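(* Let $n\ge 2$, $k_1,k_2\ge0$ and $0\le\alpha\le n-1$. The number of NBC bases of the gain graph $K_n^{[-k_2,k_1+k_2]}$ with activity $\alpha$ equals the number of $(k_1+1,k_2)$-decreasing $(k_1+1+k_2)$-colored rooted trees on $[n]$ having exactly $\alpha$ edges of the form $(n,i)$ colored $1$. In particular, the number of bounded regions of the arrangement associated with $K_n^{[-k_2,k_1+k_2]}$ (taken in the hyperplane $x_1+\cdots+x_n=0$) equals the number of such trees with no edge of the form $(n,i)$ colored $1$.
   Context: For integers $a\le b$, $K_n^{[a,b]}$ is the gain graph (over $\mathbb Z$) with vertex set $[n]$ and, for every $1\le i<j\le n$ and every integer $g\in[a,b]$, one edge from $i$ to $j$ with gain $g$ (gain $-g$ in the reverse direction), corresponding to the hyperplane $x_j-x_i=g$ in $\mathbb R^n$; the associated arrangement consists of all these hyperplanes. A circle is balanced if the sum of the gains along it, in a fixed direction, is $0$. Fix a linear order on the edges. A broken circuit is a balanced circle minus its smallest edge. An NBC set is an edge set forming a forest of the underlying multigraph (no circles, no two parallel edges) containing no broken circuit; an NBC basis is an NBC set which is a spanning tree. For an NBC basis $B$, $e\in B$ is active if $e$ is the smallest edge among all $f$ with $(B\setminus\{e\})\cup\{f\}$ a spanning tree; the activity of $B$ is the number of active edges (the counts do not depend on the order). A $k$-colored rooted tree on $[n]$ is a set of $n-1$ triples $(u,w,c)$, $u\neq w\in[n]$, $c\in[k]$ (edge from parent $u$ to child $w$ with color $c$), each vertex a child at most once, with no cycle. For a vertex $v$ with at least one child let $c_v$ be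 the minimal color of edges from $v$ to its children. With $k=k_1'+k_2'$, the tree is $(k_1',k_2')$-decreasing if for every vertex $v$ with a child and $c_v\le k_1'$, every child $w$ joined to $v$ by an edge of color $c_v$ satisfies $w<v$. An edge of the form $(n,i)$ is one whose parent is $n$. *)

theory Defs
  imports "HOL-Analysis.Analysis"
begin

type_synonym gedge = "nat \<times> nat \<times> int"
  (* (i,j,g) with i < j : edge from i to j with gain g, i.e. hyperplane x_j - x_i = g *)

definition gain_edges :: "nat \<Rightarrow> int \<Rightarrow> int \<Rightarrow> gedge set" where
  "gain_edges n a b = {(i,j,g). 1 \<le> i \<and> i < j \<and> j \<le> n \<and> a \<le> g \<and> g \<le> b}"

definition ends :: "gedge \<Rightarrow> nat set" where
  "ends e = {fst e, fst (snd e)}"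

(* gain of edge e traversed starting at vertex u *)
definition dgain :: "gedge \<Rightarrow> nat \<Rightarrow> int" where
  "dgain e u = (if fst e = u then snd (snd e) else - snd (snd e))"

(* a closed walk v_0 e_0 v_1 ... v_{m-1} e_{m-1} v_0 with distinct vertices and distinct edges *)
definition circle_seq :: "nat list \<Rightarrow> gedge list \<Rightarrow> bool" where
  "circle_seq vs es \<longleftrightarrow> 2 \<le> length vs \<and> length es = length vs \<and> distinct vs \<and> distinct es \<and>
     (\<forall>t < length vs. ends (es ! t) = {vs ! t, vs ! ((t + 1) mod length vs)})"

definition is_circle :: "gedge set \<Rightarrow> gedge set \<Rightarrow> bool" where
  "is_circle E C \<longleftrightarrow> C \<subseteq> E \<and> (\<exists>vs es. circle_seq vs es \<and> set es = C)"

definition balanced_circle :: "gedge set \<Rightarrow> gedge set \<Rightarrow> bool" where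
  "balanced_circle E C \<longleftrightarrow> C \<subseteq> E \<and>
     (\<exists>vs es. circle_seq vs es \<and> set es = C \<and> (\<Sum>t < length vs. dgain (es ! t) (vs ! t)) = 0)"

(* circle minus its smallest edge w.r.t. the (injective) ranking ord *)
definition broken_circuit :: "(gedge \<Rightarrow> nat) \<Rightarrow> gedge set \<Rightarrow> gedge set" where
  "broken_circuit ord C = {e \<in> C. \<exists>f \<in> C. ord f < ord e}"

definition is_forest :: "gedge set \<Rightarrow> gedge set \<Rightarrow> bool" where
  "is_forest E S \<longleftrightarrow> S \<subseteq> E \<and> \<not> (\<exists>C \<subseteq> S. is_circle E C)"

definition adj :: "gedge set \<Rightarrow> (nat \<times> nat) set" where
  "adj S = {(i,j). \<exists>g. (i,j,g) \<in> S \<or> (j,i,g) \<in> S}"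

definition spanning_tree :: "nat \<Rightarrow> gedge set \<Rightarrow> gedge set \<Rightarrow> bool" where
  "spanning_tree n E S \<longleftrightarrow> is_forest E S \<and> (\<forall>u \<in> {1..n}. \<forall>v \<in> {1..n}. (u,v) \<in> (adj S)\<^sup>*)"

definition nbc_set :: "gedge set \<Rightarrow> (gedge \<Rightarrow> nat) \<Rightarrow> gedge set \<Rightarrow> bool" where
  "nbc_set E ord S \<longleftrightarrow> is_forest E S \<and>
     (\<forall>C. balanced_circle E C \<longrightarrow> \<not> broken_circuit ord C \<subseteq> S)"

definition nbc_basis :: "nat \<Rightarrow> gedge set \<Rightarrow> (gedge \<Rightarrow> nat) \<Rightarrow> gedge set \<Rightarrow> bool" where
  "nbc_basis n E ord B \<longleftrightarrow> nbc_set E ord B \<and> spanning_tree n E B"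

definition active :: "nat \<Rightarrow> gedge set \<Rightarrow> (gedge \<Rightarrow> nat) \<Rightarrow> gedge set \<Rightarrow> gedge \<Rightarrow> bool" where
  "active n E ord B e \<longleftrightarrow> e \<in> B \<and>
     (\<forall>f \<in> E. spanning_tree n E ((B - {e}) \<union> {f}) \<longrightarrow> ord e \<le> ord f)"

definition activity :: "nat \<Rightarrow> gedge set \<Rightarrow> (gedge \<Rightarrow> nat) \<Rightarrow> gedge set \<Rightarrow> nat" where
  "activity n E ord B = card {e \<in> B. active n E ord B e}"

(* k-colored rooted trees: triples (parent, child, color) *)
definition colored_rooted_tree :: "nat \<Rightarrow> nat \<Rightarrow> (nat \<times> nat \<times> nat) set \<Rightarrow> bool" where
  "colored_rooted_tree n k T \<longleftrightarrow>
     T \<subseteq> {(u,w,c). u \<in> {1..n} \<and> w \<in> {1..n} \<and> u \<noteq> w \<and> c \<in> {1..k}} \<and>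
     card T = n - 1 \<and>
     (\<forall>u w c u' c'. (u,w,c) \<in> T \<longrightarrow> (u',w,c') \<in> T \<longrightarrow> u = u' \<and> c = c') \<and>
     acyclic {(u,w). \<exists>c. (u,w,c) \<in> T}"

definition min_child_color :: "(nat \<times> nat \<times> nat) set \<Rightarrow> nat \<Rightarrow> nat" where
  "min_child_color T v = Min {c. \<exists>w. (v,w,c) \<in> T}"

definition decreasing_tree :: "nat \<Rightarrow> nat \<Rightarrow> nat \<Rightarrow> (nat \<times> nat \<times> nat) set \<Rightarrow> bool" where
  "decreasing_tree n k1' k2' T \<longleftrightarrow> colored_rooted_tree n (k1' + k2') T \<and>
     (\<forall>v. (\<exists>w c. (v,w,c) \<in> T) \<longrightarrow> min_child_color T v \<le> k1' \<longrightarrow>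
        (\<forall>w. (v, w, min_child_color T v) \<in> T \<longrightarrow> w < v))"

definition n_root_color1_edges :: "nat \<Rightarrow> (nat \<times> nat \<times> nat) set \<Rightarrow> nat" where
  "n_root_color1_edges n T = card {(u,w,c) \<in> T. u = n \<and> c = 1}"

(* hyperplane arrangement in R^n; coordinates indexed via a bijection idx : {1..n} -> 'n *)
definition arr_hyperplanes :: "(nat \<Rightarrow> 'n::finite) \<Rightarrow> gedge set \<Rightarrow> (real^'n) set set" where
  "arr_hyperplanes idx E = {{x. x $ idx j - x $ idx i = of_int g} | i j g. (i,j,g) \<in> E}"

definition sum_zero_space :: "(real^'n::finite) set" where
  "sum_zero_space = {x. (\<Sum>i\<in>UNIV. x $ i) = 0}"

(* regions of the arrangement inside the ambient set V *)
definition arr_regions :: "(real^'n::finite) set \<Rightarrow> (real^'n) set set \<Rightarrow> (real^'n) set set" where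
  "arr_regions V H = {connected_component_set (V - \<Union>H) x | x. x \<in> V - \<Union>H}"

definition num_bounded_regions :: "(nat \<Rightarrow> 'n::finite) \<Rightarrow> gedge set \<Rightarrow> nat" where
  "num_bounded_regions idx E =
     card {R \<in> arr_regions (sum_zero_space :: (real^'n) set) (arr_hyperplanes idx E). bounded R}"

end

theory Submission
  imports Defs "HOL-Combinatorics.Multiset_Permutations" "HOL-Combinatorics.Stirling"
    "HOL-Computational_Algebra.Polynomial"
begin

text \<open>
  Write \<open>q\<close> for a large integer and \<open>y = 1 - q\<close>. Deletion and contraction of the largest remaining edge
  characterize the generating polynomial of NBC bases by activity. At \<open>y\<close> its value is, up to a sign
  and the factor \<open>q\<close>, the number of colourings of the vertices by integers modulo \<open>q\<close> that avoid all
  hyperplanes, and at \<open>0\<close> it is the number of bounded regions. In a colouring two cyclically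
  consecutive vertices are at distance more than \<open>k2\<close>, and more than \<open>k1 + k2\<close> at an ascent, so the
  colourings are counted by a sum of binomial coefficients over permutations of \<open>{1..n-1}\<close> that
  depends only on the number of ascents.

  On the other side, rooted trees in which the weight of an edge depends only on the parent and on
  whether the child is smaller or larger have a product formula, obtained by removing the smallest
  vertex. The colour condition of decreasing trees is a signed sum of such weights. Both sides expand
  into the same sum of Stirling numbers times rising factorials, so the two polynomials agree at
  infinitely many points.
\<close>

section \<open>Ascents of permutations\<close>

fun ascents :: "'a::linorder list \<Rightarrow> nat" where
  "ascents (x # y # zs) = of_bool (x < y) + ascents (y # zs)"
| "ascents xs = 0"

lemma ascents_le_length: "ascents xs \<le> length xs"
  by (induction xs rule: ascents.induct) auto

lemma ascents_Cons_less_length: "ascents (x # xs) \<le> length xs"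
  by (induction xs arbitrary: x) (auto simp: le_SucI)

lemma sum_ascents_Cons_insert_max:
  fixes F :: "nat \<Rightarrow> 'b::comm_semiring_1"
  assumes "\<forall>y\<in>set (x # xs). y < m"
  shows "(\<Sum>i\<le>length xs. F (ascents (x # take i xs @ m # drop i xs)))
       = of_nat (ascents (x # xs)) * F (ascents (x # xs))
         + of_nat (length (x # xs) - ascents (x # xs)) * F (ascents (x # xs) + 1)"
  using assms
proof (induction xs arbitrary: x F)
  case (Cons y zs)
  let ?insert = "\<lambda>i. y # take i zs @ m # drop i zs" and ?c = "of_bool (x < y)"
  have "(\<Sum>i\<le>length (y # zs). F (ascents (x # take i (y # zs) @ m # drop i (y # zs))))
      = F (ascents (x # m # y # zs)) + (\<Sum>i\<le>length zs. F (?c + ascents (?insert i)))"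
    by (simp add: sum.atMost_Suc_shift del: sum.atMost_Suc)
  also have "ascents (x # m # y # zs) = ascents (y # zs) + 1"
    using Cons.prems by auto
  also have "(\<Sum>i\<le>length zs. F (?c + ascents (?insert i)))
      = of_nat (ascents (y # zs)) * F (?c + ascents (y # zs))
        + of_nat (length (y # zs) - ascents (y # zs)) * F (?c + (ascents (y # zs) + 1))"
    using Cons.IH[of y "\<lambda>a. F (?c + a)"] Cons.prems by simp
  finally show ?case
    using ascents_Cons_less_length[of y zs]
    by (cases "x < y") (auto simp: Suc_diff_le algebra_simps)
qed simp

lemma sum_ascents_insert_max:
  fixes F :: "nat \<Rightarrow> 'b::comm_semiring_1"
  assumes "\<forall>x\<in>set xs. x < m"
  shows "(\<Sum>i\<le>length xs. F (ascents (take i xs @ m # drop i xs)))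
       = of_nat (ascents xs + 1) * F (ascents xs)
         + of_nat (length xs - ascents xs) * F (ascents xs + 1)"
proof (cases xs)
  case (Cons y zs)
  then show ?thesis
    using assms sum_ascents_Cons_insert_max[of y zs m F]
    by (auto simp: sum.atMost_Suc_shift algebra_simps simp del: sum.atMost_Suc)
qed simp

lemma bij_betw_permutations_of_set_insert:
  assumes "finite A" "a \<notin> A"
  shows "bij_betw (\<lambda>(xs, i). take i xs @ a # drop i xs)
    (permutations_of_set A \<times> {..card A}) (permutations_of_set (insert a A))"
  unfolding bij_betw_def
proof
  let ?f = "\<lambda>(xs, i). take i xs @ a # drop i xs" and ?I = "permutations_of_set A \<times> {..card A}"
  have perm: "length xs = card A" "a \<notin> set xs" if "xs \<in> permutations_of_set A" for xs
    using that assms length_finite_permutations_of_set[OF that] by (auto dest: permutations_of_setD)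
  show inj: "inj_on ?f ?I"
  proof (rule inj_onI, clarify)
    fix xs i ys l
    assume xs: "xs \<in> permutations_of_set A" "i \<le> card A"
      and ys: "ys \<in> permutations_of_set A" "l \<le> card A"
      and eq: "take i xs @ a # drop i xs = take l ys @ a # drop l ys"
    have "a \<notin> set (take i xs)" "a \<notin> set (drop i xs)"
      using perm[OF xs(1)] by (auto dest: in_set_takeD in_set_dropD)
    then have parts: "take i xs = take l ys" "drop i xs = drop l ys"
      using eq by (simp_all add: append_Cons_eq_iff)
    then have "xs = ys"
      by (metis append_take_drop_id)
    moreover have "i = l"
      using arg_cong[OF parts(1), of length] perm xs ys by simp
    ultimately show "xs = ys \<and> i = l" ..
  qed
  have "?f ` ?I \<subseteq> permutations_of_set (insert a A)"
  proof clarify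
    fix xs i assume xs: "xs \<in> permutations_of_set A"
    have "mset (take i xs @ a # drop i xs) = mset (a # xs)"
      by (metis append_take_drop_id mset.simps(2) mset_append union_mset_add_mset_right)
    then have "set (take i xs @ a # drop i xs) = set (a # xs)"
      "distinct (take i xs @ a # drop i xs) = distinct (a # xs)"
      by (metis set_mset_mset, metis mset_eq_imp_distinct_iff)
    then show "take i xs @ a # drop i xs \<in> permutations_of_set (insert a A)"
      using xs assms(2) by (auto simp: permutations_of_set_def)
  qed
  moreover have "card (?f ` ?I) = card (permutations_of_set (insert a A))"
    using assms by (simp add: card_image[OF inj] card_cartesian_product algebra_simps)
  ultimately show "?f ` ?I = permutations_of_set (insert a A)"
    by (simp add: card_subset_eq)
qed

lemma sum_permutations_insert_max:
  fixes F :: "nat \<Rightarrow> 'b::comm_semiring_1"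
  assumes "finite A" and less: "\<forall>x\<in>A. x < m"
  shows "(\<Sum>xs\<in>permutations_of_set (insert m A). F (ascents xs))
       = (\<Sum>xs\<in>permutations_of_set A. of_nat (ascents xs + 1) * F (ascents xs)
            + of_nat (card A - ascents xs) * F (ascents xs + 1))"
proof -
  have "m \<notin> A"
    using less by auto
  have "(\<Sum>xs\<in>permutations_of_set (insert m A). F (ascents xs))
     = (\<Sum>xs\<in>permutations_of_set A. \<Sum>i\<le>card A. F (ascents (take i xs @ m # drop i xs)))"
    unfolding sum.cartesian_product
    by (subst sum.reindex_bij_betw[OF bij_betw_permutations_of_set_insert[OF \<open>finite A\<close> \<open>m \<notin> A\<close>],
          symmetric]) (simp add: split_def)
  also have "\<dots> = (\<Sum>xs\<in>permutations_of_set A. of_nat (ascents xs + 1) * F (ascents xs)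
            + of_nat (card A - ascents xs) * F (ascents xs + 1))"
  proof (intro sum.cong refl)
    fix xs assume xs: "xs \<in> permutations_of_set A"
    then show "(\<Sum>i\<le>card A. F (ascents (take i xs @ m # drop i xs)))
        = of_nat (ascents xs + 1) * F (ascents xs)
            + of_nat (card A - ascents xs) * F (ascents xs + 1)"
      using sum_ascents_insert_max[of xs m F] less length_finite_permutations_of_set[OF xs]
      by (auto dest: permutations_of_setD)
  qed
  finally show ?thesis .
qed

lemma ascents_le_card: "xs \<in> permutations_of_set A \<Longrightarrow> ascents xs \<le> card A"
  using ascents_le_length[of xs] length_finite_permutations_of_set[of xs A] by simp

lemma choose_Suc_weighted_sum:
  assumes "a \<le> j"
  shows "(a + 1) * (a choose Suc i) + (j - a) * (Suc a choose Suc i)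
    = (j - i) * (Suc a choose Suc i)"
proof (cases "i \<le> a")
  case True
  have "(a + 1) * (a choose Suc i) = (a - i) * (Suc a choose Suc i)"
    using binomial_absorb_comp[of "Suc a" "Suc i"] by simp
  then have "(a + 1) * (a choose Suc i) + (j - a) * (Suc a choose Suc i)
      = ((a - i) + (j - a)) * (Suc a choose Suc i)"
    by (simp only: add_mult_distrib)
  also have "(a - i) + (j - a) = j - i"
    using True assms by simp
  finally show ?thesis .
qed (simp add: binomial_eq_0)

lemma sum_ascents_choose_Suc_insert_max:
  fixes A :: "'a::linorder set"
  assumes "finite A" "\<forall>a\<in>A. a < m"
  shows "(\<Sum>xs\<in>permutations_of_set (insert m A). ascents xs choose Suc i)
    = (card A - i) * ((\<Sum>xs\<in>permutations_of_set A. ascents xs choose i)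
        + (\<Sum>xs\<in>permutations_of_set A. ascents xs choose Suc i))"
proof -
  have "(\<Sum>xs\<in>permutations_of_set (insert m A). ascents xs choose Suc i)
      = (\<Sum>xs\<in>permutations_of_set A. (ascents xs + 1) * (ascents xs choose Suc i)
           + (card A - ascents xs) * (Suc (ascents xs) choose Suc i))"
    using sum_permutations_insert_max[OF assms, of "\<lambda>a. a choose Suc i"] by simp
  also have "\<dots> = (\<Sum>xs\<in>permutations_of_set A. (card A - i) *
      ((ascents xs choose i) + (ascents xs choose Suc i)))"
    by (intro sum.cong refl)
      (simp only: choose_Suc_weighted_sum ascents_le_card flip: binomial_Suc_Suc)
  finally show ?thesis
    by (simp only: sum.distrib flip: sum_distrib_left)
qed

theorem sum_ascents_choose:
  fixes A :: "'a::linorder set"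
  assumes "finite A" "i \<le> card A"
  shows "(\<Sum>xs\<in>permutations_of_set A. ascents xs choose i)
    = fact (card A - i) * Stirling (card A) (card A - i)"
  using assms
proof (induction A arbitrary: i rule: finite_linorder_max_induct)
  case empty
  then show ?case by simp
next
  case (insert m A)
  have card: "card (insert m A) = Suc (card A)"
    using insert.hyps by auto
  show ?case
  proof (cases i)
    case 0
    then show ?thesis
      using insert.hyps(1) by (simp add: card)
  next
    case (Suc i')
    note rec = sum_ascents_choose_Suc_insert_max[OF insert.hyps(1,2), of i', folded Suc]
    show ?thesis
    proof (cases "i' = card A")
      case True
      then show ?thesis
        using rec Suc by (simp add: card)
    next
      case False
      then have le: "i \<le> card A" "i' \<le> card A"
        using insert.prems Suc by (auto simp: card)
      define r where "r = card A - i"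
      have "card A - i = r" "card A - i' = Suc r" "Suc (card A) - i = Suc r"
        using le Suc by (auto simp: r_def)
      then show ?thesis
        using rec insert.IH[OF le(1)] insert.IH[OF le(2)] by (simp add: card algebra_simps)
    qed
  qed
qed

section \<open>Composition sums and rising factorials\<close>

text \<open>The sum of \<open>f (m\<^sub>1 + \<dots> + m\<^sub>i)\<close> over all \<open>m\<^sub>1, \<dots>, m\<^sub>i\<close> in \<open>{1..k}\<close>.\<close>

primrec composition_sum :: "nat \<Rightarrow> nat \<Rightarrow> (nat \<Rightarrow> 'a::comm_ring_1) \<Rightarrow> 'a" where
  "composition_sum k 0 f = f 0"
| "composition_sum k (Suc i) f = (\<Sum>m=1..k. composition_sum k i (\<lambda>s. f (m + s)))"

lemma composition_sum_add:
  "composition_sum k i (\<lambda>s. f s + g s) = composition_sum k i f + composition_sum k i g"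
  by (induction i arbitrary: f g) (auto simp: sum.distrib)

lemma composition_sum_mult_left:
  "composition_sum k i (\<lambda>s. c * f s) = c * composition_sum k i f"
  by (induction i arbitrary: f) (auto simp: sum_distrib_left)

lemma composition_sum_diff:
  "composition_sum k i (\<lambda>s. f s - g s) = composition_sum k i f - composition_sum k i g"
  by (induction i arbitrary: f g) (auto simp: sum_subtractf)

lemma composition_sum_sum:
  "composition_sum k i (\<lambda>s. \<Sum>m\<in>A. f m s) = (\<Sum>m\<in>A. composition_sum k i (f m))"
  by (induction i arbitrary: f) (auto intro: sum.swap)

definition multichoose :: "'a::field_char_0 \<Rightarrow> nat \<Rightarrow> 'a" where
  "multichoose X j = pochhammer X j / fact j"

lemma gbinomial_eq_multichoose: "a gchoose j = (- 1) ^ j * multichoose (- a) j"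
  by (simp add: multichoose_def gbinomial_pochhammer)

lemma multichoose_Suc_add1:
  "multichoose (X + 1) (Suc j) = multichoose X (Suc j) + multichoose (X + 1) j"
proof -
  have "pochhammer (X + 1) (Suc j) = pochhammer X (Suc j) + (1 + of_nat j) * pochhammer (X + 1) j"
    by (subst pochhammer_rec, subst pochhammer_Suc) (simp add: algebra_simps)
  moreover have "(1 + of_nat j :: 'a) \<noteq> 0"
    using of_nat_neq_0[of j, where 'a = 'a] by simp
  ultimately show ?thesis
    by (simp add: multichoose_def add_divide_distrib)
qed

lemma multichoose_Suc_add:
  "multichoose (X + of_nat k) (Suc j)
    = multichoose X (Suc j) + (\<Sum>m=1..k. multichoose (X + of_nat m) j)"
proof (induction k)
  case (Suc k)
  then show ?case
    using multichoose_Suc_add1[of "X + of_nat k" j] by (simp add: add_ac)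
qed simp

lemma multichoose_add_mult:
  assumes "a \<le> j"
  shows "multichoose (X + of_nat k * of_nat a) j
    = (\<Sum>i\<le>a. of_nat (a choose i) * composition_sum k i (\<lambda>s. multichoose (X + of_nat s) (j - i)))"
  using assms
proof (induction a arbitrary: X)
  case (Suc a)
  let ?c = "\<lambda>i. composition_sum k i (\<lambda>s. multichoose (X + of_nat s) (j - i))"
  have shift: "composition_sum k i (\<lambda>s. multichoose (X + of_nat k + of_nat s) (j - i))
      = ?c i + ?c (Suc i)"
    if "i \<le> a" for i
  proof -
    have j: "j - i = Suc (j - Suc i)"
      using that Suc.prems by auto
    have "multichoose (X + of_nat k + of_nat s) (j - i) = multichoose (X + of_nat s) (j - i)
        + (\<Sum>m=1..k. multichoose (X + of_nat (m + s)) (j - Suc i))" for s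
      unfolding j using multichoose_Suc_add[of "X + of_nat s" k "j - Suc i"] by (simp add: add_ac)
    then show ?thesis
      by (simp add: composition_sum_add composition_sum_sum)
  qed
  have "multichoose (X + of_nat k * of_nat (Suc a)) j
      = multichoose ((X + of_nat k) + of_nat k * of_nat a) j"
    by (simp add: algebra_simps)
  also have "\<dots> = (\<Sum>i\<le>a. of_nat (a choose i) * (?c i + ?c (Suc i)))"
    using Suc shift by (subst Suc.IH) auto
  also have "\<dots> = (\<Sum>i\<le>Suc a. of_nat (a choose i) * ?c i) + (\<Sum>i\<le>a. of_nat (a choose i) * ?c (Suc i))"
    by (simp add: algebra_simps sum.distrib)
  also have "(\<Sum>i\<le>Suc a. of_nat (a choose i) * ?c i)
      = ?c 0 + (\<Sum>i\<le>a. of_nat (a choose Suc i) * ?c (Suc i))"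
    by (subst sum.atMost_Suc_shift) simp
  also have "\<dots> + (\<Sum>i\<le>a. of_nat (a choose i) * ?c (Suc i))
      = ?c 0 + (\<Sum>i\<le>a. of_nat (Suc a choose Suc i) * ?c (Suc i))"
    by (simp add: algebra_simps sum.distrib)
  also have "\<dots> = (\<Sum>i\<le>Suc a. of_nat (Suc a choose i) * ?c i)"
    by (subst sum.atMost_Suc_shift) simp
  finally show ?case .
qed simp

definition stirling_sum ::
  "nat \<Rightarrow> nat \<Rightarrow> (nat \<Rightarrow> 'a::comm_ring_1) \<Rightarrow> (nat \<Rightarrow> 'a) \<Rightarrow> 'a" where
  "stirling_sum k j f h =
     (\<Sum>r\<le>j. of_nat (Stirling j r) * composition_sum k (j - r) (\<lambda>s. f s * pochhammer (h s) r))"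

theorem sum_multichoose_ascents:
  fixes A :: "'a::linorder set" and X :: "'b::field_char_0"
  assumes "finite A"
  shows "(\<Sum>xs\<in>permutations_of_set A. multichoose (X + of_nat k * of_nat (ascents xs)) (card A))
    = stirling_sum k (card A) (\<lambda>_. 1) (\<lambda>s. X + of_nat s)"
proof -
  let ?j = "card A"
  let ?c = "\<lambda>i. composition_sum k i (\<lambda>s. multichoose (X + of_nat s) (?j - i))"
  let ?p = "\<lambda>i. composition_sum k i (\<lambda>s. pochhammer (X + of_nat s) (?j - i))"
  have expand: "multichoose (X + of_nat k * of_nat (ascents xs)) ?j
      = (\<Sum>i\<le>?j. of_nat (ascents xs choose i) * ?c i)" if xs: "xs \<in> permutations_of_set A" for xs
  proof -
    have le: "ascents xs \<le> ?j"
      using ascents_le_length[of xs] length_finite_permutations_of_set[OF xs] by simp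
    show ?thesis
      unfolding multichoose_add_mult[OF le] by (rule sum.mono_neutral_left) (use le in auto)
  qed
  have coefficient: "of_nat (\<Sum>xs\<in>permutations_of_set A. ascents xs choose i) * ?c i
      = of_nat (Stirling ?j (?j - i)) * ?p i" if "i \<le> ?j" for i
  proof -
    have "?p i = fact (?j - i) * ?c i"
      by (subst composition_sum_mult_left[symmetric]) (simp add: multichoose_def)
    then show ?thesis
      using sum_ascents_choose[OF assms that] by simp
  qed
  have "(\<Sum>xs\<in>permutations_of_set A. multichoose (X + of_nat k * of_nat (ascents xs)) ?j)
      = (\<Sum>i\<le>?j. of_nat (\<Sum>xs\<in>permutations_of_set A. ascents xs choose i) * ?c i)"
    by (simp add: expand sum_distrib_right sum.swap[of _ "{..?j}"])
  also have "\<dots> = (\<Sum>i\<le>?j. of_nat (Stirling ?j (?j - i)) * ?p i)"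
    by (intro sum.cong refl) (use coefficient in auto)
  also have "\<dots> = stirling_sum k ?j (\<lambda>_. 1) (\<lambda>s. X + of_nat s)"
    unfolding stirling_sum_def
    by (rule sum.reindex_bij_witness[of _ "\<lambda>r. ?j - r" "\<lambda>r. ?j - r"]) auto
  finally show ?thesis .
qed

section \<open>Weighted rooted forests\<close>

text \<open>A rooted forest on \<open>S\<close> is encoded by its parent map: its roots are the vertices in
  \<open>S - dom p\<close>.\<close>

definition parent_rel :: "('a \<rightharpoonup> 'a) \<Rightarrow> ('a \<times> 'a) set" where
  "parent_rel p = {(u, w). p w = Some u}"

definition rooted_forests :: "'a set \<Rightarrow> ('a \<rightharpoonup> 'a) set" where
  "rooted_forests S = {p. dom p \<subseteq> S \<and> ran p \<subseteq> S \<and> acyclic (parent_rel p)}"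

definition rooted_trees :: "'a set \<Rightarrow> ('a \<rightharpoonup> 'a) set" where
  "rooted_trees S = {p \<in> rooted_forests S. card (S - dom p) = 1}"

definition forest_weight :: "('a \<Rightarrow> 'a \<Rightarrow> 'b::comm_semiring_1) \<Rightarrow> ('a \<rightharpoonup> 'a) \<Rightarrow> 'b" where
  "forest_weight wt p = (\<Prod>w\<in>dom p. wt (the (p w)) w)"

text \<open>One root is not counted, so that the value at \<open>0\<close> is the sum over trees.\<close>

definition forest_polynomial :: "('a \<Rightarrow> 'a \<Rightarrow> 'b::comm_semiring_1) \<Rightarrow> 'a set \<Rightarrow> 'b \<Rightarrow> 'b" where
  "forest_polynomial wt S u =
     (\<Sum>p\<in>rooted_forests S. u ^ (card (S - dom p) - 1) * forest_weight wt p)"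

lemma rooted_forestsD:
  assumes "p \<in> rooted_forests S"
  shows "dom p \<subseteq> S" "p w = Some u \<Longrightarrow> u \<in> S" "p w = Some u \<Longrightarrow> u \<noteq> w" "acyclic (parent_rel p)"
  using assms by (auto simp: rooted_forests_def ran_def parent_rel_def acyclic_def)

lemma parent_rel_subset: "p \<in> rooted_forests S \<Longrightarrow> parent_rel p \<subseteq> S \<times> S"
  by (auto simp: rooted_forests_def parent_rel_def ran_def)

lemma finite_rooted_forests:
  assumes "finite S" shows "finite (rooted_forests S)"
proof (rule finite_subset)
  show "rooted_forests S \<subseteq> (\<Union>D\<in>Pow S. {p. dom p = D \<and> ran p \<subseteq> S})"
    by (auto simp: rooted_forests_def)
  show "finite (\<Union>D\<in>Pow S. {p :: 'a \<rightharpoonup> 'a. dom p = D \<and> ran p \<subseteq> S})"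
    using assms by (auto intro!: finite_set_of_finite_maps intro: finite_subset)
qed

lemma ex_forest_root:
  assumes "finite S" and p: "p \<in> rooted_forests S" and "q \<in> S"
  shows "\<exists>r\<in>S - dom p. (r, q) \<in> (parent_rel p)\<^sup>*"
proof -
  have "wf (parent_rel p)"
    using finite_acyclic_wf finite_subset[OF parent_rel_subset[OF p]]
      rooted_forestsD(4)[OF p] assms(1)
    by blast
  then show ?thesis
    using \<open>q \<in> S\<close>
  proof (induction q rule: wf_induct_rule)
    case (less q)
    show ?case
    proof (cases "p q")
      case None
      then show ?thesis
        using less.prems by blast
    next
      case (Some u)
      then have "(u, q) \<in> parent_rel p" "u \<in> S"
        using rooted_forestsD(2)[OF p] by (auto simp: parent_rel_def)
      then show ?thesis
        using less.IH rtrancl_into_rtrancl by metis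
    qed
  qed
qed

lemma forest_root_unique:
  assumes "r \<notin> dom p" "r' \<notin> dom p" "(r, q) \<in> (parent_rel p)\<^sup>*" "(r', q) \<in> (parent_rel p)\<^sup>*"
  shows "r = r'"
proof -
  have no_parent: "x = s" if "s \<notin> dom p" "(x, s) \<in> (parent_rel p)\<^sup>*" for x s
    using that(2,1) by (cases rule: rtranclE) (auto simp: parent_rel_def)
  have "single_valued ((parent_rel p)\<inverse>)"
    by (auto simp: single_valued_def parent_rel_def)
  then have "(r, r') \<in> (parent_rel p)\<^sup>* \<or> (r', r) \<in> (parent_rel p)\<^sup>*"
    using single_valued_confluent[of "(parent_rel p)\<inverse>" q r r'] assms(3,4)
    by (auto simp: rtrancl_converse)
  then show ?thesis
    using no_parent assms(1,2) by blast
qed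

lemma card_forest_roots_pos:
  assumes "finite S" "S \<noteq> {}" "p \<in> rooted_forests S"
  shows "0 < card (S - dom p)"
proof -
  obtain q where "q \<in> S"
    using assms(2) by blast
  then show ?thesis
    using ex_forest_root[OF assms(1,3)] assms(1) by (auto simp: card_gt_0_iff)
qed

lemma forest_polynomial_0:
  assumes "finite S" "S \<noteq> {}"
  shows "forest_polynomial wt S 0 = (\<Sum>p\<in>rooted_trees S. forest_weight wt p)"
proof -
  have "forest_polynomial wt S 0
      = (\<Sum>p\<in>rooted_forests S. if card (S - dom p) = 1 then forest_weight wt p else 0)"
    unfolding forest_polynomial_def using card_forest_roots_pos[OF assms]
    by (intro sum.cong refl) (force simp: power_0_left)
  then show ?thesis
    by (simp only: rooted_trees_def sum.inter_filter[OF finite_rooted_forests[OF assms(1)]])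
qed

subsection \<open>Adding a vertex\<close>

definition attach :: "'a \<Rightarrow> ('a \<rightharpoonup> 'a) \<Rightarrow> 'a set \<Rightarrow> 'a option \<Rightarrow> ('a \<rightharpoonup> 'a)" where
  "attach v p C q = (\<lambda>w. if w = v then q else if w \<in> C then Some v else p w)"

definition attachable :: "'a set \<Rightarrow> ('a \<rightharpoonup> 'a) \<Rightarrow> 'a set \<Rightarrow> 'a option set" where
  "attachable S p C = insert None (Some ` {u \<in> S. \<forall>r\<in>C. (r, u) \<notin> (parent_rel p)\<^sup>*})"

lemma acyclic_Un_star_iff:
  assumes "finite r" "finite C" "v \<notin> C" "v \<notin> Range r"
  shows "acyclic (r \<union> {v} \<times> C) \<longleftrightarrow> acyclic r"
proof
  assume "acyclic r"
  have "{v} \<times> C \<subseteq> Wellfounded.measure (\<lambda>x. if x = v then 0 else 1)"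
    using assms(3) by auto
  then have "wf ({v} \<times> C)"
    using wf_subset wf_measure by blast
  then have "wf ({v} \<times> C \<union> r)"
    using assms finite_acyclic_wf[OF _ \<open>acyclic r\<close>] by (intro wf_Un) auto
  then show "acyclic (r \<union> {v} \<times> C)"
    by (simp add: wf_acyclic Un_commute)
qed (auto elim: acyclic_subset)

lemma reachable_through_star_iff:
  assumes "v \<notin> Domain r" "u \<noteq> v"
  shows "(v, u) \<in> (r \<union> {v} \<times> C)\<^sup>* \<longleftrightarrow> (\<exists>c\<in>C. (c, u) \<in> r\<^sup>*)"
proof
  assume "(v, u) \<in> (r \<union> {v} \<times> C)\<^sup>*"
  then have "u = v \<or> (\<exists>c\<in>C. (c, u) \<in> r\<^sup>*)"
  proof induction
    case (step y z)
    then show ?case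
      using assms(1) by (auto intro: rtrancl_into_rtrancl)
  qed simp
  then show "\<exists>c\<in>C. (c, u) \<in> r\<^sup>*"
    using assms(2) by simp
next
  assume "\<exists>c\<in>C. (c, u) \<in> r\<^sup>*"
  then obtain c where "c \<in> C" "(c, u) \<in> r\<^sup>*" ..
  then have "(v, c) \<in> r \<union> {v} \<times> C" "(c, u) \<in> (r \<union> {v} \<times> C)\<^sup>*"
    using rtrancl_mono[of r "r \<union> {v} \<times> C"] by auto
  then show "(v, u) \<in> (r \<union> {v} \<times> C)\<^sup>*"
    by (rule converse_rtrancl_into_rtrancl)
qed

lemma parent_rel_attach:
  assumes "v \<notin> dom p" "v \<notin> C" "C \<inter> dom p = {}"
  shows "parent_rel (attach v p C q) = parent_rel p \<union> {v} \<times> C \<union> (\<lambda>u. (u, v)) ` set_option q"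
  using assms by (auto simp: parent_rel_def attach_def dom_def split: if_splits)

lemma acyclic_parent_rel_attach_iff:
  assumes "finite S" and p: "dom p \<subseteq> S" "ran p \<subseteq> S" and v: "v \<notin> S"
    and C: "C \<subseteq> S - dom p" and q: "q \<in> insert None (Some ` S)"
  shows "acyclic (parent_rel (attach v p C q)) \<longleftrightarrow> acyclic (parent_rel p) \<and> q \<in> attachable S p C"
proof -
  have sub: "parent_rel p \<subseteq> S \<times> S"
    using p by (auto simp: parent_rel_def ran_def)
  have fin: "finite (parent_rel p)" "finite C"
    using finite_subset[OF sub] finite_subset[OF C] \<open>finite S\<close> by auto
  have rel: "parent_rel (attach v p C q) = parent_rel p \<union> {v} \<times> C \<union> (\<lambda>u. (u, v)) ` set_option q"
    using p v C by (intro parent_rel_attach) auto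
  have star: "acyclic (parent_rel p \<union> {v} \<times> C) \<longleftrightarrow> acyclic (parent_rel p)"
    using acyclic_Un_star_iff[OF fin] C v sub by blast
  show ?thesis
  proof (cases q)
    case None
    then show ?thesis
      using rel star by (simp add: attachable_def)
  next
    case (Some u)
    then have u: "u \<in> S" "u \<noteq> v"
      using q v by auto
    moreover have "v \<notin> Domain (parent_rel p)"
      using sub v by blast
    ultimately show ?thesis
      using Some rel star reachable_through_star_iff[of v "parent_rel p" u C]
      by (auto simp: attachable_def acyclic_insert)
  qed
qed

lemma attach_in_rooted_forests:
  assumes "finite S" "v \<notin> S" and p: "p \<in> rooted_forests S" and C: "C \<subseteq> S - dom p"
    and q: "q \<in> attachable S p C"
  shows "attach v p C q \<in> rooted_forests (insert v S)"
proof -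
  have "acyclic (parent_rel (attach v p C q))"
    using acyclic_parent_rel_attach_iff[OF assms(1) _ _ assms(2) C] p q
    by (auto simp: rooted_forests_def attachable_def)
  then show ?thesis
    using p C q
    by (fastforce simp: rooted_forests_def attach_def attachable_def ran_def split: if_splits)
qed

lemma rooted_forests_insertE:
  assumes "finite S" "v \<notin> S" and p: "p \<in> rooted_forests (insert v S)"
  obtains p' C where "p' \<in> rooted_forests S" "C \<subseteq> S - dom p'" "p v \<in> attachable S p' C"
    "p = attach v p' C (p v)"
proof
  let ?p' = "p |` {w. w \<noteq> v \<and> p w \<noteq> Some v}" and ?C = "{w \<in> S. p w = Some v}"
  have "p v \<noteq> Some v"
    using rooted_forestsD(3)[OF p] by blast
  then show eq: "p = attach v ?p' ?C (p v)"
    using rooted_forestsD(1)[OF p] by (auto simp: attach_def restrict_map_def fun_eq_iff)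
  show C: "?C \<subseteq> S - dom ?p'"
    by auto
  have p': "dom ?p' \<subseteq> S"
    unfolding dom_restrict using rooted_forestsD(1)[OF p] by blast
  moreover have "ran ?p' \<subseteq> S"
    using rooted_forestsD(2)[OF p] by (auto simp: ran_def restrict_map_def)
  moreover have "p v \<in> insert None (Some ` S)"
    using rooted_forestsD(2)[OF p, of v] \<open>p v \<noteq> Some v\<close> by (cases "p v") auto
  moreover have "acyclic (parent_rel (attach v ?p' ?C (p v)))"
    using rooted_forestsD(4)[OF p] eq by simp
  ultimately have "acyclic (parent_rel ?p') \<and> p v \<in> attachable S ?p' ?C"
    using acyclic_parent_rel_attach_iff[OF assms(1) _ _ assms(2) C] by blast
  with p' \<open>ran ?p' \<subseteq> S\<close> show "?p' \<in> rooted_forests S" "p v \<in> attachable S ?p' ?C"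
    by (simp_all add: rooted_forests_def)
qed

lemma attach_inject:
  assumes "v \<notin> S" and p: "p \<in> rooted_forests S" "p' \<in> rooted_forests S"
    and C: "C \<subseteq> S - dom p" "C' \<subseteq> S - dom p'" and eq: "attach v p C q = attach v p' C' q'"
  shows "p = p' \<and> C = C' \<and> q = q'"
proof -
  have no_v: "p w \<noteq> Some v" "p' w \<noteq> Some v" for w
    using p \<open>v \<notin> S\<close> by (auto simp: rooted_forests_def ran_def)
  have v_root: "v \<notin> dom p" "v \<notin> dom p'"
    using p \<open>v \<notin> S\<close> by (auto simp: rooted_forests_def)
  have "v \<notin> C" "v \<notin> C'"
    using C \<open>v \<notin> S\<close> by blast+
  then have attach: "(if w \<in> C then Some v else p w) = (if w \<in> C' then Some v else p' w)"
    if "w \<noteq> v" for w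
    using fun_cong[OF eq, of w] that by (simp add: attach_def)
  have "C = C'"
  proof (rule set_eqI)
    fix w show "w \<in> C \<longleftrightarrow> w \<in> C'"
      using attach[of w] no_v[of w] \<open>v \<notin> C\<close> \<open>v \<notin> C'\<close> by (cases "w = v") (auto split: if_splits)
  qed
  moreover have "p w = p' w" for w
  proof (cases "w = v \<or> w \<in> C")
    case True
    then have "w \<notin> dom p" "w \<notin> dom p'"
      using C v_root \<open>C = C'\<close> by blast+
    then show ?thesis
      by (simp add: domIff)
  next
    case False
    then show ?thesis
      using attach[of w] \<open>C = C'\<close> by simp
  qed
  moreover have "q = q'"
    using fun_cong[OF eq, of v] by (simp add: attach_def)
  ultimately show ?thesis
    by blast
qed

lemma bij_betw_attach:
  assumes "finite S" "v \<notin> S"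
  shows "bij_betw (\<lambda>(p, C, q). attach v p C q)
    (SIGMA p:rooted_forests S. SIGMA C:Pow (S - dom p). attachable S p C)
    (rooted_forests (insert v S))"
  unfolding bij_betw_def
proof
  let ?data = "SIGMA p:rooted_forests S. SIGMA C:Pow (S - dom p). attachable S p C"
  show "inj_on (\<lambda>(p, C, q). attach v p C q) ?data"
    by (rule inj_onI, clarify, drule attach_inject[OF assms(2), rotated -1]) auto
  show "(\<lambda>(p, C, q). attach v p C q) ` ?data = rooted_forests (insert v S)"
  proof (intro equalityI subsetI)
    fix p assume "p \<in> rooted_forests (insert v S)"
    then obtain p' C where "p' \<in> rooted_forests S" "C \<subseteq> S - dom p'" "p v \<in> attachable S p' C"
      "p = attach v p' C (p v)"
      by (rule rooted_forests_insertE[OF assms])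
    then show "p \<in> (\<lambda>(p, C, q). attach v p C q) ` ?data"
      by (intro image_eqI[of _ _ "(p', C, p v)"]) auto
  qed (auto intro: attach_in_rooted_forests[OF assms])
qed

lemma forest_weight_attach:
  assumes "finite S" "v \<notin> S" and p: "p \<in> rooted_forests S" and C: "C \<subseteq> S - dom p"
    and b: "\<And>w. w \<in> S \<Longrightarrow> wt v w = b"
  shows "forest_weight wt (attach v p C q)
    = (case q of None \<Rightarrow> 1 | Some u \<Rightarrow> wt u v) * b ^ card C * forest_weight wt p"
proof -
  let ?p = "attach v p C q"
  define V where "V = {w. w = v \<and> q \<noteq> None}"
  have fin: "finite C" "finite (dom p)" "finite V"
    using finite_subset[OF C] finite_subset[OF rooted_forestsD(1)[OF p]] assms(1)
    by (auto simp: V_def)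
  have v: "v \<notin> C" "v \<notin> dom p"
    using assms(2) C rooted_forestsD(1)[OF p] by auto
  have "dom ?p = V \<union> (C \<union> dom p)"
    using v by (auto simp: attach_def V_def dom_def)
  moreover have "V \<inter> (C \<union> dom p) = {}" "C \<inter> dom p = {}"
    using v C by (auto simp: V_def)
  ultimately have "forest_weight wt ?p = (\<Prod>w\<in>V. wt (the (?p w)) w)
      * ((\<Prod>w\<in>C. wt (the (?p w)) w) * (\<Prod>w\<in>dom p. wt (the (?p w)) w))"
    using fin by (simp add: forest_weight_def prod.union_disjoint)
  also have "(\<Prod>w\<in>V. wt (the (?p w)) w) = (case q of None \<Rightarrow> 1 | Some u \<Rightarrow> wt u v)"
    by (auto simp: V_def attach_def split: option.split)
  also have "(\<Prod>w\<in>C. wt (the (?p w)) w) = (\<Prod>w\<in>C. b)"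
    using v C b by (intro prod.cong) (auto simp: attach_def)
  also have "(\<Prod>w\<in>dom p. wt (the (?p w)) w) = forest_weight wt p"
    unfolding forest_weight_def using v C by (intro prod.cong) (auto simp: attach_def)
  finally show ?thesis
    by (simp add: mult.assoc)
qed

lemma roots_attach:
  assumes "v \<notin> S" "dom p \<subseteq> S" "C \<subseteq> S - dom p"
  shows "insert v S - dom (attach v p C q)
    = (if q = None then insert v (S - dom p - C) else S - dom p - C)"
  using assms by (auto simp: attach_def dom_def)

lemma sum_Pow_power:
  fixes u b :: "'b::comm_semiring_1"
  assumes "finite R"
  shows "(\<Sum>C\<in>Pow R. b ^ card C * u ^ card (R - C)) = (u + b) ^ card R"
  using prod_add[OF assms, of "\<lambda>_. b" "\<lambda>_. u"] by (simp add: add.commute)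

lemma sum_attach_child_sets_avoiding:
  fixes u b :: "'b::comm_semiring_1"
  assumes "finite S" and p: "p \<in> rooted_forests S" and "q \<in> S"
  shows "(\<Sum>C | C \<subseteq> S - dom p \<and> (\<forall>r\<in>C. (r, q) \<notin> (parent_rel p)\<^sup>*).
      b ^ card C * u ^ (card (S - dom p - C) - 1)) = (u + b) ^ (card (S - dom p) - 1)"
proof -
  let ?R = "S - dom p"
  obtain r where r: "r \<in> ?R" "(r, q) \<in> (parent_rel p)\<^sup>*"
    using ex_forest_root[OF assms] by blast
  have "(r', q) \<notin> (parent_rel p)\<^sup>*" if "r' \<in> ?R - {r}" for r'
    using forest_root_unique[of r' p r q] r that by blast
  then have "{C. C \<subseteq> ?R \<and> (\<forall>r\<in>C. (r, q) \<notin> (parent_rel p)\<^sup>*)} = Pow (?R - {r})"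
    using r by blast
  moreover have "card (?R - C) - 1 = card (?R - {r} - C)" if "C \<in> Pow (?R - {r})" for C
  proof -
    have "?R - C = insert r (?R - {r} - C)"
      using r(1) that by auto
    then show ?thesis
      using assms(1) by simp
  qed
  ultimately show ?thesis
    using sum_Pow_power[of "?R - {r}" b u] r(1) assms(1) by simp
qed

lemma sum_attach_choices:
  fixes u b :: "'b::comm_semiring_1"
  assumes "finite S" "S \<noteq> {}" "v \<notin> S" and p: "p \<in> rooted_forests S"
  shows "(\<Sum>C\<in>Pow (S - dom p). \<Sum>q\<in>attachable S p C.
      (case q of None \<Rightarrow> 1 | Some x \<Rightarrow> wt x v) * b ^ card C
        * u ^ (card (insert v S - dom (attach v p C q)) - 1))
    = (u + b + (\<Sum>x\<in>S. wt x v)) * (u + b) ^ (card (S - dom p) - 1)"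
proof -
  let ?R = "S - dom p" and ?avoids = "\<lambda>C x. \<forall>r\<in>C. (r, x) \<notin> (parent_rel p)\<^sup>*"
  let ?f = "\<lambda>C q. (case q of None \<Rightarrow> 1 | Some x \<Rightarrow> wt x v) * b ^ card C
        * u ^ (card (insert v S - dom (attach v p C q)) - 1)"
  have fin: "finite ?R"
    using assms(1) by simp
  have "(\<Sum>q\<in>attachable S p C. ?f C q) = b ^ card C * u ^ card (?R - C)
      + (\<Sum>x | x \<in> S \<and> ?avoids C x. wt x v * (b ^ card C * u ^ (card (?R - C) - 1)))"
    if C: "C \<in> Pow ?R" for C
  proof -
    have "(\<Sum>q\<in>attachable S p C. ?f C q) = ?f C None + (\<Sum>x | x \<in> S \<and> ?avoids C x. ?f C (Some x))"
      unfolding attachable_def using assms(1) by (subst sum.insert) (auto simp: sum.reindex)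
    then show ?thesis
      using roots_attach[OF assms(3) rooted_forestsD(1)[OF p], of C] C fin assms(3)
      by (simp add: mult.assoc)
  qed
  then have "(\<Sum>C\<in>Pow ?R. \<Sum>q\<in>attachable S p C. ?f C q) = (\<Sum>C\<in>Pow ?R. b ^ card C * u ^ card (?R - C))
      + (\<Sum>C\<in>Pow ?R. \<Sum>x | x \<in> S \<and> ?avoids C x. wt x v * (b ^ card C * u ^ (card (?R - C) - 1)))"
    by (simp add: sum.distrib)
  also have "(\<Sum>C\<in>Pow ?R. \<Sum>x | x \<in> S \<and> ?avoids C x. wt x v * (b ^ card C * u ^ (card (?R - C) - 1)))
      = (\<Sum>x\<in>S. \<Sum>C | C \<in> Pow ?R \<and> ?avoids C x. wt x v * (b ^ card C * u ^ (card (?R - C) - 1)))"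
    using fin assms(1) by (intro sum.swap_restrict) auto
  also have "\<dots> = (\<Sum>x\<in>S. wt x v) * (u + b) ^ (card ?R - 1)"
    unfolding sum_distrib_left[symmetric] sum_distrib_right
    by (intro sum.cong refl) (simp only: Pow_iff sum_attach_child_sets_avoiding[OF assms(1) p])
  also have "(\<Sum>C\<in>Pow ?R. b ^ card C * u ^ card (?R - C)) = (u + b) * (u + b) ^ (card ?R - 1)"
    using sum_Pow_power[OF fin, of b u] card_forest_roots_pos[OF assms(1,2) p]
    by (metis Suc_diff_1 power_Suc)
  finally show ?thesis
    by (simp add: distrib_right)
qed

theorem forest_polynomial_insert:
  fixes u b :: "'b::comm_semiring_1"
  assumes "finite S" "S \<noteq> {}" "v \<notin> S" and b: "\<And>w. w \<in> S \<Longrightarrow> wt v w = b"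
  shows "forest_polynomial wt (insert v S) u
    = (u + b + (\<Sum>x\<in>S. wt x v)) * forest_polynomial wt S (u + b)"
proof -
  let ?f = "\<lambda>p C q. u ^ (card (insert v S - dom (attach v p C q)) - 1)
      * forest_weight wt (attach v p C q)"
  have fin: "finite (Pow (S - dom p))" "finite (attachable S p C)" for p :: "'a \<rightharpoonup> 'a" and C
    using assms(1) by (auto simp: attachable_def)
  have "forest_polynomial wt (insert v S) u
      = (\<Sum>(p, C, q)\<in>(SIGMA p:rooted_forests S. SIGMA C:Pow (S - dom p). attachable S p C).
          ?f p C q)"
    unfolding forest_polynomial_def
    by (subst sum.reindex_bij_betw[OF bij_betw_attach[OF assms(1,3)], symmetric])
      (simp add: split_def)
  also have "\<dots> = (\<Sum>p\<in>rooted_forests S. \<Sum>C\<in>Pow (S - dom p). \<Sum>q\<in>attachable S p C. ?f p C q)"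
    using fin finite_rooted_forests[OF assms(1)] by (simp add: sum.Sigma split_def finite_SigmaI)
  also have "\<dots> = (\<Sum>p\<in>rooted_forests S.
      (u + b + (\<Sum>x\<in>S. wt x v)) * ((u + b) ^ (card (S - dom p) - 1) * forest_weight wt p))"
  proof (intro sum.cong refl)
    fix p assume p: "p \<in> rooted_forests S"
    have "?f p C q = (case q of None \<Rightarrow> 1 | Some x \<Rightarrow> wt x v) * b ^ card C
        * u ^ (card (insert v S - dom (attach v p C q)) - 1) * forest_weight wt p"
      if "C \<in> Pow (S - dom p)" for C q
      using forest_weight_attach[OF assms(1,3) p, of C wt b q] that b by (simp add: mult_ac)
    then have "(\<Sum>C\<in>Pow (S - dom p). \<Sum>q\<in>attachable S p C. ?f p C q)
        = (\<Sum>C\<in>Pow (S - dom p). \<Sum>q\<in>attachable S p C.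
            (case q of None \<Rightarrow> 1 | Some x \<Rightarrow> wt x v) * b ^ card C
              * u ^ (card (insert v S - dom (attach v p C q)) - 1)) * forest_weight wt p"
      by (simp add: sum_distrib_right)
    then show "(\<Sum>C\<in>Pow (S - dom p). \<Sum>q\<in>attachable S p C. ?f p C q)
        = (u + b + (\<Sum>x\<in>S. wt x v)) * ((u + b) ^ (card (S - dom p) - 1) * forest_weight wt p)"
      unfolding sum_attach_choices[OF assms(1-3) p] by (simp add: mult.assoc)
  qed
  finally show ?thesis
    by (simp add: forest_polynomial_def sum_distrib_left)
qed

lemma forest_polynomial_singleton: "forest_polynomial wt {v} u = 1"
proof -
  have "p = Map.empty" if p: "p \<in> rooted_forests {v}" for p
  proof
    fix w show "p w = None"
      using rooted_forestsD(1)[OF p] rooted_forestsD(2,3)[OF p, of w] by (cases "p w") auto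
  qed
  then have "rooted_forests {v} = {Map.empty}"
    by (auto simp: rooted_forests_def parent_rel_def acyclic_def)
  then show ?thesis
    by (simp add: forest_polynomial_def forest_weight_def)
qed

theorem forest_polynomial_interval:
  fixes a b :: "nat \<Rightarrow> 'b::comm_semiring_1"
  assumes "i \<le> n"
  shows "forest_polynomial (\<lambda>v w. if v < w then b v else a v) {i..n} u
    = (\<Prod>k\<in>{i..<n}. u + (\<Sum>j\<in>{i..k}. b j) + (\<Sum>j\<in>{k<..n}. a j))"
  using assms
proof (induction i arbitrary: u rule: inc_induct)
  case base
  then show ?case
    by (simp add: forest_polynomial_singleton)
next
  case (step i)
  let ?wt = "\<lambda>v w. if v < w then b v else a v"
  let ?factor = "\<lambda>u i k. u + (\<Sum>j\<in>{i..k}. b j) + (\<Sum>j\<in>{k<..n}. a j)"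
  have "{i..n} = insert i {Suc i..n}"
    using step.hyps by auto
  then have "forest_polynomial ?wt {i..n} u
      = (u + b i + (\<Sum>q\<in>{Suc i..n}. ?wt q i)) * forest_polynomial ?wt {Suc i..n} (u + b i)"
    using step.hyps by (simp only:) (rule forest_polynomial_insert, auto)
  also have "(\<Sum>q\<in>{Suc i..n}. ?wt q i) = (\<Sum>j\<in>{i<..n}. a j)"
    by (intro sum.cong) auto
  also have "forest_polynomial ?wt {Suc i..n} (u + b i)
      = (\<Prod>k\<in>{Suc i..<n}. ?factor (u + b i) (Suc i) k)"
    by (rule step.IH)
  also have "\<dots> = (\<Prod>k\<in>{Suc i..<n}. ?factor u i k)"
    by (intro prod.cong refl) (auto simp: sum.atLeast_Suc_atMost[of i] add.assoc)
  also have "(u + b i + (\<Sum>j\<in>{i<..n}. a j)) * \<dots> = (\<Prod>k\<in>{i..<n}. ?factor u i k)"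
    using step.hyps by (simp add: prod.atLeast_Suc_lessThan[of i])
  finally show ?case .
qed

section \<open>Signed colour windows\<close>

text \<open>In a decreasing tree with \<open>k + 1\<close> constrained colours, the condition on the colours of the
  children of a vertex \<open>v\<close> is not a product over the children. It is a signed sum of products over
  windows \<open>t = (z, m)\<close>: the children larger than \<open>v\<close> use the colours above \<open>k + 1 - m\<close>, the smaller
  ones those above \<open>k + 1 - m - z\<close>.\<close>

definition signed_windows :: "nat \<Rightarrow> (nat \<times> nat) set" where
  "signed_windows k = {1} \<times> {0..k} \<union> {0} \<times> {1..k}"

definition window_sign :: "nat \<times> nat \<Rightarrow> 'a::comm_ring_1" where
  "window_sign t = (if fst t = 1 then 1 else -1)"

definition in_window :: "nat \<Rightarrow> nat \<times> nat \<Rightarrow> nat \<Rightarrow> nat \<Rightarrow> nat \<Rightarrow> bool" where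
  "in_window k t v w c \<longleftrightarrow> k + 1 < c + snd t + (if w < v then fst t else 0)"

definition decreasing_at :: "nat \<Rightarrow> (nat \<Rightarrow> nat) \<Rightarrow> nat set \<Rightarrow> nat \<Rightarrow> bool" where
  "decreasing_at k c W v \<longleftrightarrow>
     (W \<noteq> {} \<longrightarrow> Min (c ` W) \<le> k \<longrightarrow> (\<forall>w\<in>W. c w = Min (c ` W) \<longrightarrow> w < v))"

lemma finite_signed_windows [simp]: "finite (signed_windows k)"
  by (simp add: signed_windows_def)

lemma sum_signed_windows:
  fixes f :: "nat \<times> nat \<Rightarrow> 'a::comm_ring_1"
  shows "(\<Sum>t\<in>signed_windows k. window_sign t * f t) = (\<Sum>m=0..k. f (1, m)) - (\<Sum>m=1..k. f (0, m))"
proof -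
  have "(\<Sum>t\<in>{z} \<times> M. g t) = (\<Sum>m\<in>M. g (z, m))" for z :: nat and M :: "nat set"
    and g :: "nat \<times> nat \<Rightarrow> 'a"
    using sum.cartesian_product[of "\<lambda>z m. g (z, m)" M "{z}"] by simp
  then show ?thesis
    unfolding signed_windows_def
    by (subst sum.union_disjoint) (auto simp: window_sign_def sum_negf)
qed

lemma card_in_window:
  assumes "t \<in> signed_windows k1"
  shows "card {c \<in> {1..k1 + 1 + k2}. in_window k1 t v w c}
      = k2 + snd t + (if w < v then fst t else 0)"
proof -
  define m where "m = snd t + (if w < v then fst t else 0)"
  have m: "m \<le> k1 + 1"
    using assms by (auto simp: m_def signed_windows_def)
  then have "{c \<in> {1..k1 + 1 + k2}. in_window k1 t v w c} = {k1 + 1 - m<..k1 + 1 + k2}"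
    by (auto simp: in_window_def m_def)
  then show ?thesis
    using m by (simp add: m_def)
qed

lemma all_in_window_0_iff:
  fixes c :: "nat \<Rightarrow> nat"
  assumes "finite W" "W \<noteq> {}"
  shows "(\<forall>w\<in>W. in_window k (0, m) v w (c w)) \<longleftrightarrow> k + 1 < Min (c ` W) + m"
proof -
  have "Min (c ` W) \<in> c ` W"
    using assms by simp
  then obtain w\<^sub>0 where "w\<^sub>0 \<in> W" "c w\<^sub>0 = Min (c ` W)"
    by auto
  moreover have "k + 1 < c w + m" if "k + 1 < Min (c ` W) + m" "w \<in> W" for w
    using that assms by (auto intro: order_less_le_trans)
  ultimately show ?thesis
    by (auto simp: in_window_def)
qed

lemma all_in_window_1_iff:
  fixes c :: "nat \<Rightarrow> nat"
  assumes "finite W" "W \<noteq> {}"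
  defines "\<mu> \<equiv> Min (c ` W)"
  shows "(\<forall>w\<in>W. in_window k (1, m) v w (c w))
    \<longleftrightarrow> k + 1 < \<mu> + m \<or> k + 1 = \<mu> + m \<and> (\<forall>w\<in>W. c w = \<mu> \<longrightarrow> w < v)" (is "?L \<longleftrightarrow> ?R")
proof
  assume L: ?L
  have less: "k + 1 < c w + m + (if w < v then 1 else 0)" if "w \<in> W" for w
    using bspec[OF L that] by (simp add: in_window_def split: if_splits)
  have "\<mu> \<in> c ` W"
    using assms by simp
  then obtain w\<^sub>0 where "w\<^sub>0 \<in> W" "c w\<^sub>0 = \<mu>"
    by auto
  show ?R
  proof (cases "k + 1 < \<mu> + m")
    case False
    then have "k + 1 = \<mu> + m"
      using less[OF \<open>w\<^sub>0 \<in> W\<close>] \<open>c w\<^sub>0 = \<mu>\<close> by (simp split: if_splits)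
    moreover have "w < v" if "w \<in> W" "c w = \<mu>" for w
      using less[OF that(1)] that(2) False by (simp split: if_splits)
    ultimately show ?thesis
      by blast
  qed blast
next
  assume R: ?R
  show ?L
  proof
    fix w assume w: "w \<in> W"
    then have "\<mu> \<le> c w"
      using assms by simp
    then have "k + 1 < c w + m + (if w < v then 1 else 0)"
      using R w by (cases "c w = \<mu>") auto
    then show "in_window k (1, m) v w (c w)"
      by (simp add: in_window_def split: if_splits)
  qed
qed

lemma prod_of_bool:
  "finite A \<Longrightarrow> (\<Prod>v\<in>A. of_bool (P v)) = (of_bool (\<forall>v\<in>A. P v) :: 'a::comm_semiring_1)"
  by (induction A rule: finite_induct) auto

lemma sum_windows_eq_decreasing_at:
  fixes c :: "nat \<Rightarrow> nat"
  assumes "finite W" and pos: "\<And>w. w \<in> W \<Longrightarrow> 1 \<le> c w"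
  shows "(\<Sum>t\<in>signed_windows k. window_sign t * (\<Prod>w\<in>W. of_bool (in_window k t v w (c w))))
    = (of_bool (decreasing_at (k + 1) c W v) :: 'a::comm_ring_1)"
proof (cases "W = {}")
  case True
  then show ?thesis
    using sum_signed_windows[of "\<lambda>_. 1 :: 'a" k] by (simp add: decreasing_at_def)
next
  case False
  define \<mu> where "\<mu> = Min (c ` W)"
  define all_less where "all_less \<longleftrightarrow> (\<forall>w\<in>W. c w = \<mu> \<longrightarrow> w < v)"
  have "1 \<le> \<mu>"
    using False assms by (simp add: \<mu>_def)
  have "(\<Sum>t\<in>signed_windows k. window_sign t * (\<Prod>w\<in>W. of_bool (in_window k t v w (c w))))
      = (\<Sum>m=0..k. of_bool (k + 1 < \<mu> + m \<or> k + 1 = \<mu> + m \<and> all_less))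
        - (\<Sum>m=1..k. of_bool (k + 1 < \<mu> + m) :: 'a)"
    using all_in_window_0_iff[OF assms(1) False, of k _ v c]
      all_in_window_1_iff[OF assms(1) False, of k _ v c]
    by (simp add: sum_signed_windows prod_of_bool[OF assms(1)] \<mu>_def all_less_def)
  also have "(\<Sum>m=0..k. of_bool (k + 1 < \<mu> + m \<or> k + 1 = \<mu> + m \<and> all_less) :: 'a)
      = (\<Sum>m=0..k. of_bool (k + 1 < \<mu> + m) + of_bool (m = k + 1 - \<mu> \<and> \<mu> \<le> k + 1 \<and> all_less))"
    by (intro sum.cong refl) auto
  also have "\<dots> - (\<Sum>m=1..k. of_bool (k + 1 < \<mu> + m))
      = of_bool (k + 1 < \<mu>) + (\<Sum>m=0..k. of_bool (m = k + 1 - \<mu> \<and> \<mu> \<le> k + 1 \<and> all_less))"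
    by (simp add: sum.distrib sum.atLeast_Suc_atMost[of 0 k] del: sum_of_bool_eq)
  also have "(\<Sum>m=0..k. of_bool (m = k + 1 - \<mu> \<and> \<mu> \<le> k + 1 \<and> all_less))
      = (of_bool (\<mu> \<le> k + 1 \<and> all_less) :: 'a)"
    using \<open>1 \<le> \<mu>\<close> by (simp add: of_bool_conj flip: sum_distrib_right)
  also have "of_bool (k + 1 < \<mu>) + \<dots> = of_bool (decreasing_at (k + 1) c W v)"
    using False by (auto simp: decreasing_at_def \<mu>_def all_less_def not_less)
  finally show ?thesis .
qed

subsection \<open>Summation over the windows of all vertices\<close>

lemma mult_pochhammer_add1_diff:
  fixes x :: "'a::comm_ring_1"
  shows "x * pochhammer (x + 1) r - x * pochhammer x r = of_nat r * pochhammer x r"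
  using pochhammer_rec[of x r] pochhammer_Suc[of x r] by (simp add: algebra_simps)

lemma stirling_sum_add1_diff:
  fixes f h :: "nat \<Rightarrow> 'a::comm_ring_1"
  shows "stirling_sum k j (\<lambda>s. f s * h s) (\<lambda>s. h s + 1) - stirling_sum k j (\<lambda>s. f s * h s) h
    = (\<Sum>r\<le>j. of_nat (r * Stirling j r) * composition_sum k (j - r) (\<lambda>s. f s * pochhammer (h s) r))"
proof -
  have "f s * h s * pochhammer (h s + 1) r - f s * h s * pochhammer (h s) r
      = of_nat r * (f s * pochhammer (h s) r)" for s r
    using arg_cong[OF mult_pochhammer_add1_diff[of "h s" r], of "\<lambda>x. f s * x"]
    by (simp add: algebra_simps)
  then have "composition_sum k i (\<lambda>s. f s * h s * pochhammer (h s + 1) r)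
      - composition_sum k i (\<lambda>s. f s * h s * pochhammer (h s) r)
      = of_nat r * composition_sum k i (\<lambda>s. f s * pochhammer (h s) r)" for i r
    by (simp flip: composition_sum_diff composition_sum_mult_left)
  then show ?thesis
    unfolding stirling_sum_def sum_subtractf[symmetric] right_diff_distrib[symmetric]
    by (intro sum.cong refl) (simp add: mult_ac)
qed

lemma sum_windows_stirling_sum:
  fixes f h :: "nat \<Rightarrow> 'a::comm_ring_1"
  shows "(\<Sum>t\<in>signed_windows k. window_sign t *
      stirling_sum k j (\<lambda>s. f (snd t + s) * h (snd t + s)) (\<lambda>s. h (snd t + s) + of_nat (fst t)))
    = stirling_sum k (Suc j) f h" (is "?L = _")
proof -
  let ?f = "\<lambda>m s. f (m + s) * h (m + s)"
  let ?p = "\<lambda>r s. f s * pochhammer (h s) r"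
  have "?L = (\<Sum>m=0..k. stirling_sum k j (?f m) (\<lambda>s. h (m + s) + 1))
      - (\<Sum>m=1..k. stirling_sum k j (?f m) (\<lambda>s. h (m + s)))"
    by (simp add: sum_signed_windows)
  also have "\<dots> = stirling_sum k j (?f 0) (\<lambda>s. h s + 1)
      + (\<Sum>m=1..k. stirling_sum k j (?f m) (\<lambda>s. h (m + s) + 1)
          - stirling_sum k j (?f m) (\<lambda>s. h (m + s)))"
    by (simp add: sum.atLeast_Suc_atMost sum_subtractf)
  also have "stirling_sum k j (?f 0) (\<lambda>s. h s + 1)
      = (\<Sum>r\<le>j. of_nat (Stirling j r) * composition_sum k (j - r) (?p (Suc r)))"
    by (simp add: stirling_sum_def pochhammer_rec mult.assoc)
  also have "(\<Sum>m=1..k. stirling_sum k j (?f m) (\<lambda>s. h (m + s) + 1)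
      - stirling_sum k j (?f m) (\<lambda>s. h (m + s)))
      = (\<Sum>r\<le>j. of_nat (r * Stirling j r) * composition_sum k (Suc j - r) (?p r))"
    unfolding stirling_sum_add1_diff
    by (subst sum.swap) (auto simp: Suc_diff_le sum_distrib_left intro!: sum.cong)
  also have "\<dots> = (\<Sum>r\<le>Suc j. of_nat (r * Stirling j r) * composition_sum k (Suc j - r) (?p r))"
    by simp
  also have "\<dots> = (\<Sum>r\<le>j. of_nat (Suc r * Stirling j (Suc r))
      * composition_sum k (j - r) (?p (Suc r)))"
    by (subst sum.atMost_Suc_shift) simp
  also have "(\<Sum>r\<le>j. of_nat (Stirling j r) * composition_sum k (j - r) (?p (Suc r))) + \<dots>
      = (\<Sum>r\<le>j. of_nat (Stirling (Suc j) (Suc r)) * composition_sum k (j - r) (?p (Suc r)))"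
    unfolding sum.distrib[symmetric] by (intro sum.cong refl) (simp add: algebra_simps)
  also have "\<dots> = stirling_sum k (Suc j) f h"
    unfolding stirling_sum_def by (subst sum.atMost_Suc_shift) simp
  finally show ?thesis .
qed

lemma sum_PiE_insert:
  assumes "a \<notin> A"
  shows "(\<Sum>f\<in>PiE (insert a A) B. g f) = (\<Sum>b\<in>B a. \<Sum>f\<in>PiE A B. g (f(a := b)))"
proof -
  have "(\<Sum>f\<in>PiE (insert a A) B. g f) = (\<Sum>p\<in>B a \<times> PiE A B. g ((\<lambda>(y, h). h(a := y)) p))"
    unfolding PiE_insert_eq by (subst sum.reindex) (use assms in \<open>auto intro: inj_combinator\<close>)
  then show ?thesis
    by (simp add: sum.cartesian_product split_def)
qed

definition window_product ::
  "nat \<Rightarrow> (nat \<Rightarrow> 'a) \<Rightarrow> (nat \<Rightarrow> 'a) \<Rightarrow> (nat \<Rightarrow> nat \<times> nat) \<Rightarrow> 'a::comm_ring_1" where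
  "window_product j f h t = (\<Prod>v\<in>{1..j}. window_sign (t v)) * (f (\<Sum>v\<in>{1..j}. snd (t v)) *
     (\<Prod>i\<in>{1..j}. h (\<Sum>v\<in>{1..j}. snd (t v)) + of_nat (\<Sum>v\<in>{i<..j}. fst (t v))))"

lemma window_product_Suc:
  "window_product (Suc j) f h (t(Suc j := b)) = window_sign b *
     window_product j (\<lambda>s. f (snd b + s) * h (snd b + s)) (\<lambda>s. h (snd b + s) + of_nat (fst b)) t"
proof -
  let ?t = "t(Suc j := b)"
  have ins: "{1..Suc j} = insert (Suc j) {1..j}"
    by auto
  have signs: "(\<Prod>v\<in>{1..Suc j}. window_sign (?t v))
      = window_sign b * (\<Prod>v\<in>{1..j}. window_sign (t v) :: 'a)"
    unfolding ins by (subst prod.insert) (auto intro!: prod.cong)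
  have shifts: "(\<Sum>v\<in>{1..Suc j}. snd (?t v)) = snd b + (\<Sum>v\<in>{1..j}. snd (t v))"
    unfolding ins by (subst sum.insert) (auto intro!: sum.cong)
  have bonus: "(\<Sum>v\<in>{i<..Suc j}. fst (?t v)) = fst b + (\<Sum>v\<in>{i<..j}. fst (t v))" if "i \<in> {1..j}" for i
  proof -
    have "{i<..Suc j} = insert (Suc j) {i<..j}"
      using that by auto
    then show ?thesis
      using that by (auto intro!: sum.cong)
  qed
  have "(\<Prod>i\<in>{1..Suc j}. h s + of_nat (\<Sum>v\<in>{i<..Suc j}. fst (?t v)))
      = h s * (\<Prod>i\<in>{1..j}. h s + of_nat (fst b) + of_nat (\<Sum>v\<in>{i<..j}. fst (t v)))" for s
    unfolding ins by (subst prod.insert) (use bonus in \<open>auto intro!: prod.cong simp: add.assoc\<close>)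
  then show ?thesis
    unfolding window_product_def signs shifts by (simp add: mult_ac)
qed

theorem sum_window_product:
  "(\<Sum>t\<in>PiE {1..j} (\<lambda>_. signed_windows k). window_product j f h t) = stirling_sum k j f h"
proof (induction j arbitrary: f h)
  case 0
  then show ?case
    by (simp add: window_product_def stirling_sum_def)
next
  case (Suc j)
  have "{1..Suc j} = insert (Suc j) {1..j}"
    by auto
  then have "(\<Sum>t\<in>PiE {1..Suc j} (\<lambda>_. signed_windows k). window_product (Suc j) f h t)
      = (\<Sum>b\<in>signed_windows k. \<Sum>t\<in>PiE {1..j} (\<lambda>_. signed_windows k).
          window_product (Suc j) f h (t(Suc j := b)))"
    by (simp add: sum_PiE_insert)
  then show ?case
    by (simp only: window_product_Suc Suc.IH sum_windows_stirling_sum flip: sum_distrib_left)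
qed

section \<open>Decreasing trees\<close>

definition tree_edges :: "(nat \<rightharpoonup> nat) \<Rightarrow> (nat \<Rightarrow> nat) \<Rightarrow> (nat \<times> nat \<times> nat) set" where
  "tree_edges p c = (\<lambda>w. (the (p w), w, c w)) ` dom p"

lemma mem_tree_edges [simp]: "(u, w, k) \<in> tree_edges p c \<longleftrightarrow> p w = Some u \<and> c w = k"
  by (force simp: tree_edges_def)

lemma card_tree_edges: "card (tree_edges p c) = card (dom p)"
  unfolding tree_edges_def by (rule card_image) (auto simp: inj_on_def)

lemma parent_rel_tree_edges: "{(u, w). \<exists>k. (u, w, k) \<in> tree_edges p c} = parent_rel p"
  by (auto simp: parent_rel_def)

lemma rooted_tree_iff:
  assumes "1 \<le> n"
  shows "p \<in> rooted_trees {1..n} \<longleftrightarrow>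
    dom p \<subseteq> {1..n} \<and> ran p \<subseteq> {1..n} \<and> acyclic (parent_rel p) \<and> card (dom p) = n - 1"
proof (cases "dom p \<subseteq> {1..n}")
  case True
  then have "card (dom p) \<le> n"
    using card_mono[OF _ True] by simp
  then have "card ({1..n} - dom p) = 1 \<longleftrightarrow> card (dom p) = n - 1"
    using card_Diff_subset[OF finite_subset[OF True] True] assms by auto
  then show ?thesis
    by (simp add: rooted_trees_def rooted_forests_def)
qed (simp add: rooted_trees_def rooted_forests_def)

lemma colored_rooted_tree_tree_edges:
  assumes n: "1 \<le> n" and p: "p \<in> rooted_trees {1..n}" and c: "c \<in> dom p \<rightarrow>\<^sub>E {1..K}"
  shows "colored_rooted_tree n K (tree_edges p c)"
proof -
  have forest: "p \<in> rooted_forests {1..n}"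
    using p by (simp add: rooted_trees_def)
  have "tree_edges p c \<subseteq> {(u, w, k). u \<in> {1..n} \<and> w \<in> {1..n} \<and> u \<noteq> w \<and> k \<in> {1..K}}"
  proof clarify
    fix u w k assume "(u, w, k) \<in> tree_edges p c"
    then have w: "p w = Some u" "c w = k" "w \<in> dom p"
      by auto
    then show "u \<in> {1..n} \<and> w \<in> {1..n} \<and> u \<noteq> w \<and> k \<in> {1..K}"
      using rooted_forestsD[OF forest] PiE_mem[OF c, of w] by blast
  qed
  moreover have "u = u' \<and> k = k'"
    if "(u, w, k) \<in> tree_edges p c" "(u', w, k') \<in> tree_edges p c" for u w k u' k'
    using that by simp
  ultimately show ?thesis
    using p
    unfolding colored_rooted_tree_def card_tree_edges parent_rel_tree_edges rooted_tree_iff[OF n]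
    by blast
qed

lemma colored_rooted_treeE:
  assumes n: "1 \<le> n" and T: "colored_rooted_tree n K T"
  obtains p c where "p \<in> rooted_trees {1..n}" "c \<in> dom p \<rightarrow>\<^sub>E {1..K}" "T = tree_edges p c"
proof -
  have sub: "T \<subseteq> {(u, w, c). u \<in> {1..n} \<and> w \<in> {1..n} \<and> u \<noteq> w \<and> c \<in> {1..K}}"
    and "card T = n - 1" and acyclic: "acyclic {(u, w). \<exists>c. (u, w, c) \<in> T}"
    and unique: "\<And>u w c u' c'. (u, w, c) \<in> T \<Longrightarrow> (u', w, c') \<in> T \<Longrightarrow> u = u' \<and> c = c'"
    using T unfolding colored_rooted_tree_def by blast+
  have "\<exists>q. \<forall>u c. (u, w, c) \<in> T \<longleftrightarrow> q = Some (u, c)" for w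
  proof (cases "\<exists>u c. (u, w, c) \<in> T")
    case True
    then obtain u c where "(u, w, c) \<in> T"
      by blast
    then have "\<forall>u' c'. (u', w, c') \<in> T \<longleftrightarrow> Some (u, c) = Some (u', c')"
      using unique by blast
    then show ?thesis
      by blast
  qed auto
  then obtain t where t: "\<And>u w c. (u, w, c) \<in> T \<longleftrightarrow> t w = Some (u, c)"
    by metis
  define p where "p = map_option fst \<circ> t"
  define c where "c = restrict (\<lambda>w. snd (the (t w))) (dom p)"
  have eq: "T = tree_edges p c"
    using t by (auto simp: p_def c_def)
  have dom: "dom p = dom t"
    by (auto simp: p_def)
  have edge: "u \<in> {1..n} \<and> w \<in> {1..n} \<and> k \<in> {1..K}" if "t w = Some (u, k)" for u w k
    using sub t that by blast
  have "p \<in> rooted_trees {1..n}"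
    using acyclic \<open>card T = n - 1\<close> edge
    unfolding rooted_tree_iff[OF n] eq card_tree_edges parent_rel_tree_edges
    by (fastforce simp: p_def ran_def)
  moreover have "c \<in> dom p \<rightarrow>\<^sub>E {1..K}"
    using edge by (auto simp: c_def dom)
  ultimately show ?thesis
    using eq that by blast
qed

lemma bij_betw_tree_edges:
  assumes "1 \<le> n"
  shows "bij_betw (\<lambda>(p, c). tree_edges p c)
    (SIGMA p:rooted_trees {1..n}. dom p \<rightarrow>\<^sub>E {1..K}) {T. colored_rooted_tree n K T}"
  unfolding bij_betw_def
proof
  show "inj_on (\<lambda>(p, c). tree_edges p c) (SIGMA p:rooted_trees {1..n}. dom p \<rightarrow>\<^sub>E {1..K})"
  proof (rule inj_onI, clarify)
    fix p c p' c'
    assume c: "c \<in> dom p \<rightarrow>\<^sub>E {1..K}" "c' \<in> dom p' \<rightarrow>\<^sub>E {1..K}"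
      and eq: "tree_edges p c = tree_edges p' c'"
    have edge: "p w = Some u \<and> c w = k \<longleftrightarrow> p' w = Some u \<and> c' w = k" for u w k
      unfolding mem_tree_edges[symmetric] eq ..
    have "p w = p' w" for w
      using edge[of w _ "c w"] edge[of w _ "c' w"] by (cases "p w"; cases "p' w") auto
    then have "p = p'" ..
    moreover have "c = c'"
      by (rule PiE_ext[OF c(1)]) (use c(2) edge \<open>p = p'\<close> in auto)
    ultimately show "p = p' \<and> c = c'" ..
  qed
  show "(\<lambda>(p, c). tree_edges p c) ` (SIGMA p:rooted_trees {1..n}. dom p \<rightarrow>\<^sub>E {1..K})
      = {T. colored_rooted_tree n K T}"
  proof (intro equalityI subsetI)
    fix T assume "T \<in> {T. colored_rooted_tree n K T}"
    then obtain p c where "p \<in> rooted_trees {1..n}" "c \<in> dom p \<rightarrow>\<^sub>E {1..K}" "T = tree_edges p c"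
      using colored_rooted_treeE[OF assms] by blast
    then show "T \<in> (\<lambda>(p, c). tree_edges p c) ` (SIGMA p:rooted_trees {1..n}. dom p \<rightarrow>\<^sub>E {1..K})"
      by (intro image_eqI[of _ _ "(p, c)"]) auto
  qed (use colored_rooted_tree_tree_edges[OF assms] in auto)
qed

lemma decreasing_tree_edges_iff:
  assumes n: "1 \<le> n" and p: "p \<in> rooted_trees {1..n}" and c: "c \<in> dom p \<rightarrow>\<^sub>E {1..k1 + k2}"
  shows "decreasing_tree n k1 k2 (tree_edges p c) \<longleftrightarrow>
    (\<forall>v\<in>{1..<n}. decreasing_at k1 c {w. p w = Some v} v)"
proof -
  have min: "min_child_color (tree_edges p c) v = Min (c ` {w. p w = Some v})" for v
    unfolding min_child_color_def by (intro arg_cong[where f = Min]) auto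
  have "decreasing_tree n k1 k2 (tree_edges p c) \<longleftrightarrow> (\<forall>v. decreasing_at k1 c {w. p w = Some v} v)"
    using colored_rooted_tree_tree_edges[OF assms]
    by (auto simp: decreasing_tree_def decreasing_at_def min)
  moreover have "decreasing_at k1 c {w. p w = Some v} v" if "v \<notin> {1..<n}" for v
  proof -
    have forest: "p \<in> rooted_forests {1..n}"
      using p by (simp add: rooted_trees_def)
    have "w < v" if "p w = Some v" for w
    proof -
      have "v \<in> {1..n}" "v \<noteq> w" "w \<in> {1..n}"
        using rooted_forestsD[OF forest] that by blast+
      then show ?thesis
        using \<open>v \<notin> {1..<n}\<close> by auto
    qed
    then show ?thesis
      by (simp add: decreasing_at_def)
  qed
  ultimately show ?thesis
    by blast
qed

lemma n_root_color1_tree_edges: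
  "n_root_color1_edges n (tree_edges p c) = card {w. p w = Some n \<and> c w = 1}"
proof -
  have "{(u, w, k) \<in> tree_edges p c. u = n \<and> k = 1} = (\<lambda>w. (n, w, 1)) ` {w. p w = Some n \<and> c w = 1}"
    by (auto simp: image_iff)
  then show ?thesis
    unfolding n_root_color1_edges_def by (simp add: card_image inj_on_def)
qed

lemma prod_dom_group_by_parent:
  assumes "finite S" and p: "p \<in> rooted_forests S"
  shows "(\<Prod>w\<in>dom p. g (the (p w)) w) = (\<Prod>v\<in>S. \<Prod>w | p w = Some v. g v w)"
proof -
  have "(\<Prod>v\<in>S. \<Prod>w | p w = Some v. g v w)
      = (\<Prod>v\<in>S. \<Prod>w\<in>{w \<in> dom p. the (p w) = v}. g (the (p w)) w)"
    by (intro prod.cong) auto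
  also have "\<dots> = (\<Prod>w\<in>dom p. g (the (p w)) w)"
    using finite_subset[OF rooted_forestsD(1)[OF p]] rooted_forestsD(2)[OF p] assms(1)
    by (intro prod.group) auto
  finally show ?thesis ..
qed

definition edge_weight ::
  "nat \<Rightarrow> nat \<Rightarrow> 'a::comm_ring_1 \<Rightarrow> (nat \<Rightarrow> nat \<times> nat) \<Rightarrow> nat \<Rightarrow> nat \<Rightarrow> nat \<Rightarrow> 'a" where
  "edge_weight n k y t v w c =
     (if v = n then (if c = 1 then y else 1) else of_bool (in_window k (t v) v w c))"

definition smaller_child_weight ::
  "nat \<Rightarrow> nat \<Rightarrow> nat \<Rightarrow> 'a::comm_ring_1 \<Rightarrow> (nat \<Rightarrow> nat \<times> nat) \<Rightarrow> nat \<Rightarrow> 'a" where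
  "smaller_child_weight n k1 k2 y t v =
     (if v = n then y + of_nat (k1 + k2) else of_nat (k2 + snd (t v) + fst (t v)))"

definition larger_child_weight :: "nat \<Rightarrow> (nat \<Rightarrow> nat \<times> nat) \<Rightarrow> nat \<Rightarrow> 'a::comm_ring_1" where
  "larger_child_weight k2 t v = of_nat (k2 + snd (t v))"

lemma prod_edge_weight:
  fixes y :: "'a::comm_ring_1"
  assumes n: "n = Suc j" and p: "p \<in> rooted_forests {1..n}"
  shows "(\<Prod>w\<in>dom p. edge_weight n k1 y t (the (p w)) w (c w))
    = (\<Prod>v\<in>{1..j}. \<Prod>w\<in>{w. p w = Some v}. of_bool (in_window k1 (t v) v w (c w)))
      * y ^ n_root_color1_edges n (tree_edges p c)"
proof -
  let ?children = "\<lambda>v. {w. p w = Some v}"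
  have vertices: "{1..n} = insert n {1..j}" "n \<notin> {1..j}"
    using n by auto
  have "finite (?children n)"
    using rooted_forestsD(1)[OF p] by (auto intro: finite_subset)
  then have root: "(\<Prod>w\<in>?children n. edge_weight n k1 y t n w (c w))
      = y ^ n_root_color1_edges n (tree_edges p c)"
    by (simp add: edge_weight_def n_root_color1_tree_edges prod.If_cases Int_def conj_ac)
  have inner: "(\<Prod>w\<in>?children v. edge_weight n k1 y t v w (c w))
      = (\<Prod>w\<in>?children v. of_bool (in_window k1 (t v) v w (c w)))" if "v \<in> {1..j}" for v
    using that n by (simp add: edge_weight_def)
  have "(\<Prod>w\<in>dom p. edge_weight n k1 y t (the (p w)) w (c w))
      = (\<Prod>v\<in>insert n {1..j}. \<Prod>w\<in>?children v. edge_weight n k1 y t v w (c w))"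
    unfolding vertices(1)[symmetric]
    by (rule prod_dom_group_by_parent[OF _ p,
          where g = "\<lambda>v w. edge_weight n k1 y t v w (c w)"]) simp
  also have "\<dots> = (\<Prod>v\<in>{1..j}. \<Prod>w\<in>?children v. of_bool (in_window k1 (t v) v w (c w)))
      * y ^ n_root_color1_edges n (tree_edges p c)"
    unfolding prod.insert[OF finite_atLeastAtMost vertices(2)] root
    by (simp add: inner mult.commute)
  finally show ?thesis .
qed

lemma decreasing_tree_weight_expansion:
  fixes y :: "'a::comm_ring_1"
  assumes n: "n = Suc j" and p: "p \<in> rooted_trees {1..n}"
    and c: "c \<in> dom p \<rightarrow>\<^sub>E {1..k1 + 1 + k2}"
  shows "of_bool (decreasing_tree n (k1 + 1) k2 (tree_edges p c))
      * y ^ n_root_color1_edges n (tree_edges p c)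
    = (\<Sum>t\<in>PiE {1..j} (\<lambda>_. signed_windows k1).
        (\<Prod>v\<in>{1..j}. window_sign (t v)) * (\<Prod>w\<in>dom p. edge_weight n k1 y t (the (p w)) w (c w)))"
proof -
  let ?children = "\<lambda>v. {w. p w = Some v}"
  have forest: "p \<in> rooted_forests {1..n}"
    using p by (simp add: rooted_trees_def)
  have fin: "finite (?children v)" for v
    using rooted_forestsD(1)[OF forest] by (auto intro: finite_subset)
  have pos: "1 \<le> c w" if "w \<in> ?children v" for v w
    using PiE_mem[OF c, of w] that by auto
  have "(\<Prod>v\<in>{1..j}. of_bool (decreasing_at (k1 + 1) c (?children v) v))
      = (\<Prod>v\<in>{1..j}. \<Sum>t\<in>signed_windows k1.
          window_sign t * (\<Prod>w\<in>?children v. of_bool (in_window k1 t v w (c w))) :: 'a)"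
    by (intro prod.cong refl sum_windows_eq_decreasing_at[symmetric] fin pos)
  also have "\<dots> = (\<Sum>t\<in>PiE {1..j} (\<lambda>_. signed_windows k1).
      \<Prod>v\<in>{1..j}. window_sign (t v) * (\<Prod>w\<in>?children v. of_bool (in_window k1 (t v) v w (c w))))"
    by (intro prod_sum_PiE) auto
  finally have windows: "of_bool (\<forall>v\<in>{1..j}. decreasing_at (k1 + 1) c (?children v) v) = \<dots>"
    by (simp add: prod_of_bool)
  have "{1..<n} = {1..j}"
    using n by auto
  then have "decreasing_tree n (k1 + 1) k2 (tree_edges p c)
      \<longleftrightarrow> (\<forall>v\<in>{1..j}. decreasing_at (k1 + 1) c (?children v) v)"
    using decreasing_tree_edges_iff[OF _ p, of c "k1 + 1" k2] c n by simp
  then show ?thesis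
    unfolding prod_edge_weight[OF n forest]
    by (simp only: windows prod.distrib sum_distrib_right mult.assoc)
qed

lemma sum_colors_edge_weight:
  fixes y :: "'a::comm_ring_1"
  assumes "v \<in> {1..n}" "w \<in> {1..n}" "v \<noteq> w" and t: "\<And>v. v \<in> {1..<n} \<Longrightarrow> t v \<in> signed_windows k1"
  shows "(\<Sum>c\<in>{1..k1 + 1 + k2}. edge_weight n k1 y t v w c)
    = (if v < w then larger_child_weight k2 t v else smaller_child_weight n k1 k2 y t v)"
proof (cases "v = n")
  case True
  have "(\<Sum>c\<in>{1..k1 + 1 + k2}. if c = 1 then y else 1) = y + of_nat (k1 + k2)"
    by (simp add: sum.atLeast_Suc_atMost)
  then show ?thesis
    using True assms by (simp add: edge_weight_def smaller_child_weight_def)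
next
  case False
  then have "card {c \<in> {1..k1 + 1 + k2}. in_window k1 (t v) v w c}
      = k2 + snd (t v) + (if w < v then fst (t v) else 0)"
    using assms by (intro card_in_window t) auto
  moreover have "(\<Sum>c\<in>{1..k1 + 1 + k2}. edge_weight n k1 y t v w c)
      = of_nat (card {c \<in> {1..k1 + 1 + k2}. in_window k1 (t v) v w c})"
    using False
    by (simp only: edge_weight_def if_False sum_of_bool_eq finite_atLeastAtMost Int_def
        mem_Collect_eq)
  ultimately show ?thesis
    using False assms(3) by (simp add: larger_child_weight_def smaller_child_weight_def)
qed

lemma sum_colorings_edge_weight:
  fixes y :: "'a::comm_ring_1"
  assumes p: "p \<in> rooted_trees {1..n}" and t: "\<And>v. v \<in> {1..<n} \<Longrightarrow> t v \<in> signed_windows k1"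
  shows "(\<Sum>c\<in>dom p \<rightarrow>\<^sub>E {1..k1 + 1 + k2}. \<Prod>w\<in>dom p. edge_weight n k1 y t (the (p w)) w (c w))
    = forest_weight (\<lambda>v w. if v < w then larger_child_weight k2 t v
        else smaller_child_weight n k1 k2 y t v) p"
proof -
  have forest: "p \<in> rooted_forests {1..n}"
    using p by (simp add: rooted_trees_def)
  have "finite (dom p)"
    using rooted_forestsD(1)[OF forest] finite_subset by blast
  then have "(\<Sum>c\<in>dom p \<rightarrow>\<^sub>E {1..k1 + 1 + k2}. \<Prod>w\<in>dom p. edge_weight n k1 y t (the (p w)) w (c w))
      = (\<Prod>w\<in>dom p. \<Sum>c\<in>{1..k1 + 1 + k2}. edge_weight n k1 y t (the (p w)) w c)"
    by (intro prod_sum_PiE[symmetric]) auto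
  also have "\<dots> = forest_weight
      (\<lambda>v w. if v < w then larger_child_weight k2 t v else smaller_child_weight n k1 k2 y t v) p"
    unfolding forest_weight_def
  proof (intro prod.cong refl sum_colors_edge_weight t)
    fix w assume "w \<in> dom p"
    then show "the (p w) \<in> {1..n}" "w \<in> {1..n}" "the (p w) \<noteq> w"
      using rooted_forestsD(1-3)[OF forest] by auto
  qed
  finally show ?thesis .
qed

lemma sum_child_weights_split:
  fixes y :: "'a::comm_ring_1"
  assumes n: "n = Suc j" and i: "i \<in> {1..j}"
  shows "(\<Sum>v\<in>{1..i}. larger_child_weight k2 t v) + (\<Sum>v\<in>{i<..n}. smaller_child_weight n k1 k2 y t v)
    = y + of_nat (n * k2 + k1) + of_nat (\<Sum>v\<in>{1..j}. snd (t v)) + of_nat (\<Sum>v\<in>{i<..j}. fst (t v))"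
proof -
  let ?s = "\<lambda>v. k2 + snd (t v)"
  have "{i<..n} = insert n {i<..j}"
    using i n by auto
  then have "(\<Sum>v\<in>{i<..n}. smaller_child_weight n k1 k2 y t v)
      = y + of_nat (k1 + k2) + (\<Sum>v\<in>{i<..j}. smaller_child_weight n k1 k2 y t v)"
    using n by (simp add: smaller_child_weight_def)
  also have "(\<Sum>v\<in>{i<..j}. smaller_child_weight n k1 k2 y t v)
      = of_nat (\<Sum>v\<in>{i<..j}. ?s v) + of_nat (\<Sum>v\<in>{i<..j}. fst (t v))"
    using n by (auto simp: smaller_child_weight_def simp flip: sum.distrib intro!: sum.cong)
  finally have smaller: "(\<Sum>v\<in>{i<..n}. smaller_child_weight n k1 k2 y t v) = y + of_nat (k1 + k2)
      + (of_nat (\<Sum>v\<in>{i<..j}. ?s v) + of_nat (\<Sum>v\<in>{i<..j}. fst (t v)))" .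
  have larger: "(\<Sum>v\<in>{1..i}. larger_child_weight k2 t v) = (of_nat (\<Sum>v\<in>{1..i}. ?s v) :: 'a)"
    by (simp add: larger_child_weight_def)
  have "{1..j} = {1..i} \<union> {i<..j}"
    using i by auto
  then have "(\<Sum>v\<in>{1..i}. ?s v) + (\<Sum>v\<in>{i<..j}. ?s v) = (\<Sum>v\<in>{1..j}. ?s v)"
    by (simp only:) (subst sum.union_disjoint, auto)
  then have total: "(\<Sum>v\<in>{1..i}. ?s v) + (\<Sum>v\<in>{i<..j}. ?s v) + (k1 + k2)
      = n * k2 + k1 + (\<Sum>v\<in>{1..j}. snd (t v))"
    using n by (simp add: sum.distrib)
  have "(\<Sum>v\<in>{1..i}. larger_child_weight k2 t v) + (\<Sum>v\<in>{i<..n}. smaller_child_weight n k1 k2 y t v)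
      = y + of_nat ((\<Sum>v\<in>{1..i}. ?s v) + (\<Sum>v\<in>{i<..j}. ?s v) + (k1 + k2))
        + of_nat (\<Sum>v\<in>{i<..j}. fst (t v))"
    unfolding smaller larger by (simp only: of_nat_add add_ac)
  then show ?thesis
    unfolding total by (simp only: of_nat_add add_ac)
qed

lemma sum_tree_weight_windows:
  fixes y :: "'a::comm_ring_1"
  assumes n: "n = Suc j"
  shows "(\<Sum>p\<in>rooted_trees {1..n}. forest_weight
      (\<lambda>v w. if v < w then larger_child_weight k2 t v else smaller_child_weight n k1 k2 y t v) p)
    = (\<Prod>i\<in>{1..j}. y + of_nat (n * k2 + k1) + of_nat (\<Sum>v\<in>{1..j}. snd (t v))
        + of_nat (\<Sum>v\<in>{i<..j}. fst (t v)))"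
proof -
  let ?a = "smaller_child_weight n k1 k2 y t" and ?b = "larger_child_weight k2 t :: nat \<Rightarrow> 'a"
  have "(\<Sum>p\<in>rooted_trees {1..n}. forest_weight (\<lambda>v w. if v < w then ?b v else ?a v) p)
      = forest_polynomial (\<lambda>v w. if v < w then ?b v else ?a v) {1..n} 0"
    using n by (intro forest_polynomial_0[symmetric]) auto
  also have "\<dots> = (\<Prod>i\<in>{1..<n}. 0 + (\<Sum>v\<in>{1..i}. ?b v) + (\<Sum>v\<in>{i<..n}. ?a v))"
    using n by (intro forest_polynomial_interval) simp
  also have "{1..<n} = {1..j}"
    using n by auto
  finally show ?thesis
    by (simp only: add_0 sum_child_weights_split[OF n] cong: prod.cong)
qed

lemma finite_decreasing_trees: "finite {T. decreasing_tree n k1 k2 T}"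
  by (rule finite_subset[of _ "Pow ({1..n} \<times> {1..n} \<times> {1..k1 + k2})"])
     (auto simp: decreasing_tree_def colored_rooted_tree_def)

theorem decreasing_tree_polynomial:
  fixes y :: "'a::comm_ring_1"
  assumes n: "n = Suc j"
  shows "(\<Sum>T | decreasing_tree n (k1 + 1) k2 T. y ^ n_root_color1_edges n T)
    = stirling_sum k1 j (\<lambda>_. 1) (\<lambda>s. y + of_nat (n * k2 + k1) + of_nat s)"
proof -
  let ?K = "k1 + 1 + k2" and ?windows = "PiE {1..j} (\<lambda>_. signed_windows k1)"
  let ?sign = "\<lambda>t. \<Prod>v\<in>{1..j}. window_sign (t v)"
  let ?edges = "\<lambda>t p c. \<Prod>w\<in>dom p. edge_weight n k1 y t (the (p w)) w (c w)"
  have n_pos: "1 \<le> n"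
    using n by simp
  have fin: "finite (rooted_trees {1..n})"
    "p \<in> rooted_trees {1..n} \<Longrightarrow> finite (dom p \<rightarrow>\<^sub>E {1..?K})" for p
    using finite_rooted_forests[of "{1..n}"] rooted_forestsD(1)[of p "{1..n}"]
    by (auto simp: rooted_trees_def intro!: finite_PiE intro: finite_subset)
  note bij = bij_betw_tree_edges[OF n_pos, of ?K]
  have "finite {T. colored_rooted_tree n ?K T}"
    using bij_betw_finite[OF bij] fin by auto
  then have "(\<Sum>T | decreasing_tree n (k1 + 1) k2 T. y ^ n_root_color1_edges n T)
      = (\<Sum>T | colored_rooted_tree n ?K T.
          of_bool (decreasing_tree n (k1 + 1) k2 T) * y ^ n_root_color1_edges n T)"
    by (intro sum.mono_neutral_cong_left) (auto simp: decreasing_tree_def)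
  also have "\<dots> = (\<Sum>p\<in>rooted_trees {1..n}. \<Sum>c\<in>dom p \<rightarrow>\<^sub>E {1..?K}.
      of_bool (decreasing_tree n (k1 + 1) k2 (tree_edges p c))
          * y ^ n_root_color1_edges n (tree_edges p c))"
    using fin by (subst sum.reindex_bij_betw[OF bij, symmetric])
      (simp add: sum.Sigma split_def del: sum_of_bool_mult_eq)
  also have "\<dots> = (\<Sum>p\<in>rooted_trees {1..n}. \<Sum>c\<in>dom p \<rightarrow>\<^sub>E {1..?K}.
      \<Sum>t\<in>?windows. ?sign t * ?edges t p c)"
    by (intro sum.cong refl decreasing_tree_weight_expansion[OF n])
  also have "\<dots> = (\<Sum>p\<in>rooted_trees {1..n}. \<Sum>t\<in>?windows.
      ?sign t * (\<Sum>c\<in>dom p \<rightarrow>\<^sub>E {1..?K}. ?edges t p c))"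
    unfolding sum_distrib_left by (intro sum.cong refl sum.swap)
  also have "\<dots> = (\<Sum>t\<in>?windows. \<Sum>p\<in>rooted_trees {1..n}.
      ?sign t * (\<Sum>c\<in>dom p \<rightarrow>\<^sub>E {1..?K}. ?edges t p c))"
    by (rule sum.swap)
  also have "\<dots> = (\<Sum>t\<in>?windows. \<Sum>p\<in>rooted_trees {1..n}. ?sign t * forest_weight
      (\<lambda>v w. if v < w then larger_child_weight k2 t v else smaller_child_weight n k1 k2 y t v) p)"
    by (intro sum.cong refl arg_cong2[where f = "(*)"] sum_colorings_edge_weight) (use n in auto)
  also have "\<dots> = (\<Sum>t\<in>?windows.
      window_product j (\<lambda>_. 1) (\<lambda>s. y + of_nat (n * k2 + k1) + of_nat s) t)"
    unfolding sum_distrib_left[symmetric] sum_tree_weight_windows[OF n]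
    by (simp add: window_product_def)
  finally show ?thesis
    unfolding sum_window_product .
qed

section \<open>Edge sets and linked vertices\<close>

abbreviation src :: "gedge \<Rightarrow> nat" where "src e \<equiv> fst e"
abbreviation tgt :: "gedge \<Rightarrow> nat" where "tgt e \<equiv> fst (snd e)"
abbreviation gain :: "gedge \<Rightarrow> int" where "gain e \<equiv> snd (snd e)"

definition edges_within :: "nat \<Rightarrow> gedge set \<Rightarrow> bool" where
  "edges_within n E \<longleftrightarrow> (\<forall>e\<in>E. src e \<in> {1..n} \<and> tgt e \<in> {1..n})"

definition loopless :: "gedge set \<Rightarrow> bool" where
  "loopless E \<longleftrightarrow> (\<forall>e\<in>E. src e \<noteq> tgt e)"

definition linked :: "gedge set \<Rightarrow> nat \<Rightarrow> nat \<Rightarrow> bool" where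
  "linked S u v \<longleftrightarrow> (u, v) \<in> (adj S)\<^sup>*"

definition spanning :: "nat \<Rightarrow> gedge set \<Rightarrow> bool" where
  "spanning n S \<longleftrightarrow> (\<forall>u\<in>{1..n}. \<forall>v\<in>{1..n}. linked S u v)"

definition circle_free :: "gedge set \<Rightarrow> bool" where
  "circle_free S \<longleftrightarrow> (\<forall>e\<in>S. \<not> linked (S - {e}) (src e) (tgt e))"

lemma linked_refl [simp]: "linked S u u"
  by (simp add: linked_def)

lemma linked_trans: "linked S u v \<Longrightarrow> linked S v w \<Longrightarrow> linked S u w"
  unfolding linked_def by (rule rtrancl_trans)

lemma linked_sym: "linked S u v \<Longrightarrow> linked S v u"
proof -
  have "sym (adj S)"
    by (auto simp: sym_def adj_def)
  then show "linked S u v \<Longrightarrow> linked S v u"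
    unfolding linked_def by (meson sym_rtrancl symD)
qed

lemma linked_mono: "linked S u v \<Longrightarrow> S \<subseteq> T \<Longrightarrow> linked T u v"
  unfolding linked_def using rtrancl_mono[of "adj S" "adj T"] by (fastforce simp: adj_def)

lemma linked_edge: "e \<in> S \<Longrightarrow> linked S (src e) (tgt e)"
  unfolding linked_def by (rule r_into_rtrancl) (cases e; auto simp: adj_def)

lemma linked_ends_iff: "ends e = {u, v} \<Longrightarrow> linked S (src e) (tgt e) \<longleftrightarrow> linked S u v"
  by (auto simp: ends_def doubleton_eq_iff dest: linked_sym)

lemma linked_invariant:
  assumes "linked S u v" "P u" and "\<And>e. e \<in> S \<Longrightarrow> P (src e) \<longleftrightarrow> P (tgt e)"
  shows "P v"
  using assms(1) unfolding linked_def
proof induction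
  case (step y z)
  then obtain g where "(y, z, g) \<in> S \<or> (z, y, g) \<in> S"
    by (auto simp: adj_def)
  then show ?case
    using step.IH assms(3) by force
qed (rule assms(2))

lemma linked_insert_iff:
  "linked (insert e S) u v \<longleftrightarrow> linked S u v
     \<or> (linked S u (src e) \<and> linked S (tgt e) v) \<or> (linked S u (tgt e) \<and> linked S (src e) v)"
    (is "?L \<longleftrightarrow> ?R v")
proof
  assume L: ?L
  show "?R v"
  proof (rule linked_invariant[OF L, where P = ?R])
    show "?R u"
      by simp
    fix f assume f: "f \<in> insert e S"
    show "?R (src f) \<longleftrightarrow> ?R (tgt f)"
    proof (cases "f = e")
      case True
      then show ?thesis
        by (meson linked_refl linked_trans linked_sym)
    next
      case False
      then have "linked S (src f) (tgt f)"
        using f by (auto intro: linked_edge)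
      then have "linked S w (src f) \<longleftrightarrow> linked S w (tgt f)" for w
        by (meson linked_trans linked_sym)
      then show ?thesis
        by simp
    qed
  qed
next
  assume R: "?R v"
  have "linked (insert e S) (src e) (tgt e)"
    by (rule linked_edge) simp
  moreover have "linked S a b \<Longrightarrow> linked (insert e S) a b" for a b
    by (erule linked_mono) auto
  ultimately show ?L
    using R by (meson linked_trans linked_sym)
qed

lemma linked_subset_closure:
  assumes "linked S u v" and "\<And>e. e \<in> S \<Longrightarrow> linked T (src e) (tgt e)"
  shows "linked T u v"
proof (rule linked_invariant[OF assms(1), where P = "linked T u"])
  fix e assume "e \<in> S"
  then show "linked T u (src e) \<longleftrightarrow> linked T u (tgt e)"
    using assms(2) by (meson linked_sym linked_trans)
qed simp

lemma spanning_delete: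
  assumes "spanning n (insert e S)" "linked S (src e) (tgt e)"
  shows "spanning n S"
  using assms unfolding spanning_def linked_insert_iff by (meson linked_sym linked_trans)

lemma circle_free_empty [simp]: "circle_free {}"
  by (simp add: circle_free_def)

lemma circle_free_subset: "circle_free S \<Longrightarrow> T \<subseteq> S \<Longrightarrow> circle_free T"
  unfolding circle_free_def using linked_mono[of "T - {_}" _ _ "S - {_}"]
  by (meson Diff_mono order_refl subsetD)

lemma circle_free_insert_iff:
  assumes "e \<notin> S"
  shows "circle_free (insert e S) \<longleftrightarrow> circle_free S \<and> \<not> linked S (src e) (tgt e)"
proof
  assume free: "circle_free (insert e S)"
  then show "circle_free S \<and> \<not> linked S (src e) (tgt e)"
    using assms circle_free_subset[OF free] by (auto simp: circle_free_def)
next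
  assume R: "circle_free S \<and> \<not> linked S (src e) (tgt e)"
  have "\<not> linked (insert e S - {f}) (src f) (tgt f)" if f: "f \<in> S" for f
  proof
    have "insert e S - {f} = insert e (S - {f})"
      using f assms by auto
    moreover assume "linked (insert e S - {f}) (src f) (tgt f)"
    ultimately have "linked (S - {f}) (src f) (src e) \<and> linked (S - {f}) (tgt e) (tgt f)
         \<or> linked (S - {f}) (src f) (tgt e) \<and> linked (S - {f}) (src e) (tgt f)"
      using R f by (auto simp: linked_insert_iff circle_free_def)
    moreover have "linked (S - {f}) a b \<Longrightarrow> linked S a b" for a b
      by (erule linked_mono) auto
    moreover have "linked S (src f) (tgt f)"
      using f by (rule linked_edge)
    ultimately show False
      using R by (meson linked_trans linked_sym)
  qed
  then show "circle_free (insert e S)"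
    using R assms by (simp add: circle_free_def)
qed

lemma spanning_exchange:
  assumes span: "spanning n B" and "e \<in> B" and f: "src f \<in> {1..n}" "tgt f \<in> {1..n}"
    and separated: "\<not> linked (B - {e}) (src f) (tgt f)"
  shows "spanning n (insert f (B - {e}))"
proof -
  let ?C = "B - {e}"
  have B: "B = insert e ?C"
    using \<open>e \<in> B\<close> by auto
  have near_e: "linked ?C u (src e) \<or> linked ?C u (tgt e)" if "u \<in> {1..n}" for u
  proof -
    have "linked (insert e ?C) u (src f)" "linked (insert e ?C) u (tgt f)"
      using span that f B by (auto simp: spanning_def)
    then show ?thesis
      unfolding linked_insert_iff using separated by (meson linked_sym linked_trans)
  qed
  have "linked ?C (src e) (src f) \<and> linked ?C (tgt e) (tgt f)
      \<or> linked ?C (tgt e) (src f) \<and> linked ?C (src e) (tgt f)"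
    using near_e[OF f(1)] near_e[OF f(2)] separated by (meson linked_sym linked_trans)
  then have "linked ?C u (src f) \<or> linked ?C u (tgt f)" if "u \<in> {1..n}" for u
    using near_e[OF that] by (meson linked_trans)
  then show ?thesis
    unfolding spanning_def linked_insert_iff by (meson linked_sym linked_trans)
qed

section \<open>Paths, circles and their gains\<close>

definition defect :: "(nat \<Rightarrow> 'a::ring_1) \<Rightarrow> gedge \<Rightarrow> 'a" where
  "defect x e = x (tgt e) - x (src e) - of_int (gain e)"

definition gain_path :: "gedge set \<Rightarrow> nat list \<Rightarrow> gedge list \<Rightarrow> bool" where
  "gain_path S vs es \<longleftrightarrow> length vs = Suc (length es) \<and> distinct vs \<and>
     (\<forall>t<length es. es ! t \<in> S \<and> ends (es ! t) = {vs ! t, vs ! Suc t})"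

definition path_gain :: "nat list \<Rightarrow> gedge list \<Rightarrow> int" where
  "path_gain vs es = (\<Sum>t<length es. dgain (es ! t) (vs ! t))"

definition circle_gain :: "nat list \<Rightarrow> gedge list \<Rightarrow> int" where
  "circle_gain vs es = (\<Sum>t<length vs. dgain (es ! t) (vs ! t))"

definition balanced_by :: "gedge set \<Rightarrow> gedge \<Rightarrow> bool" where
  "balanced_by S e \<longleftrightarrow> (\<exists>vs es. gain_path S vs es \<and> ends e = {vs ! 0, vs ! length es} \<and>
     path_gain vs es + dgain e (vs ! length es) = 0)"

lemma gain_path_mono: "gain_path S vs es \<Longrightarrow> set es \<subseteq> T \<Longrightarrow> gain_path T vs es"
  unfolding gain_path_def by (auto dest: nth_mem)

lemma gain_path_subset: "gain_path S vs es \<Longrightarrow> set es \<subseteq> S"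
  unfolding gain_path_def subset_iff in_set_conv_nth by metis

lemma gain_path_distinct:
  assumes "gain_path S vs es"
  shows "distinct es"
  unfolding distinct_conv_nth
proof (intro allI impI notI)
  fix s t assume st: "s < length es" "t < length es" "s \<noteq> t" and "es ! s = es ! t"
  then have "{vs ! s, vs ! Suc s} = {vs ! t, vs ! Suc t}"
    using assms unfolding gain_path_def by metis
  moreover have "length vs = Suc (length es)" "distinct vs"
    using assms by (auto simp: gain_path_def)
  ultimately show False
    using st by (auto simp: doubleton_eq_iff nth_eq_iff_index_eq)
qed

lemma gain_path_linked:
  assumes "gain_path S vs es" "t \<le> length es"
  shows "linked S (vs ! 0) (vs ! t)"
  using assms(2)
proof (induction t)
  case (Suc t)
  then have "es ! t \<in> S" "ends (es ! t) = {vs ! t, vs ! Suc t}"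
    using assms(1) by (auto simp: gain_path_def)
  then have "linked S (vs ! t) (vs ! Suc t)"
    using linked_edge linked_ends_iff by blast
  then show ?case
    using Suc linked_trans by auto
qed simp

lemma gain_path_snoc:
  assumes "gain_path S vs es" "e \<in> S" "ends e = {vs ! length es, z}" "z \<notin> set vs"
  shows "gain_path S (vs @ [z]) (es @ [e])"
  unfolding gain_path_def
proof (intro conjI allI impI)
  have len: "length vs = Suc (length es)"
    using assms(1) by (simp add: gain_path_def)
  fix t assume t: "t < length (es @ [e])"
  show "(es @ [e]) ! t \<in> S" "ends ((es @ [e]) ! t) = {(vs @ [z]) ! t, (vs @ [z]) ! Suc t}"
    using t assms len by (cases "t = length es"; auto simp: gain_path_def nth_append)+
qed (use assms in \<open>auto simp: gain_path_def\<close>)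

lemma linked_imp_gain_path:
  assumes "linked S u v"
  obtains vs es where "gain_path S vs es" "vs ! 0 = u" "vs ! length es = v"
proof -
  have "\<exists>vs es. gain_path S vs es \<and> vs ! 0 = u \<and> vs ! length es = v"
    using assms unfolding linked_def
  proof induction
    case base
    show ?case
      by (rule exI[of _ "[u]"], rule exI[of _ "[]"]) (simp add: gain_path_def)
  next
    case (step y z)
    then obtain vs es where path: "gain_path S vs es" "vs ! 0 = u" "vs ! length es = y"
      by auto
    then have len: "length vs = Suc (length es)"
      by (simp add: gain_path_def)
    obtain g where "(y, z, g) \<in> S \<or> (z, y, g) \<in> S"
      using step.hyps(2) by (auto simp: adj_def)
    then obtain e where e: "e \<in> S" "ends e = {y, z}"
      by (metis ends_def fst_conv snd_conv insert_commute)
    show ?case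
    proof (cases "z \<in> set vs")
      case True
      then obtain t where t: "t < length vs" "vs ! t = z"
        by (auto simp: in_set_conv_nth)
      then have "gain_path S (take (Suc t) vs) (take t es)"
        using path(1) len by (auto simp: gain_path_def)
      then show ?thesis
        using path(2) t len by (intro exI[of _ "take (Suc t) vs"] exI[of _ "take t es"]) auto
    next
      case False
      then have "gain_path S (vs @ [z]) (es @ [e])"
        using path e by (intro gain_path_snoc) auto
      then show ?thesis
        using path(2) len
        by (intro exI[of _ "vs @ [z]"] exI[of _ "es @ [e]"]) (auto simp: nth_append)
    qed
  qed
  then show ?thesis
    using that by blast
qed

lemma balanced_by_linked:
  assumes "balanced_by S e"
  shows "linked S (src e) (tgt e)"
proof -
  obtain vs es where "gain_path S vs es" "ends e = {vs ! 0, vs ! length es}"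
    using assms by (auto simp: balanced_by_def)
  then show ?thesis
    using gain_path_linked[of S vs es "length es"] linked_ends_iff by blast
qed

lemma balanced_by_mono:
  assumes "balanced_by S e" "S \<subseteq> T"
  shows "balanced_by T e"
  using assms gain_path_mono gain_path_subset unfolding balanced_by_def by (meson subset_trans)

subsection \<open>Circles as closed paths\<close>

lemma circle_seq_snoc_iff:
  assumes "src e \<noteq> tgt e"
  shows "circle_seq vs (es @ [e])
    \<longleftrightarrow> gain_path (set es) vs es \<and> e \<notin> set es \<and> ends e = {vs ! 0, vs ! length es}"
proof
  let ?m = "length es"
  assume circle: "circle_seq vs (es @ [e])"
  then have len: "length vs = Suc ?m" and "?m \<noteq> 0"
    by (auto simp: circle_seq_def)
  have ends: "ends ((es @ [e]) ! t) = {vs ! t, vs ! ((t + 1) mod Suc ?m)}" if "t < Suc ?m" for t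
    using circle that len by (auto simp: circle_seq_def)
  have "ends (es ! t) = {vs ! t, vs ! Suc t}" if "t < ?m" for t
    using ends[of t] that by (simp add: nth_append)
  moreover have "ends e = {vs ! 0, vs ! ?m}"
    using ends[of ?m] by (simp add: insert_commute)
  ultimately show "gain_path (set es) vs es \<and> e \<notin> set es \<and> ends e = {vs ! 0, vs ! ?m}"
    using circle len by (auto simp: gain_path_def circle_seq_def)
next
  let ?m = "length es"
  assume R: "gain_path (set es) vs es \<and> e \<notin> set es \<and> ends e = {vs ! 0, vs ! ?m}"
  then have len: "length vs = Suc ?m"
    by (simp add: gain_path_def)
  have "?m \<noteq> 0"
    using R assms by (auto simp: ends_def doubleton_eq_iff)
  have "ends ((es @ [e]) ! t) = {vs ! t, vs ! ((t + 1) mod length vs)}" if "t < length vs" for t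
  proof (cases "t = ?m")
    case True
    then show ?thesis
      using R len by (simp add: insert_commute)
  next
    case False
    then have "t < ?m"
      using that len by simp
    then show ?thesis
      using R len by (simp add: gain_path_def nth_append)
  qed
  then show "circle_seq vs (es @ [e])"
    using R len \<open>?m \<noteq> 0\<close> gain_path_distinct[of "set es" vs es]
    by (auto simp: circle_seq_def gain_path_def Suc_le_eq)
qed

lemma circle_gain_snoc:
  assumes "length vs = Suc (length es)"
  shows "circle_gain vs (es @ [e]) = path_gain vs es + dgain e (vs ! length es)"
  unfolding circle_gain_def path_gain_def assms by (simp add: nth_append)

lemma circle_seq_rotate:
  assumes "circle_seq vs es"
  shows "circle_seq (rotate k vs) (rotate k es)"
proof -
  let ?L = "length vs"
  have len: "length es = ?L" "vs \<noteq> []"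
    and ends: "\<And>t. t < ?L \<Longrightarrow> ends (es ! t) = {vs ! t, vs ! ((t + 1) mod ?L)}"
    using assms by (auto simp: circle_seq_def)
  have "ends (rotate k es ! t) = {rotate k vs ! t, rotate k vs ! ((t + 1) mod ?L)}"
    if "t < ?L" for t
    using that len ends[of "(k + t) mod ?L"] by (simp add: nth_rotate mod_simps)
  then show ?thesis
    using assms by (simp add: circle_seq_def)
qed

lemma circle_gain_rotate:
  assumes "length es = length vs"
  shows "circle_gain (rotate k vs) (rotate k es) = circle_gain vs es"
proof -
  let ?gains = "\<lambda>vs es. map2 dgain es vs"
  have sum_list: "circle_gain us fs = sum_list (?gains us fs)" if "length fs = length us" for us fs
    using that by (simp add: circle_gain_def sum_list_sum_nth atLeast0LessThan)
  have "?gains (rotate k vs) (rotate k es) = rotate k (?gains vs es)"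
  proof (cases "vs = []")
    case False
    then show ?thesis
      using assms by (intro nth_equalityI) (simp_all add: nth_rotate)
  qed (use assms in simp)
  moreover have "sum_list (rotate k (?gains vs es)) = sum_list (?gains vs es)"
    by (metis rotate_drop_take append_take_drop_id sum_list_append add.commute)
  ultimately show ?thesis
    using assms by (simp add: sum_list)
qed

lemma circle_minus_edge:
  assumes circle: "circle_seq vs es" and e: "e \<in> set es" "src e \<noteq> tgt e"
  obtains us fs where "gain_path (set es - {e}) us fs" "ends e = {us ! 0, us ! length fs}"
    "path_gain us fs + dgain e (us ! length fs) = circle_gain vs es"
proof -
  obtain as bs where es: "es = as @ e # bs"
    using e(1) by (meson split_list)
  let ?k = "Suc (length as)"
  have rotate: "rotate ?k es = (bs @ as) @ [e]"
    using rotate_append[of "as @ [e]" bs] by (simp add: es)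
  have "circle_seq (rotate ?k vs) ((bs @ as) @ [e])"
    using circle_seq_rotate[OF circle, of ?k] unfolding rotate .
  then have path: "gain_path (set (bs @ as)) (rotate ?k vs) (bs @ as)"
    and ends: "ends e = {rotate ?k vs ! 0, rotate ?k vs ! length (bs @ as)}"
    unfolding circle_seq_snoc_iff[OF e(2)] by blast+
  moreover have "set (bs @ as) = set es - {e}"
    using circle by (auto simp: es circle_seq_def)
  moreover have "path_gain (rotate ?k vs) (bs @ as) + dgain e (rotate ?k vs ! length (bs @ as))
      = circle_gain vs es"
    using circle_gain_snoc[of "rotate ?k vs" "bs @ as" e] circle_gain_rotate[of es vs ?k] circle
    unfolding rotate by (simp add: circle_seq_def es)
  ultimately show ?thesis
    using that by metis
qed

lemma is_circle_minus_edge_linked: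
  assumes "is_circle E C" "loopless E" "e \<in> C"
  shows "linked (C - {e}) (src e) (tgt e)"
proof -
  obtain vs es where "circle_seq vs es" "set es = C"
    using assms(1) by (auto simp: is_circle_def)
  moreover have "src e \<noteq> tgt e"
    using assms by (auto simp: is_circle_def loopless_def)
  ultimately obtain us fs where "gain_path (C - {e}) us fs" "ends e = {us ! 0, us ! length fs}"
    using circle_minus_edge[of vs es e] assms(3) by metis
  then show ?thesis
    using gain_path_linked linked_ends_iff by blast
qed

lemma linked_closes_circle:
  assumes "linked S (src e) (tgt e)" "src e \<noteq> tgt e" "e \<notin> S" "insert e S \<subseteq> E"
  obtains C where "is_circle E C" "C \<subseteq> insert e S"
proof -
  obtain vs es where path: "gain_path S vs es" "vs ! 0 = src e" "vs ! length es = tgt e"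
    using assms(1) by (rule linked_imp_gain_path)
  have sub: "set es \<subseteq> S"
    using path(1) by (rule gain_path_subset)
  then have "circle_seq vs (es @ [e])"
    using path gain_path_mono[OF path(1) order_refl] assms(3)
    by (auto simp: circle_seq_snoc_iff[OF assms(2)] ends_def)
  moreover have "set (es @ [e]) \<subseteq> E"
    using sub assms(4) by auto
  ultimately have "is_circle E (set (es @ [e]))"
    unfolding is_circle_def by blast
  then show ?thesis
    using that sub by auto
qed

lemma balanced_circle_minus_edge:
  assumes "balanced_circle E C" "loopless E" "e \<in> C"
  shows "balanced_by (C - {e}) e"
proof -
  obtain vs es where "circle_seq vs es" "set es = C" "circle_gain vs es = 0"
    using assms(1) by (auto simp: balanced_circle_def circle_gain_def)
  moreover have "src e \<noteq> tgt e"
    using assms by (auto simp: balanced_circle_def loopless_def)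
  ultimately show ?thesis
    using circle_minus_edge[of vs es e] assms(3) unfolding balanced_by_def by metis
qed

lemma balanced_by_closes_circle:
  assumes "balanced_by S e" "src e \<noteq> tgt e" "e \<notin> S" "insert e S \<subseteq> E"
  obtains C where "balanced_circle E C" "C \<subseteq> insert e S" "e \<in> C"
proof -
  obtain vs es where path: "gain_path S vs es" "ends e = {vs ! 0, vs ! length es}"
    and gain: "path_gain vs es + dgain e (vs ! length es) = 0"
    using assms(1) by (auto simp: balanced_by_def)
  have sub: "set es \<subseteq> S"
    using path(1) by (rule gain_path_subset)
  then have "circle_seq vs (es @ [e])"
    using path gain_path_mono[OF path(1) order_refl] assms(3)
    by (auto simp: circle_seq_snoc_iff[OF assms(2)])
  moreover have "circle_gain vs (es @ [e]) = 0"
    using gain path(1) by (simp add: circle_gain_snoc gain_path_def)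
  moreover have "set (es @ [e]) \<subseteq> E"
    using sub assms(4) by auto
  ultimately have "balanced_circle E (set (es @ [e]))"
    unfolding balanced_circle_def circle_gain_def by blast
  then show ?thesis
    using that sub by auto
qed

subsection \<open>Forests, NBC sets and spanning trees\<close>

lemma is_forest_iff:
  assumes "loopless E"
  shows "is_forest E S \<longleftrightarrow> S \<subseteq> E \<and> circle_free S"
proof
  assume forest: "is_forest E S"
  have "circle_free S"
    unfolding circle_free_def
  proof (intro ballI notI)
    fix e assume e: "e \<in> S" "linked (S - {e}) (src e) (tgt e)"
    then have "insert e (S - {e}) \<subseteq> E" "src e \<noteq> tgt e"
      using forest assms by (auto simp: is_forest_def loopless_def)
    then obtain C where "is_circle E C" "C \<subseteq> insert e (S - {e})"
      using linked_closes_circle[OF e(2)] by blast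
    then show False
      using forest e(1) by (auto simp: is_forest_def)
  qed
  then show "S \<subseteq> E \<and> circle_free S"
    using forest by (simp add: is_forest_def)
next
  assume S: "S \<subseteq> E \<and> circle_free S"
  have "\<not> is_circle E C" if "C \<subseteq> S" for C
  proof
    assume C: "is_circle E C"
    then have "C \<noteq> {}"
      by (auto simp: is_circle_def circle_seq_def)
    then obtain e where e: "e \<in> C"
      by blast
    then have "linked (C - {e}) (src e) (tgt e)"
      by (rule is_circle_minus_edge_linked[OF C assms])
    then have "linked (S - {e}) (src e) (tgt e)"
      by (rule linked_mono) (use that in auto)
    then show False
      using S e that by (auto simp: circle_free_def)
  qed
  then show "is_forest E S"
    using S by (auto simp: is_forest_def)
qed

lemma no_broken_circuit_iff:
  assumes loopless: "loopless E" and inj: "inj_on ord E" and "S \<subseteq> E"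
  shows "(\<forall>C. balanced_circle E C \<longrightarrow> \<not> broken_circuit ord C \<subseteq> S)
    \<longleftrightarrow> (\<forall>e\<in>E. \<not> balanced_by {f \<in> S. ord e < ord f} e)"
proof
  assume none: "\<forall>C. balanced_circle E C \<longrightarrow> \<not> broken_circuit ord C \<subseteq> S"
  show "\<forall>e\<in>E. \<not> balanced_by {f \<in> S. ord e < ord f} e"
  proof (intro ballI notI)
    fix e assume e: "e \<in> E" "balanced_by {f \<in> S. ord e < ord f} e"
    then have "insert e {f \<in> S. ord e < ord f} \<subseteq> E" "src e \<noteq> tgt e"
      using loopless \<open>S \<subseteq> E\<close> by (auto simp: loopless_def)
    then obtain C where C: "balanced_circle E C" "C \<subseteq> insert e {f \<in> S. ord e < ord f}" "e \<in> C"
      using balanced_by_closes_circle[OF e(2)] by blast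
    have "broken_circuit ord C \<subseteq> S"
      by (auto simp: broken_circuit_def dest!: subsetD[OF C(2)])
    then show False
      using none C(1) by blast
  qed
next
  assume none: "\<forall>e\<in>E. \<not> balanced_by {f \<in> S. ord e < ord f} e"
  show "\<forall>C. balanced_circle E C \<longrightarrow> \<not> broken_circuit ord C \<subseteq> S"
  proof (intro allI impI notI)
    fix C assume C: "balanced_circle E C" "broken_circuit ord C \<subseteq> S"
    then have "C \<subseteq> E" "C \<noteq> {}" "finite C"
      by (auto simp: balanced_circle_def circle_seq_def)
    then obtain e where e: "e \<in> C" "\<And>f. f \<in> C \<Longrightarrow> ord e \<le> ord f"
      by (metis arg_min_if_finite(1) arg_min_least)
    have "C - {e} \<subseteq> {f \<in> S. ord e < ord f}"
    proof
      fix f assume f: "f \<in> C - {e}"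
      then have "ord f \<noteq> ord e"
        using inj \<open>C \<subseteq> E\<close> e(1) by (auto simp: inj_on_def)
      then have "ord e < ord f"
        using e(2)[of f] f by simp
      then show "f \<in> {f \<in> S. ord e < ord f}"
        using f e(1) C(2) by (auto simp: broken_circuit_def)
    qed
    then have "balanced_by {f \<in> S. ord e < ord f} e"
      using balanced_circle_minus_edge[OF C(1) loopless e(1)] balanced_by_mono by blast
    then show False
      using none e(1) \<open>C \<subseteq> E\<close> by blast
  qed
qed

lemma spanning_tree_iff:
  "loopless E \<Longrightarrow> spanning_tree n E S \<longleftrightarrow> S \<subseteq> E \<and> circle_free S \<and> spanning n S"
  by (simp add: spanning_tree_def is_forest_iff spanning_def linked_def)

lemma nbc_basis_iff:
  assumes "loopless E" "inj_on ord E"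
  shows "nbc_basis n E ord B \<longleftrightarrow> B \<subseteq> E \<and> circle_free B \<and> spanning n B \<and>
    (\<forall>e\<in>E. \<not> balanced_by {f \<in> B. ord e < ord f} e)"
  by (cases "B \<subseteq> E") (auto simp: nbc_basis_def nbc_set_def spanning_tree_iff is_forest_iff
      no_broken_circuit_iff assms)

lemma exchange_spanning_tree_iff:
  assumes loopless: "loopless E" and within: "edges_within n E"
    and B: "B \<subseteq> E" "circle_free B" "spanning n B" and e: "e \<in> B" and f: "f \<in> E"
  shows "spanning_tree n E ((B - {e}) \<union> {f}) \<longleftrightarrow> \<not> linked (B - {e}) (src f) (tgt f)"
proof
  assume "spanning_tree n E ((B - {e}) \<union> {f})"
  then have free: "circle_free (insert f (B - {e}))" and span: "spanning n (insert f (B - {e}))"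
    by (auto simp: spanning_tree_iff[OF loopless])
  have "f \<notin> B - {e}"
  proof
    assume "f \<in> B - {e}"
    then have "spanning n (B - {e})"
      using span by (simp add: insert_absorb)
    moreover have "src e \<in> {1..n}" "tgt e \<in> {1..n}"
      using e B(1) within by (auto simp: edges_within_def)
    ultimately show False
      using B(2) e by (auto simp: spanning_def circle_free_def)
  qed
  then show "\<not> linked (B - {e}) (src f) (tgt f)"
    using free by (simp add: circle_free_insert_iff)
next
  assume separated: "\<not> linked (B - {e}) (src f) (tgt f)"
  then have "f \<notin> B - {e}"
    using linked_edge[of f "B - {e}"] by blast
  then have "circle_free (insert f (B - {e}))"
    using separated circle_free_subset[OF B(2), of "B - {e}"] by (auto simp: circle_free_insert_iff)
  moreover have "spanning n (insert f (B - {e}))"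
    using f within
    by (intro spanning_exchange[OF B(3) e _ _ separated]) (auto simp: edges_within_def)
  ultimately show "spanning_tree n E ((B - {e}) \<union> {f})"
    using B f by (auto simp: spanning_tree_iff[OF loopless])
qed

subsection \<open>Defects along paths\<close>

definition subtraction_closed :: "('a::ab_group_add \<Rightarrow> bool) \<Rightarrow> bool" where
  "subtraction_closed P \<longleftrightarrow> P 0 \<and> (\<forall>a b. P a \<longrightarrow> P b \<longrightarrow> P (a - b))"

lemma subtraction_closed_add:
  assumes "subtraction_closed P" "P a" "P b"
  shows "P (a + b)"
proof -
  have "P (a - (0 - b))"
    using assms unfolding subtraction_closed_def by blast
  then show ?thesis
    by simp
qed

lemma subtraction_closed_minus_iff: "subtraction_closed P \<Longrightarrow> P (- a) \<longleftrightarrow> P a"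
  unfolding subtraction_closed_def by (metis diff_0 minus_minus)

lemma subtraction_closed_add_iff:
  assumes "subtraction_closed P" "P (a + b)"
  shows "P a \<longleftrightarrow> P b"
  using assms unfolding subtraction_closed_def
  by (metis add_diff_cancel_left' add_diff_cancel_right')

lemma gain_path_defect:
  fixes x :: "nat \<Rightarrow> 'a::ring_1"
  assumes path: "gain_path S vs es" and P: "subtraction_closed P"
    and S: "\<And>e. e \<in> S \<Longrightarrow> P (defect x e)"
  shows "P (x (vs ! length es) - x (vs ! 0) - of_int (path_gain vs es))"
proof -
  have "P (x (vs ! t) - x (vs ! 0) - of_int (\<Sum>s<t. dgain (es ! s) (vs ! s)))"
    if "t \<le> length es" for t
    using that
  proof (induction t)
    case 0
    then show ?case
      using P by (simp add: subtraction_closed_def)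
  next
    case (Suc t)
    then have e: "es ! t \<in> S" "ends (es ! t) = {vs ! t, vs ! Suc t}" and "vs ! t \<noteq> vs ! Suc t"
      using path by (auto simp: gain_path_def nth_eq_iff_index_eq)
    have "P (x (vs ! Suc t) - x (vs ! t) - of_int (dgain (es ! t) (vs ! t)))" (is "P ?step")
    proof (cases "src (es ! t) = vs ! t")
      case True
      then have "tgt (es ! t) = vs ! Suc t"
        using e(2) \<open>vs ! t \<noteq> vs ! Suc t\<close> by (auto simp: ends_def doubleton_eq_iff)
      then show ?thesis
        using S[OF e(1)] True by (simp add: dgain_def defect_def)
    next
      case False
      then have "src (es ! t) = vs ! Suc t" "tgt (es ! t) = vs ! t"
        using e(2) by (auto simp: ends_def doubleton_eq_iff)
      then have "?step = - defect x (es ! t)"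
        using False by (simp add: dgain_def defect_def)
      then show ?thesis
        using S[OF e(1)] subtraction_closed_minus_iff[OF P] by simp
    qed
    then have "P (?step + (x (vs ! t) - x (vs ! 0) - of_int (\<Sum>s<t. dgain (es ! s) (vs ! s))))"
      using Suc by (intro subtraction_closed_add[OF P]) auto
    then show ?case
      by (simp add: algebra_simps)
  qed
  from this[of "length es"] show ?thesis
    by (simp add: path_gain_def)
qed

lemma closing_edge_defect_iff:
  fixes x :: "nat \<Rightarrow> 'a::ring_1"
  assumes path: "gain_path S vs es" and ends: "ends e = {vs ! 0, vs ! length es}" "src e \<noteq> tgt e"
    and P: "subtraction_closed P" and S: "\<And>e. e \<in> S \<Longrightarrow> P (defect x e)"
  shows "P (defect x e) \<longleftrightarrow> P (of_int (path_gain vs es + dgain e (vs ! length es)))"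
proof -
  let ?m = "length es"
  let ?path = "x (vs ! ?m) - x (vs ! 0) - of_int (path_gain vs es)"
  let ?total = "of_int (path_gain vs es + dgain e (vs ! ?m)) :: 'a"
  have "P ?path"
    by (rule gain_path_defect[OF path P S])
  show ?thesis
  proof (cases "src e = vs ! ?m")
    case True
    then have "tgt e = vs ! 0"
      using ends by (auto simp: ends_def doubleton_eq_iff)
    then have "defect x e + ?total = - ?path"
      using True by (simp add: dgain_def defect_def)
    then show ?thesis
      using subtraction_closed_add_iff[OF P, of "defect x e" ?total] \<open>P ?path\<close>
        subtraction_closed_minus_iff[OF P] by metis
  next
    case False
    then have "src e = vs ! 0" "tgt e = vs ! ?m"
      using ends by (auto simp: ends_def doubleton_eq_iff)
    then have "defect x e + - ?total = ?path"
      using False by (simp add: dgain_def defect_def)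
    then show ?thesis
      using subtraction_closed_add_iff[OF P, of "defect x e" "- ?total"] \<open>P ?path\<close>
        subtraction_closed_minus_iff[OF P] by metis
  qed
qed

lemma balanced_by_defect:
  fixes x :: "nat \<Rightarrow> 'a::ring_1"
  assumes "balanced_by S e" "src e \<noteq> tgt e" "subtraction_closed P" "\<And>f. f \<in> S \<Longrightarrow> P (defect x f)"
  shows "P (defect x e)"
proof -
  obtain vs es where path: "gain_path S vs es" "ends e = {vs ! 0, vs ! length es}"
    and "path_gain vs es + dgain e (vs ! length es) = 0"
    using assms(1) by (auto simp: balanced_by_def)
  then have "P (defect x e) \<longleftrightarrow> P (of_int 0)"
    using closing_edge_defect_iff[OF path assms(2-4)] by simp
  then show ?thesis
    using assms(3) by (simp add: subtraction_closed_def)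
qed

lemma abs_path_gain_le:
  assumes "gain_path S vs es" "finite S"
  shows "\<bar>path_gain vs es\<bar> \<le> (\<Sum>f\<in>S. \<bar>gain f\<bar>)"
proof -
  have "\<bar>path_gain vs es\<bar> \<le> (\<Sum>t<length es. \<bar>gain (es ! t)\<bar>)"
    unfolding path_gain_def by (rule order_trans[OF sum_abs]) (intro sum_mono, auto simp: dgain_def)
  also have "\<dots> = (\<Sum>f\<leftarrow>es. \<bar>gain f\<bar>)"
    by (simp add: sum_list_sum_nth atLeast0LessThan)
  also have "\<dots> = (\<Sum>f\<in>set es. \<bar>gain f\<bar>)"
    by (rule sum_list_distinct_conv_sum_set[OF gain_path_distinct[OF assms(1)]])
  also have "\<dots> \<le> (\<Sum>f\<in>S. \<bar>gain f\<bar>)"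
    by (rule sum_mono2) (use assms gain_path_subset in auto)
  finally show ?thesis .
qed

lemma linked_unbalanced_defect:
  assumes "linked S (src e) (tgt e)" "\<not> balanced_by S e" "src e \<noteq> tgt e" "finite S" "e \<notin> S"
  obtains g where "g \<noteq> 0" "\<bar>g\<bar> \<le> (\<Sum>f\<in>insert e S. \<bar>gain f\<bar>)"
    "\<And>P x. subtraction_closed P \<Longrightarrow> (\<And>f. f \<in> S \<Longrightarrow> P (defect (x :: nat \<Rightarrow> 'a::ring_1) f)) \<Longrightarrow>
       P (defect x e) \<longleftrightarrow> P (of_int g)"
proof -
  obtain vs es where path: "gain_path S vs es" "vs ! 0 = src e" "vs ! length es = tgt e"
    using assms(1) by (rule linked_imp_gain_path)
  then have ends: "ends e = {vs ! 0, vs ! length es}"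
    by (simp add: ends_def)
  let ?g = "path_gain vs es + dgain e (vs ! length es)"
  show ?thesis
  proof (rule that[of ?g])
    show "?g \<noteq> 0"
      using assms(2) path(1) ends by (auto simp: balanced_by_def)
    have "\<bar>?g\<bar> \<le> \<bar>path_gain vs es\<bar> + \<bar>gain e\<bar>"
      by (simp add: dgain_def abs_triangle_ineq abs_triangle_ineq4)
    also have "\<dots> \<le> (\<Sum>f\<in>insert e S. \<bar>gain f\<bar>)"
      using abs_path_gain_le[OF path(1) assms(4)] assms(4,5) by simp
    finally show "\<bar>?g\<bar> \<le> (\<Sum>f\<in>insert e S. \<bar>gain f\<bar>)" .
    show "P (defect x e) \<longleftrightarrow> P (of_int ?g)"
      if "subtraction_closed P" "\<And>f. f \<in> S \<Longrightarrow> P (defect x f)" for P and x :: "nat \<Rightarrow> 'a"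
      by (rule closing_edge_defect_iff[OF path(1) ends assms(3) that])
  qed
qed

section \<open>Deletion and contraction\<close>

text \<open>In a minor the edges of \<open>D\<close> are contracted and those of \<open>E\<close> remain. No vertices are identified:
  a basis of the minor contains \<open>D\<close>.\<close>

definition gain_minor :: "nat \<Rightarrow> (gedge \<Rightarrow> nat) \<Rightarrow> gedge set \<Rightarrow> gedge set \<Rightarrow> bool" where
  "gain_minor n ord D E \<longleftrightarrow> finite D \<and> finite E \<and> edges_within n (D \<union> E) \<and> loopless (D \<union> E) \<and>
     inj_on ord E \<and> (\<forall>d\<in>D. \<forall>e\<in>E. ord e < ord d) \<and> circle_free D \<and> spanning n (D \<union> E)"

definition minor_bases :: "nat \<Rightarrow> (gedge \<Rightarrow> nat) \<Rightarrow> gedge set \<Rightarrow> gedge set \<Rightarrow> gedge set set" where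
  "minor_bases n ord D E = {B. D \<subseteq> B \<and> B \<subseteq> D \<union> E \<and> circle_free B \<and> spanning n B \<and>
     (\<forall>e\<in>E. \<not> balanced_by {f \<in> B. ord e < ord f} e)}"

definition minor_activity :: "(gedge \<Rightarrow> nat) \<Rightarrow> gedge set \<Rightarrow> gedge set \<Rightarrow> nat" where
  "minor_activity ord E B =
     card {b \<in> B \<inter> E. \<forall>f\<in>E. \<not> linked (B - {b}) (src f) (tgt f) \<longrightarrow> ord b \<le> ord f}"

definition activity_poly ::
  "nat \<Rightarrow> (gedge \<Rightarrow> nat) \<Rightarrow> gedge set \<Rightarrow> gedge set \<Rightarrow> 'a::comm_semiring_1 \<Rightarrow> 'a" where
  "activity_poly n ord D E y = (\<Sum>B\<in>minor_bases n ord D E. y ^ minor_activity ord E B)"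

text \<open>Always removing the largest remaining edge makes NBC conditions and activities of the other
  edges independent of the removed edge.\<close>

definition removable :: "nat \<Rightarrow> (gedge \<Rightarrow> nat) \<Rightarrow> gedge set \<Rightarrow> gedge set \<Rightarrow> gedge \<Rightarrow> bool" where
  "removable n ord D E e \<longleftrightarrow> gain_minor n ord D (insert e E) \<and> e \<notin> E \<and> (\<forall>f\<in>E. ord f < ord e)"

lemma removableD:
  assumes "removable n ord D E e"
  shows "e \<notin> D" "e \<notin> E" "finite D" "finite E" "edges_within n (insert e (D \<union> E))" "src e \<noteq> tgt e"
    "circle_free D" "\<forall>f\<in>E. ord f < ord e" "\<forall>d\<in>D. ord e < ord d"
  using assms by (auto simp: removable_def gain_minor_def edges_within_def loopless_def)

lemma gain_minor_delete:
  assumes "removable n ord D E e" "linked (D \<union> E) (src e) (tgt e)"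
  shows "gain_minor n ord D E"
  using assms spanning_delete[of n e "D \<union> E"]
  by (auto simp: removable_def gain_minor_def edges_within_def loopless_def)

lemma gain_minor_contract:
  assumes "removable n ord D E e" "\<not> linked D (src e) (tgt e)"
  shows "gain_minor n ord (insert e D) E"
  using assms removableD(1)[OF assms(1)]
  by (auto simp: removable_def gain_minor_def edges_within_def loopless_def circle_free_insert_iff)

lemma gain_minor_induct [consumes 1, case_names empty insert]:
  assumes "gain_minor n ord D E"
    and empty: "\<And>D. gain_minor n ord D {} \<Longrightarrow> P D {}"
    and insert: "\<And>D E e. removable n ord D E e \<Longrightarrow>
      (linked (D \<union> E) (src e) (tgt e) \<Longrightarrow> P D E) \<Longrightarrow>
      (\<not> linked D (src e) (tgt e) \<Longrightarrow> P (insert e D) E) \<Longrightarrow> P D (insert e E)"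
  shows "P D E"
proof -
  have "finite E"
    using assms(1) by (simp add: gain_minor_def)
  then show ?thesis
    using assms(1)
  proof (induction E arbitrary: D rule: finite_ranking_induct[where f = ord])
    case empty
    then show ?case
      by (rule assms(2))
  next
    case (insert e E)
    show ?case
    proof (cases "e \<in> E")
      case True
      then show ?thesis
        using insert by (simp add: insert_absorb)
    next
      case False
      have "ord f < ord e" if "f \<in> E" for f
        using insert.hyps(2)[OF that] insert.prems False that
        by (auto simp: gain_minor_def inj_on_def le_less)
      then have "removable n ord D E e"
        using insert.prems False by (simp add: removable_def)
      then show ?thesis
        by (intro assms(3)) (auto intro: insert.IH gain_minor_delete gain_minor_contract)
    qed
  qed
qed

lemma finite_minor_bases: "finite D \<Longrightarrow> finite E \<Longrightarrow> finite (minor_bases n ord D E)"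
  unfolding minor_bases_def by (rule finite_subset[of _ "Pow (D \<union> E)"]) auto

lemma larger_edges_of_basis:
  assumes "removable n ord D E e" "D \<subseteq> B" "B \<subseteq> D \<union> insert e E"
  shows "{f \<in> B. ord e < ord f} = D"
proof (intro set_eqI iffI)
  fix f assume f: "f \<in> {f \<in> B. ord e < ord f}"
  then have "f \<noteq> e" "f \<notin> E"
    using removableD(8)[OF assms(1)] by (auto dest: less_asym)
  then show "f \<in> D"
    using f assms(3) by blast
qed (use assms(2) removableD(9)[OF assms(1)] in blast)

lemma minor_bases_balanced:
  assumes "removable n ord D E e" "balanced_by D e"
  shows "minor_bases n ord D (insert e E) = {}"
  using larger_edges_of_basis[OF assms(1)] assms(2) by (auto simp: minor_bases_def)

lemma minor_bases_insert:
  assumes rem: "removable n ord D E e" and "\<not> balanced_by D e"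
  shows "minor_bases n ord D (insert e E)
      = minor_bases n ord D E \<union> minor_bases n ord (insert e D) E"
proof (intro equalityI subsetI)
  fix B assume "B \<in> minor_bases n ord D (insert e E)"
  then show "B \<in> minor_bases n ord D E \<union> minor_bases n ord (insert e D) E"
    by (cases "e \<in> B") (auto simp: minor_bases_def)
next
  fix B assume B: "B \<in> minor_bases n ord D E \<union> minor_bases n ord (insert e D) E"
  then have "{f \<in> B. ord e < ord f} = D"
    by (intro larger_edges_of_basis[OF rem]) (auto simp: minor_bases_def)
  then show "B \<in> minor_bases n ord D (insert e E)"
    using B assms(2) by (auto simp: minor_bases_def)
qed

lemma minor_bases_contract_linked:
  assumes "e \<notin> D" "linked D (src e) (tgt e)"
  shows "minor_bases n ord (insert e D) E = {}"
proof (rule ccontr)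
  assume "minor_bases n ord (insert e D) E \<noteq> {}"
  then obtain B where "insert e D \<subseteq> B" "circle_free B"
    by (auto simp: minor_bases_def)
  moreover from this have "linked (B - {e}) (src e) (tgt e)"
    using assms by (intro linked_mono[OF assms(2)]) auto
  ultimately show False
    by (auto simp: circle_free_def)
qed

lemma minor_bases_delete_isthmus:
  assumes "edges_within n {e}" "\<not> linked (D \<union> E) (src e) (tgt e)"
  shows "minor_bases n ord D E = {}"
proof (rule ccontr)
  assume "minor_bases n ord D E \<noteq> {}"
  then obtain B where "B \<subseteq> D \<union> E" "spanning n B"
    by (auto simp: minor_bases_def)
  then have "linked (D \<union> E) (src e) (tgt e)"
    using assms(1) linked_mono[of B] by (auto simp: spanning_def edges_within_def)
  then show False
    using assms(2) by contradiction
qed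

lemma minor_activity_delete:
  assumes "removable n ord D E e" "e \<notin> B"
  shows "minor_activity ord (insert e E) B = minor_activity ord E B"
  unfolding minor_activity_def using removableD(8)[OF assms(1)] assms(2)
  by (intro arg_cong[where f = card]) (auto simp: less_imp_le)

lemma basis_links_others_iff_isthmus:
  assumes rem: "removable n ord D E e" and B: "B \<in> minor_bases n ord (insert e D) E"
  shows "(\<forall>f\<in>E. linked (B - {e}) (src f) (tgt f)) \<longleftrightarrow> \<not> linked (D \<union> E) (src e) (tgt e)"
proof -
  let ?C = "B - {e}"
  have basis: "insert e D \<subseteq> B" "B \<subseteq> insert e D \<union> E" "spanning n B" and B_eq: "B = insert e ?C"
    and e_free: "\<not> linked ?C (src e) (tgt e)"
    using B by (auto simp: minor_bases_def circle_free_def)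
  show ?thesis
  proof
    assume others: "\<forall>f\<in>E. linked ?C (src f) (tgt f)"
    show "\<not> linked (D \<union> E) (src e) (tgt e)"
    proof
      assume "linked (D \<union> E) (src e) (tgt e)"
      moreover have "linked ?C (src f) (tgt f)" if "f \<in> D \<union> E" for f
        using that others basis(1) removableD(1)[OF rem] linked_edge[of f ?C] by blast
      ultimately show False
        using linked_subset_closure e_free by blast
    qed
  next
    assume isthmus: "\<not> linked (D \<union> E) (src e) (tgt e)"
    show "\<forall>f\<in>E. linked ?C (src f) (tgt f)"
    proof (rule ballI, rule ccontr)
      fix f assume f: "f \<in> E" and unlinked: "\<not> linked ?C (src f) (tgt f)"
      have "linked (insert e ?C) (src f) (tgt f)"
        using basis(3) f removableD(5)[OF rem] B_eq by (auto simp: spanning_def edges_within_def)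
      then have "linked ?C (src f) (src e) \<and> linked ?C (tgt e) (tgt f)
         \<or> linked ?C (src f) (tgt e) \<and> linked ?C (src e) (tgt f)"
        unfolding linked_insert_iff using unlinked by blast
      moreover have "linked ?C a b \<Longrightarrow> linked (D \<union> E) a b" for a b
        by (erule linked_mono) (use basis(2) in auto)
      moreover have "linked (D \<union> E) (src f) (tgt f)"
        using f by (auto intro: linked_edge)
      ultimately show False
        using isthmus by (meson linked_sym linked_trans)
    qed
  qed
qed

lemma minor_activity_contract:
  assumes rem: "removable n ord D E e" and B: "B \<in> minor_bases n ord (insert e D) E"
  shows "minor_activity ord (insert e E) B
    = minor_activity ord E B + of_bool (\<not> linked (D \<union> E) (src e) (tgt e))"
proof -
  let ?active = "\<lambda>E. {b \<in> B \<inter> E. \<forall>f\<in>E. \<not> linked (B - {b}) (src f) (tgt f) \<longrightarrow> ord b \<le> ord f}"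
  have "e \<in> ?active (insert e E) \<longleftrightarrow> (\<forall>f\<in>E. linked (B - {e}) (src f) (tgt f))"
    using B removableD(8)[OF rem] by (fastforce simp: minor_bases_def)
  also have "\<dots> \<longleftrightarrow> \<not> linked (D \<union> E) (src e) (tgt e)"
    by (rule basis_links_others_iff_isthmus[OF rem B])
  finally have e: "e \<in> ?active (insert e E) \<longleftrightarrow> \<not> linked (D \<union> E) (src e) (tgt e)" .
  have "b \<in> ?active (insert e E) \<longleftrightarrow> b \<in> ?active E" if "b \<noteq> e" for b
    using that removableD(8)[OF rem] by (auto simp: less_imp_le)
  then have "?active (insert e E)
      = (if linked (D \<union> E) (src e) (tgt e) then ?active E else insert e (?active E))"
    using e removableD(2)[OF rem]
    by (intro set_eqI) (metis (no_types, lifting) IntD2 insert_iff mem_Collect_eq)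
  moreover have "finite (?active E)" "e \<notin> ?active E"
    using removableD(2,4)[OF rem] by auto
  ultimately show ?thesis
    unfolding minor_activity_def by simp
qed

lemma activity_poly_insert:
  assumes rem: "removable n ord D E e" and unbalanced: "\<not> balanced_by D e"
  shows "activity_poly n ord D (insert e E) y = activity_poly n ord D E y
    + (if linked (D \<union> E) (src e) (tgt e) then 1 else y) * activity_poly n ord (insert e D) E y"
proof -
  let ?y = "if linked (D \<union> E) (src e) (tgt e) then 1 else y"
  have disj: "minor_bases n ord D E \<inter> minor_bases n ord (insert e D) E = {}"
    using removableD(1,2)[OF rem] by (auto simp: minor_bases_def)
  have "activity_poly n ord D (insert e E) y
      = (\<Sum>B\<in>minor_bases n ord D E. y ^ minor_activity ord (insert e E) B)
        + (\<Sum>B\<in>minor_bases n ord (insert e D) E. y ^ minor_activity ord (insert e E) B)"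
    unfolding activity_poly_def minor_bases_insert[OF assms]
    using disj removableD(3,4)[OF rem]
    by (intro sum.union_disjoint) (auto intro: finite_minor_bases)
  also have "(\<Sum>B\<in>minor_bases n ord D E. y ^ minor_activity ord (insert e E) B)
      = activity_poly n ord D E y"
    unfolding activity_poly_def
  proof (intro sum.cong refl)
    fix B assume "B \<in> minor_bases n ord D E"
    then have "e \<notin> B"
      using removableD(1,2)[OF rem] by (auto simp: minor_bases_def)
    then show "y ^ minor_activity ord (insert e E) B = y ^ minor_activity ord E B"
      by (simp add: minor_activity_delete[OF rem])
  qed
  also have "(\<Sum>B\<in>minor_bases n ord (insert e D) E. y ^ minor_activity ord (insert e E) B)
      = (\<Sum>B\<in>minor_bases n ord (insert e D) E. ?y * y ^ minor_activity ord E B)"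
    by (intro sum.cong refl) (simp add: minor_activity_contract[OF rem])
  also have "\<dots> = ?y * activity_poly n ord (insert e D) E y"
    by (simp add: activity_poly_def sum_distrib_left)
  finally show ?thesis .
qed

lemma activity_poly_empty:
  assumes "gain_minor n ord D {}"
  shows "activity_poly n ord D {} y = 1"
proof -
  have "minor_bases n ord D {} = {D}"
    using assms by (auto simp: minor_bases_def gain_minor_def)
  then show ?thesis
    by (simp add: activity_poly_def minor_activity_def)
qed

lemma activity_poly_balanced:
  assumes "removable n ord D E e" "balanced_by D e"
  shows "activity_poly n ord D (insert e E) y = 0"
  by (simp add: activity_poly_def minor_bases_balanced[OF assms])

lemma activity_poly_unbalanced:
  assumes rem: "removable n ord D E e" and "linked D (src e) (tgt e)" "\<not> balanced_by D e"
  shows "activity_poly n ord D (insert e E) y = activity_poly n ord D E y"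
proof -
  have "activity_poly n ord (insert e D) E y = 0"
    using minor_bases_contract_linked[OF removableD(1)[OF rem] assms(2)]
    by (simp add: activity_poly_def)
  then show ?thesis
    by (simp add: activity_poly_insert[OF rem assms(3)])
qed

lemma activity_poly_ordinary:
  assumes rem: "removable n ord D E e"
    and "\<not> linked D (src e) (tgt e)" "linked (D \<union> E) (src e) (tgt e)"
  shows "activity_poly n ord D (insert e E) y
    = activity_poly n ord D E y + activity_poly n ord (insert e D) E y"
proof -
  have "\<not> balanced_by D e"
    using assms(2) balanced_by_linked by blast
  then show ?thesis
    using assms(3) by (simp add: activity_poly_insert[OF rem])
qed

lemma activity_poly_isthmus:
  assumes rem: "removable n ord D E e" and isthmus: "\<not> linked (D \<union> E) (src e) (tgt e)"
  shows "activity_poly n ord D (insert e E) y = y * activity_poly n ord (insert e D) E y"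
proof -
  have "\<not> balanced_by D e"
    using isthmus linked_mono balanced_by_linked by blast
  moreover have "activity_poly n ord D E y = 0"
    using minor_bases_delete_isthmus[OF _ isthmus] removableD(5)[OF rem]
    by (simp add: activity_poly_def edges_within_def)
  ultimately show ?thesis
    using isthmus by (simp add: activity_poly_insert[OF rem])
qed

text \<open>The set \<open>U\<close> allows for invariants that satisfy the recursion only for minors supported on \<open>U\<close>.\<close>

theorem activity_poly_unique:
  fixes F :: "gedge set \<Rightarrow> gedge set \<Rightarrow> 'a::comm_semiring_1"
  assumes "gain_minor n ord D E" "D \<union> E \<subseteq> U"
    and empty: "\<And>D. gain_minor n ord D {} \<Longrightarrow> D \<subseteq> U \<Longrightarrow> F D {} = 1"
    and balanced: "\<And>D E e. removable n ord D E e \<Longrightarrow> insert e (D \<union> E) \<subseteq> U \<Longrightarrow> balanced_by D e \<Longrightarrow>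
      F D (insert e E) = 0"
    and unbalanced: "\<And>D E e. removable n ord D E e \<Longrightarrow> insert e (D \<union> E) \<subseteq> U \<Longrightarrow>
      linked D (src e) (tgt e) \<Longrightarrow> \<not> balanced_by D e \<Longrightarrow> F D (insert e E) = F D E"
    and ordinary: "\<And>D E e. removable n ord D E e \<Longrightarrow> insert e (D \<union> E) \<subseteq> U \<Longrightarrow>
      \<not> linked D (src e) (tgt e) \<Longrightarrow> linked (D \<union> E) (src e) (tgt e) \<Longrightarrow>
      F D (insert e E) = F D E + F (insert e D) E"
    and isthmus: "\<And>D E e. removable n ord D E e \<Longrightarrow> insert e (D \<union> E) \<subseteq> U \<Longrightarrow>
      \<not> linked (D \<union> E) (src e) (tgt e) \<Longrightarrow> F D (insert e E) = y * F (insert e D) E"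
  shows "F D E = activity_poly n ord D E y"
  using assms(1,2)
proof (induction rule: gain_minor_induct)
  case (empty D)
  then show ?case
    using assms(3) by (simp add: activity_poly_empty)
next
  case (insert D E e)
  note rem = insert.hyps
  have sub: "insert e (D \<union> E) \<subseteq> U" "D \<union> E \<subseteq> U" "insert e D \<union> E \<subseteq> U"
    using insert.prems by auto
  consider (balanced) "balanced_by D e"
    | (unbalanced) "linked D (src e) (tgt e)" "\<not> balanced_by D e"
    | (ordinary) "\<not> linked D (src e) (tgt e)" "linked (D \<union> E) (src e) (tgt e)"
    | (isthmus) "\<not> linked (D \<union> E) (src e) (tgt e)"
    by blast
  then show ?case
  proof cases
    case balanced
    then show ?thesis
      using assms(4)[OF rem sub(1)] by (simp add: activity_poly_balanced[OF rem])
  next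
    case unbalanced
    then have "linked (D \<union> E) (src e) (tgt e)"
      by (auto elim: linked_mono)
    then show ?thesis
      using assms(5)[OF rem sub(1) unbalanced] insert.IH(1) sub(2)
      by (simp add: activity_poly_unbalanced[OF rem unbalanced])
  next
    case ordinary
    then show ?thesis
      using assms(6)[OF rem sub(1) ordinary] insert.IH sub(2,3)
      by (simp add: activity_poly_ordinary[OF rem ordinary])
  next
    case isthmus
    then have "\<not> linked D (src e) (tgt e)"
      using linked_mono by blast
    then show ?thesis
      using assms(7)[OF rem sub(1) isthmus] insert.IH(2) sub(3)
      by (simp add: activity_poly_isthmus[OF rem isthmus])
  qed
qed

lemma nbc_basis_iff_minor_basis:
  assumes "loopless E" "inj_on ord E"
  shows "nbc_basis n E ord B \<longleftrightarrow> B \<in> minor_bases n ord {} E"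
  by (simp add: nbc_basis_iff[OF assms] minor_bases_def)

lemma activity_eq_minor_activity:
  assumes "loopless E" "edges_within n E" and B: "B \<in> minor_bases n ord {} E"
  shows "activity n E ord B = minor_activity ord E B"
proof -
  have "active n E ord B e \<longleftrightarrow> (\<forall>f\<in>E. \<not> linked (B - {e}) (src f) (tgt f) \<longrightarrow> ord e \<le> ord f)"
    if "e \<in> B" for e
    using exchange_spanning_tree_iff[OF assms(1,2) _ _ _ that] B that
    by (auto simp: active_def minor_bases_def)
  then show ?thesis
    unfolding activity_def minor_activity_def using B
    by (intro arg_cong[where f = card]) (auto simp: minor_bases_def)
qed

section \<open>Colourings modulo \<open>q\<close>\<close>

definition satisfies_mod :: "int \<Rightarrow> (nat \<Rightarrow> int) \<Rightarrow> gedge \<Rightarrow> bool" where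
  "satisfies_mod q x e \<longleftrightarrow> q dvd defect x e"

definition colorings :: "nat \<Rightarrow> int \<Rightarrow> gedge set \<Rightarrow> gedge set \<Rightarrow> (nat \<Rightarrow> int) set" where
  "colorings n q D E = {x \<in> {1..n} \<rightarrow>\<^sub>E {0..<q}.
     (\<forall>e\<in>D. satisfies_mod q x e) \<and> (\<forall>e\<in>E. \<not> satisfies_mod q x e)}"

definition shift_vertices :: "nat \<Rightarrow> int \<Rightarrow> nat set \<Rightarrow> int \<Rightarrow> (nat \<Rightarrow> int) \<Rightarrow> nat \<Rightarrow> int" where
  "shift_vertices n q U s x = (\<lambda>i\<in>{1..n}. (x i + (if i \<in> U then s else 0)) mod q)"

lemma finite_colorings [simp]: "finite (colorings n q D E)"
  unfolding colorings_def
  by (rule finite_subset[of _ "{1..n} \<rightarrow>\<^sub>E {0..<q}"]) (auto intro: finite_PiE)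

lemma subtraction_closed_dvd: "subtraction_closed (\<lambda>a :: 'a::comm_ring_1. q dvd a)"
  by (simp add: subtraction_closed_def)

lemma satisfies_mod_cong:
  assumes "\<And>v. v \<in> ends e \<Longrightarrow> q dvd x v - y v - s"
  shows "satisfies_mod q x e \<longleftrightarrow> satisfies_mod q y e"
proof -
  have "q dvd (x (tgt e) - y (tgt e) - s) - (x (src e) - y (src e) - s)"
    by (rule dvd_diff; rule assms) (simp_all add: ends_def)
  also have "(x (tgt e) - y (tgt e) - s) - (x (src e) - y (src e) - s) = defect x e - defect y e"
    by (simp add: defect_def)
  finally show ?thesis
    unfolding satisfies_mod_def using dvd_add_right_iff[of q "defect x e - defect y e" "defect y e"]
    by simp
qed

lemma shift_vertices_colorings:
  assumes "0 < q" and within: "edges_within n (D \<union> E)" and x: "x \<in> colorings n q D E"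
    and U: "\<And>f. f \<in> D \<union> E \<Longrightarrow> src f \<in> U \<longleftrightarrow> tgt f \<in> U"
  shows "shift_vertices n q U s x \<in> colorings n q D E"
proof -
  have "satisfies_mod q (shift_vertices n q U s x) f \<longleftrightarrow> satisfies_mod q x f" if f: "f \<in> D \<union> E" for f
  proof (rule satisfies_mod_cong[where s = "if src f \<in> U then s else 0"])
    fix v assume v: "v \<in> ends f"
    then have "v \<in> {1..n}" "v \<in> U \<longleftrightarrow> src f \<in> U"
      using within f U[OF f] by (auto simp: edges_within_def ends_def)
    moreover have "q dvd (x v + a) mod q - x v - a" for a
      by (metis diff_diff_eq dvd_minus_mod dvd_diff_commute)
    ultimately show "q dvd shift_vertices n q U s x v - x v - (if src f \<in> U then s else 0)"
      by (simp add: shift_vertices_def)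
  qed
  moreover have "shift_vertices n q U s x \<in> {1..n} \<rightarrow>\<^sub>E {0..<q}"
    using \<open>0 < q\<close> by (auto simp: shift_vertices_def)
  ultimately show ?thesis
    using x by (auto simp: colorings_def)
qed

lemma shift_vertices_add:
  "shift_vertices n q U s (shift_vertices n q U t x) = shift_vertices n q U (s + t) x"
  by (auto simp: shift_vertices_def restrict_def mod_simps add_ac fun_eq_iff)

lemma shift_vertices_0: "x \<in> colorings n q D E \<Longrightarrow> shift_vertices n q U 0 x = x"
  by (rule extensionalityI[of _ "{1..n}"]) (auto simp: shift_vertices_def colorings_def PiE_iff)

lemma card_eq_mult_card_fibre:
  fixes act :: "int \<Rightarrow> 'a \<Rightarrow> 'a" and \<phi> :: "'a \<Rightarrow> int"
  assumes q: "0 < q" and closed: "\<And>s x. x \<in> X \<Longrightarrow> act s x \<in> X"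
    and add: "\<And>s t x. x \<in> X \<Longrightarrow> act s (act t x) = act (s + t) x"
    and zero: "\<And>x. x \<in> X \<Longrightarrow> act 0 x = x"
    and equivariant: "\<And>s x. x \<in> X \<Longrightarrow> \<phi> (act s x) = (\<phi> x + s) mod q"
  shows "card X = nat q * card {x \<in> X. \<phi> x = 0}"
proof -
  have range: "\<phi> x \<in> {0..<q}" if "x \<in> X" for x
    using equivariant[OF that, of 0] zero[OF that] q by (metis add.right_neutral atLeastLessThan_iff
        pos_mod_bound pos_mod_sign)
  have "bij_betw (\<lambda>(x, s). act s x) ({x \<in> X. \<phi> x = 0} \<times> {0..<q}) X"
    by (rule bij_betw_byWitness[where f' = "\<lambda>x. (act (- \<phi> x) x, \<phi> x)"])
      (use range in \<open>auto simp: closed add zero equivariant\<close>)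
  from bij_betw_same_card[OF this] show ?thesis
    by (simp add: card_cartesian_product mult.commute)
qed

lemma card_colorings_based:
  assumes "0 < q" "v \<in> {1..n}" "edges_within n (D \<union> E)"
  shows "card (colorings n q D E) = nat q * card {x \<in> colorings n q D E. x v = 0}"
proof (rule card_eq_mult_card_fibre[OF assms(1), where act = "shift_vertices n q UNIV"])
  fix x s assume x: "x \<in> colorings n q D E"
  show "shift_vertices n q UNIV s x \<in> colorings n q D E"
    by (rule shift_vertices_colorings[OF assms(1,3) x]) simp
  show "shift_vertices n q UNIV s x v = (x v + s) mod q"
    using assms(2) by (simp add: shift_vertices_def)
qed (auto simp: shift_vertices_add shift_vertices_0)

lemma card_colorings_isthmus:
  assumes "0 < q" and within: "edges_within n (insert e (D \<union> E))"
    and isthmus: "\<not> linked (D \<union> E) (src e) (tgt e)"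
  shows "card (colorings n q D E) = nat q * card (colorings n q (insert e D) E)"
proof -
  let ?U = "{u. linked (D \<union> E) (tgt e) u}"
  have e: "tgt e \<in> ?U" "src e \<notin> ?U" "tgt e \<in> {1..n}" "src e \<in> {1..n}"
    using isthmus linked_sym within by (auto simp: edges_within_def)
  have U: "src f \<in> ?U \<longleftrightarrow> tgt f \<in> ?U" if "f \<in> D \<union> E" for f
    using linked_edge[OF that] by (auto intro: linked_trans linked_sym)
  have "card (colorings n q D E) = nat q * card {x \<in> colorings n q D E. defect x e mod q = 0}"
  proof (rule card_eq_mult_card_fibre[OF assms(1), where act = "shift_vertices n q ?U"])
    fix x s assume x: "x \<in> colorings n q D E"
    show "shift_vertices n q ?U s x \<in> colorings n q D E"
      using within
      by (intro shift_vertices_colorings[OF assms(1) _ x U]) (auto simp: edges_within_def)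
    have "defect (shift_vertices n q ?U s x) e mod q
        = ((x (tgt e) + s) mod q - x (src e) mod q - gain e) mod q"
      using e by (simp add: defect_def shift_vertices_def)
    also have "\<dots> = (x (tgt e) + s - x (src e) - gain e) mod q"
      by (metis mod_diff_eq mod_diff_left_eq)
    also have "x (tgt e) + s - x (src e) - gain e = defect x e + s"
      by (simp add: defect_def)
    finally show "defect (shift_vertices n q ?U s x) e mod q = (defect x e mod q + s) mod q"
      by (simp add: mod_simps)
  qed (auto simp: shift_vertices_add shift_vertices_0)
  also have "{x \<in> colorings n q D E. defect x e mod q = 0} = colorings n q (insert e D) E"
    by (auto simp: colorings_def satisfies_mod_def)
  finally show ?thesis .
qed

lemma card_colorings_split:
  "card (colorings n q D E)
      = card (colorings n q D (insert e E)) + card (colorings n q (insert e D) E)"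
proof -
  have "colorings n q D E = colorings n q D (insert e E) \<union> colorings n q (insert e D) E"
    "colorings n q D (insert e E) \<inter> colorings n q (insert e D) E = {}"
    by (auto simp: colorings_def)
  then show ?thesis
    by (metis card_Un_disjoint finite_colorings)
qed

lemma colorings_balanced:
  assumes "balanced_by D e" "src e \<noteq> tgt e"
  shows "colorings n q D (insert e E) = {}"
  using balanced_by_defect[OF assms subtraction_closed_dvd[of q]]
  by (fastforce simp: colorings_def satisfies_mod_def)

lemma colorings_unbalanced:
  assumes "linked D (src e) (tgt e)" "\<not> balanced_by D e" "src e \<noteq> tgt e" "finite D" "e \<notin> D"
    and q: "(\<Sum>f\<in>insert e D. \<bar>gain f\<bar>) < q"
  shows "colorings n q (insert e D) E = {}"
proof -
  obtain g where g: "g \<noteq> 0" "\<bar>g\<bar> \<le> (\<Sum>f\<in>insert e D. \<bar>gain f\<bar>)"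
    and iff: "\<And>P x. subtraction_closed P \<Longrightarrow> (\<And>f. f \<in> D \<Longrightarrow> P (defect (x :: nat \<Rightarrow> int) f)) \<Longrightarrow>
       P (defect x e) \<longleftrightarrow> P (of_int g)"
    using linked_unbalanced_defect[OF assms(1-5), where 'a = int] by metis
  have "\<not> q dvd g"
    using g q dvd_imp_le_int[of g q] by force
  then show ?thesis
    using iff[OF subtraction_closed_dvd[of q]] by (auto simp: colorings_def satisfies_mod_def)
qed

lemma card_colorings_circle_free:
  assumes "0 < q" "finite D" "circle_free D" "edges_within n D"
  shows "card (colorings n q D {}) * nat q ^ card D = nat q ^ n"
  using assms(2-)
proof (induction D)
  case empty
  have "colorings n q {} {} = {1..n} \<rightarrow>\<^sub>E {0..<q}"
    by (auto simp: colorings_def)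
  then show ?case
    by (simp add: card_PiE)
next
  case (insert e D)
  have "circle_free D" "\<not> linked D (src e) (tgt e)"
    using insert by (auto simp: circle_free_insert_iff)
  moreover have "card (colorings n q D {}) = nat q * card (colorings n q (insert e D) {})"
    using insert calculation(2) by (intro card_colorings_isthmus[OF assms(1)]) auto
  ultimately show ?case
    using insert by (simp add: edges_within_def mult_ac)
qed

lemma colorings_eq_if_linked:
  assumes x: "x \<in> colorings n q D E" and y: "y \<in> colorings n q D E"
    and "linked D u v" "v \<in> {1..n}" "x u = y u"
  shows "x v = y v"
proof -
  have "q dvd x v - y v"
  proof (rule linked_invariant[OF assms(3), where P = "\<lambda>i. q dvd x i - y i"])
    fix e assume "e \<in> D"
    then have "q dvd defect x e - defect y e"
      using x y by (intro dvd_diff) (auto simp: colorings_def satisfies_mod_def)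
    also have "defect x e - defect y e = (x (tgt e) - y (tgt e)) - (x (src e) - y (src e))"
      by (simp add: defect_def)
    finally show "q dvd x (src e) - y (src e) \<longleftrightarrow> q dvd x (tgt e) - y (tgt e)"
      by (metis dvd_diff_right_iff dvd_diff_commute zdvd_zdiffD)
  qed (simp add: assms(5))
  moreover have "x v \<in> {0..<q}" "y v \<in> {0..<q}"
    using x y assms(4) by (auto simp: colorings_def)
  ultimately show ?thesis
    by (metis atLeastLessThan_iff mod_eq_dvd_iff mod_pos_pos_trivial)
qed

lemma card_colorings_spanning_tree:
  assumes q: "0 < q" and D: "finite D" "circle_free D" "edges_within n D" "spanning n D" and "1 \<le> n"
  shows "card (colorings n q D {}) = nat q"
proof -
  have based: "card (colorings n q D {}) = nat q * card {x \<in> colorings n q D {}. x 1 = 0}"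
    using assms by (intro card_colorings_based) auto
  have "x = y" if "x \<in> colorings n q D {}" "y \<in> colorings n q D {}" "x 1 = y 1" for x y
  proof (rule PiE_ext[of _ "{1..n}" "\<lambda>_. {0..<q}"])
    fix v assume "v \<in> {1..n}"
    then have "linked D 1 v"
      using D(4) \<open>1 \<le> n\<close> by (simp add: spanning_def)
    then show "x v = y v"
      using colorings_eq_if_linked that \<open>v \<in> {1..n}\<close> by blast
  qed (use that in \<open>auto simp: colorings_def\<close>)
  then have "card {x \<in> colorings n q D {}. x 1 = 0} \<le> 1"
    by (simp add: card_le_Suc0_iff_eq)
  moreover have "card (colorings n q D {}) \<noteq> 0"
    using card_colorings_circle_free[OF q D(1-3)] q by (intro notI) simp
  ultimately show ?thesis
    using based by (cases "card {x \<in> colorings n q D {}. x 1 = 0}") auto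
qed

lemma card_spanning_tree:
  assumes D: "finite D" "circle_free D" "edges_within n D" "spanning n D" and "1 \<le> n"
  shows "Suc (card D) = n"
proof -
  have "(2::nat) ^ Suc (card D) = 2 ^ n"
    using card_colorings_circle_free[of 2 D n] card_colorings_spanning_tree[of 2 D n] assms by simp
  then show ?thesis
    using power_inject_exp[of "2::nat" "Suc (card D)" n] by simp
qed

definition coloring_invariant :: "nat \<Rightarrow> int \<Rightarrow> gedge set \<Rightarrow> gedge set \<Rightarrow> real" where
  "coloring_invariant n q D E
      = (- 1) ^ (n - 1 + card D) * real (card (colorings n q D E)) / of_int q"

lemma coloring_invariant_split:
  assumes "e \<notin> D" "finite D"
  shows "coloring_invariant n q D (insert e E)
      = coloring_invariant n q D E + coloring_invariant n q (insert e D) E"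
  using assms card_colorings_split[of n q D E e]
  by (simp add: coloring_invariant_def distrib_left add_divide_distrib)

lemma coloring_invariant_isthmus:
  assumes "0 < q" "edges_within n (insert e (D \<union> E))" "e \<notin> D" "finite D"
    "\<not> linked (D \<union> E) (src e) (tgt e)"
  shows "coloring_invariant n q D (insert e E)
      = (1 - of_int q) * coloring_invariant n q (insert e D) E"
proof -
  have "coloring_invariant n q D E = - of_int q * coloring_invariant n q (insert e D) E"
    using assms card_colorings_isthmus[OF assms(1,2,5)] by (simp add: coloring_invariant_def)
  then show ?thesis
    using coloring_invariant_split[OF assms(3,4)] by (simp add: algebra_simps)
qed

theorem coloring_invariant_eq_activity_poly:
  assumes minor: "gain_minor n ord D E" and "1 \<le> n" and q: "(\<Sum>f\<in>D \<union> E. \<bar>gain f\<bar>) < q"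
  shows "coloring_invariant n q D E = activity_poly n ord D E (1 - of_int q)"
proof (rule activity_poly_unique[OF minor order_refl])
  have q_pos: "0 < q"
    using q by (meson abs_ge_zero order_le_less_trans sum_nonneg)
  show "coloring_invariant n q D' {} = 1" if "gain_minor n ord D' {}" for D'
  proof -
    have D': "finite D'" "circle_free D'" "edges_within n D'" "spanning n D'"
      using that by (auto simp: gain_minor_def)
    then have "card D' = n - 1"
      using card_spanning_tree[OF D' \<open>1 \<le> n\<close>] by simp
    then show ?thesis
      using card_colorings_spanning_tree[OF q_pos D' \<open>1 \<le> n\<close>] q_pos
      by (simp add: coloring_invariant_def flip: mult_2)
  qed
  fix D' E' e assume rem: "removable n ord D' E' e" and sub: "insert e (D' \<union> E') \<subseteq> D \<union> E"
  note rem = removableD[OF rem]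
  show "coloring_invariant n q D' (insert e E') = 0" if "balanced_by D' e"
    using colorings_balanced[OF that] rem(6) by (simp add: coloring_invariant_def)
  show "coloring_invariant n q D' (insert e E') = coloring_invariant n q D' E'"
    if "linked D' (src e) (tgt e)" "\<not> balanced_by D' e"
  proof -
    have "(\<Sum>f\<in>insert e D'. \<bar>gain f\<bar>) \<le> (\<Sum>f\<in>D \<union> E. \<bar>gain f\<bar>)"
      using sub minor by (intro sum_mono2) (auto simp: gain_minor_def)
    then have "colorings n q (insert e D') E' = {}"
      using q by (intro colorings_unbalanced[OF that rem(6,3,1)]) linarith
    then show ?thesis
      using coloring_invariant_split[OF rem(1,3), of n q E'] by (simp add: coloring_invariant_def)
  qed
  show "coloring_invariant n q D' (insert e E')
      = coloring_invariant n q D' E' + coloring_invariant n q (insert e D') E'"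
    by (rule coloring_invariant_split[OF rem(1,3)])
  show "coloring_invariant n q D' (insert e E')
      = (1 - of_int q) * coloring_invariant n q (insert e D') E'"
    if "\<not> linked (D' \<union> E') (src e) (tgt e)"
    by (rule coloring_invariant_isthmus[OF q_pos rem(5,1,3) that])
qed

section \<open>Counting colourings by the cyclic order of the colours\<close>

definition gap :: "nat \<Rightarrow> nat \<Rightarrow> nat \<Rightarrow> nat \<Rightarrow> int" where
  "gap k1 k2 u w = int k2 + 1 + (if u < w then int k1 else 0)"

definition separated :: "nat \<Rightarrow> nat \<Rightarrow> nat set \<Rightarrow> (nat \<Rightarrow> int) \<Rightarrow> bool" where
  "separated k1 k2 A y \<longleftrightarrow>
     (\<forall>u\<in>A. \<forall>w\<in>A. u \<noteq> w \<longrightarrow> y u + gap k1 k2 u w \<le> y w \<or> y w + gap k1 k2 w u \<le> y u)"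

definition spaced :: "nat \<Rightarrow> nat \<Rightarrow> nat list \<Rightarrow> int \<Rightarrow> int \<Rightarrow> (nat \<Rightarrow> int) set" where
  "spaced k1 k2 xs a b =
     {y \<in> set xs \<rightarrow>\<^sub>E {a..<b}. sorted_wrt (\<lambda>u w. y u + gap k1 k2 u w \<le> y w) xs}"

lemma gap_pos: "1 \<le> gap k1 k2 u w"
  by (simp add: gap_def)

lemma transp_gap: "transp (\<lambda>u w. y u + gap k1 k2 u w \<le> y w)"
proof (rule transpI)
  fix u v w assume "y u + gap k1 k2 u v \<le> y v" "y v + gap k1 k2 v w \<le> y w"
  moreover have "gap k1 k2 u w \<le> gap k1 k2 u v + gap k1 k2 v w"
    by (auto simp: gap_def)
  ultimately show "y u + gap k1 k2 u w \<le> y w"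
    by linarith
qed

lemma finite_spaced [simp]: "finite (spaced k1 k2 xs a b)"
  unfolding spaced_def by (rule finite_subset[of _ "set xs \<rightarrow>\<^sub>E {a..<b}"]) (auto intro: finite_PiE)

lemma sum_choose_int:
  assumes "1 \<le> l" "1 \<le> e"
  shows "(\<Sum>s\<in>{a..<b}. nat (b - s - e) choose l) = nat (b - a - e + 1) choose (Suc l)"
proof (cases "a \<le> b - e")
  case True
  have "(\<Sum>s\<in>{a..<b}. nat (b - s - e) choose l) = (\<Sum>s\<in>{a..b - e}. nat (b - s - e) choose l)"
    using assms by (intro sum.mono_neutral_right) auto
  also have "\<dots> = (\<Sum>k\<le>nat (b - a - e). k choose l)"
    using True
    by (intro sum.reindex_bij_witness[of _ "\<lambda>k. b - e - int k" "\<lambda>s. nat (b - s - e)"]) auto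
  also have "\<dots> = Suc (nat (b - a - e)) choose Suc l"
    by (rule sum_choose_upper)
  also have "Suc (nat (b - a - e)) = nat (b - a - e + 1)"
    using True by simp
  finally show ?thesis .
next
  case False
  then have "(\<Sum>s\<in>{a..<b}. nat (b - s - e) choose l) = 0"
    using assms by (intro sum.neutral) auto
  then show ?thesis
    using False by simp
qed

lemma PiE_insert_iff:
  assumes "a \<notin> A"
  shows "f \<in> PiE (insert a A) B \<longleftrightarrow> f a \<in> B a \<and> f(a := undefined) \<in> PiE A B"
  using assms PiE_fun_upd[of "f a" B a "f(a := undefined)" A] by (auto intro: fun_upd_in_PiE)

lemma spaced_Cons_iff:
  assumes "x \<notin> set (w # ws)"
  shows "y \<in> spaced k1 k2 (x # w # ws) a b \<longleftrightarrow>
    y x \<in> {a..<b} \<and> y(x := undefined) \<in> spaced k1 k2 (w # ws) (y x + gap k1 k2 x w) b"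
proof -
  let ?R = "\<lambda>y u v. y u + gap k1 k2 u v \<le> y v" and ?y = "y(x := undefined)"
  have same: "sorted_wrt (?R ?y) (w # ws) \<longleftrightarrow> sorted_wrt (?R y) (w # ws)"
    using assms by (intro iffI; elim sorted_wrt_mono_rel[rotated]) (auto split: if_splits)
  have sorted: "sorted_wrt (?R y) (x # w # ws) \<longleftrightarrow> ?R y x w \<and> sorted_wrt (?R y) (w # ws)"
    by (rule sorted_wrt2[OF transp_gap])
  have least: "y w \<le> y v" if "sorted_wrt (?R y) (w # ws)" "v \<in> set (w # ws)" for v
    using that gap_pos[of k1 k2 w v] by fastforce
  have "?y \<in> set (w # ws) \<rightarrow>\<^sub>E {a..<b} \<longleftrightarrow> ?y \<in> set (w # ws) \<rightarrow>\<^sub>E {y x + gap k1 k2 x w..<b}"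
    if "y x \<in> {a..<b}" "?R y x w" "sorted_wrt (?R y) (w # ws)"
  proof -
    have "?y v \<in> {a..<b} \<longleftrightarrow> ?y v \<in> {y x + gap k1 k2 x w..<b}" if v: "v \<in> set (w # ws)" for v
      using least[OF \<open>sorted_wrt (?R y) (w # ws)\<close> v] \<open>y x \<in> {a..<b}\<close> \<open>?R y x w\<close>
        gap_pos[of k1 k2 x w]
        assms v by auto
    then show ?thesis
      unfolding PiE_iff by (intro conj_cong ball_cong refl)
  qed
  then have "y \<in> set (x # w # ws) \<rightarrow>\<^sub>E {a..<b} \<longleftrightarrow>
      y x \<in> {a..<b} \<and> ?y \<in> set (w # ws) \<rightarrow>\<^sub>E {y x + gap k1 k2 x w..<b}"
    if "?R y x w" "sorted_wrt (?R y) (w # ws)"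
    using that PiE_insert_iff[OF assms, of y "\<lambda>_. {a..<b}"] by (simp only: list.set(2)[of x]) blast
  moreover have "?R y x w" if "?y \<in> set (w # ws) \<rightarrow>\<^sub>E {y x + gap k1 k2 x w..<b}"
    using PiE_mem[OF that, of w] assms by auto
  ultimately show ?thesis
    unfolding spaced_def mem_Collect_eq sorted same by blast
qed

lemma card_spaced_Cons:
  assumes "x \<notin> set (w # ws)"
  shows "card (spaced k1 k2 (x # w # ws) a b)
    = (\<Sum>s\<in>{a..<b}. card (spaced k1 k2 (w # ws) (s + gap k1 k2 x w) b))"
proof -
  have "bij_betw (\<lambda>y. (y x, y(x := undefined))) (spaced k1 k2 (x # w # ws) a b)
      (SIGMA s:{a..<b}. spaced k1 k2 (w # ws) (s + gap k1 k2 x w) b)"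
  proof (rule bij_betw_byWitness[where f' = "\<lambda>(s, y). y(x := s)"])
    have "y(x := undefined) = y" if "y \<in> spaced k1 k2 (w # ws) c b" for y c
      using that assms by (intro fun_upd_idem) (auto simp: spaced_def intro: PiE_arb)
    then show "\<forall>p\<in>SIGMA s:{a..<b}. spaced k1 k2 (w # ws) (s + gap k1 k2 x w) b.
        (((\<lambda>(s, y). y(x := s)) p) x, ((\<lambda>(s, y). y(x := s)) p)(x := undefined)) = p"
      and "(\<lambda>(s, y). y(x := s)) ` (SIGMA s:{a..<b}. spaced k1 k2 (w # ws) (s + gap k1 k2 x w) b)
        \<subseteq> spaced k1 k2 (x # w # ws) a b"
      by (auto simp: spaced_Cons_iff[OF assms])
  qed (auto simp: spaced_Cons_iff[OF assms])
  from bij_betw_same_card[OF this] show ?thesis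
    by (simp add: card_SigmaI)
qed

lemma card_spaced:
  assumes "distinct xs" "xs \<noteq> []"
  shows "card (spaced k1 k2 xs a b)
    = nat (b - a - int k2 * (int (length xs) - 1) - int k1 * int (ascents xs)) choose length xs"
  using assms
proof (induction xs arbitrary: a rule: ascents.induct)
  case (1 x w ws)
  let ?l = "length (w # ws)"
  define e where "e = gap k1 k2 x w + int k2 * (int ?l - 1) + int k1 * int (ascents (w # ws))"
  have "0 \<le> int k2 * (int ?l - 1) + int k1 * int (ascents (w # ws))"
    by simp
  then have "1 \<le> e"
    using gap_pos[of k1 k2 x w] unfolding e_def by linarith
  have "card (spaced k1 k2 (w # ws) (s + gap k1 k2 x w) b) = nat (b - s - e) choose ?l" for s
    using "1.IH"[of "s + gap k1 k2 x w"] "1.prems" by (simp add: e_def algebra_simps)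
  then have "card (spaced k1 k2 (x # w # ws) a b) = (\<Sum>s\<in>{a..<b}. nat (b - s - e) choose ?l)"
    using "1.prems" by (subst card_spaced_Cons) auto
  also have "\<dots> = nat (b - a - e + 1) choose (Suc ?l)"
    by (rule sum_choose_int) (use \<open>1 \<le> e\<close> in auto)
  also have "b - a - e + 1
      = b - a - int k2 * (int (length (x # w # ws)) - 1) - int k1 * int (ascents (x # w # ws))"
    by (simp add: e_def gap_def algebra_simps)
  finally show ?case
    by simp
next
  case ("2_2" v)
  have "spaced k1 k2 [v] a b = {v} \<rightarrow>\<^sub>E {a..<b}"
    by (auto simp: spaced_def)
  then show ?case
    by (simp add: card_PiE)
qed simp

lemma separated_eq_Union_spaced:
  assumes "finite A"
  shows "{y \<in> A \<rightarrow>\<^sub>E {a..<b}. separated k1 k2 A y}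
      = (\<Union>xs\<in>permutations_of_set A. spaced k1 k2 xs a b)"
proof (intro equalityI subsetI)
  fix y assume y: "y \<in> {y \<in> A \<rightarrow>\<^sub>E {a..<b}. separated k1 k2 A y}"
  define xs where "xs = sort_key y (sorted_list_of_set A)"
  have xs: "set xs = A" "distinct xs" "sorted (map y xs)"
    using assms by (simp_all add: xs_def)
  have "sorted_wrt (\<lambda>u w. y u + gap k1 k2 u w \<le> y w) xs"
    unfolding sorted_wrt_iff_nth_less
  proof (intro allI impI)
    fix s t assume st: "s < t" "t < length xs"
    then have "xs ! s \<in> A" "xs ! t \<in> A" "xs ! s \<noteq> xs ! t" "y (xs ! s) \<le> y (xs ! t)"
      using xs sorted_nth_mono[OF xs(3), of s t] by (auto simp: nth_eq_iff_index_eq)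
    then show "y (xs ! s) + gap k1 k2 (xs ! s) (xs ! t) \<le> y (xs ! t)"
      using y gap_pos[of k1 k2 "xs ! t" "xs ! s"] by (fastforce simp: separated_def)
  qed
  then have "y \<in> spaced k1 k2 xs a b"
    using y xs(1) by (simp add: spaced_def)
  moreover have "xs \<in> permutations_of_set A"
    using xs by (simp add: permutations_of_set_def)
  ultimately show "y \<in> (\<Union>xs\<in>permutations_of_set A. spaced k1 k2 xs a b)"
    by blast
next
  fix y assume "y \<in> (\<Union>xs\<in>permutations_of_set A. spaced k1 k2 xs a b)"
  then obtain xs where xs: "set xs = A" and y: "y \<in> set xs \<rightarrow>\<^sub>E {a..<b}"
    and sorted: "sorted_wrt (\<lambda>u w. y u + gap k1 k2 u w \<le> y w) xs"
    by (auto simp: permutations_of_set_def spaced_def)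
  have "y u + gap k1 k2 u w \<le> y w \<or> y w + gap k1 k2 w u \<le> y u" if "u \<in> A" "w \<in> A" "u \<noteq> w" for u w
    using that sorted unfolding xs[symmetric] sorted_wrt_iff_nth_less in_set_conv_nth
    by (metis linorder_neqE_nat)
  then show "y \<in> {y \<in> A \<rightarrow>\<^sub>E {a..<b}. separated k1 k2 A y}"
    using y xs by (simp add: separated_def)
qed

lemma spaced_inj:
  assumes "y \<in> spaced k1 k2 xs a b" "y \<in> spaced k1 k2 ys a b" "set xs = set ys"
  shows "xs = ys"
proof -
  have strict: "sorted_wrt (<) (map y zs)" if "y \<in> spaced k1 k2 zs a b" for zs
    unfolding sorted_wrt_map
    by (rule sorted_wrt_mono_rel[of zs "\<lambda>u w. y u + gap k1 k2 u w \<le> y w"])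
      (use that in \<open>auto simp: spaced_def gap_def split: if_splits\<close>)
  then have "map y xs = map y ys"
    using assms by (intro strict_sorted_equal) auto
  moreover have "inj_on y (set xs \<union> set ys)"
    using strict[OF assms(1)] assms(3) by (simp add: strict_sorted_iff distinct_map)
  ultimately show ?thesis
    using inj_on_map_eq_map by blast
qed

lemma card_separated:
  assumes "finite A" "A \<noteq> {}"
  shows "card {y \<in> A \<rightarrow>\<^sub>E {a..<b}. separated k1 k2 A y}
    = (\<Sum>xs\<in>permutations_of_set A.
        nat (b - a - int k2 * (int (card A) - 1) - int k1 * int (ascents xs)) choose card A)"
proof -
  have "card {y \<in> A \<rightarrow>\<^sub>E {a..<b}. separated k1 k2 A y}
      = (\<Sum>xs\<in>permutations_of_set A. card (spaced k1 k2 xs a b))"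
    unfolding separated_eq_Union_spaced[OF assms(1)]
  proof (rule card_UN_disjoint)
    show "\<forall>xs\<in>permutations_of_set A. \<forall>ys\<in>permutations_of_set A.
        xs \<noteq> ys \<longrightarrow> spaced k1 k2 xs a b \<inter> spaced k1 k2 ys a b = {}"
      using spaced_inj by (fastforce simp: permutations_of_set_def)
  qed auto
  also have "\<dots> = (\<Sum>xs\<in>permutations_of_set A.
        nat (b - a - int k2 * (int (card A) - 1) - int k1 * int (ascents xs)) choose card A)"
  proof (intro sum.cong refl)
    fix xs assume xs: "xs \<in> permutations_of_set A"
    then have "distinct xs" "xs \<noteq> []" "length xs = card A"
      using assms(2) length_finite_permutations_of_set[OF xs]
      by (auto simp: permutations_of_set_def)
    then show "card (spaced k1 k2 xs a b)
        = nat (b - a - int k2 * (int (card A) - 1) - int k1 * int (ascents xs)) choose card A"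
      using card_spaced[of xs k1 k2 a b] by simp
  qed
  finally show ?thesis .
qed

lemma avoids_interval_mod_iff:
  fixes a b d q :: int
  assumes "-q < d" "d < q" "-q < a" "b < q"
  shows "(\<forall>g\<in>{a..b}. \<not> q dvd d - g) \<longleftrightarrow> d \<notin> {a..b} \<and> d + q \<notin> {a..b} \<and> d - q \<notin> {a..b}"
proof
  assume L: "\<forall>g\<in>{a..b}. \<not> q dvd d - g"
  have "q dvd d - d" "q dvd d - (d + q)" "q dvd d - (d - q)"
    by simp_all
  then show "d \<notin> {a..b} \<and> d + q \<notin> {a..b} \<and> d - q \<notin> {a..b}"
    using L by blast
next
  assume R: "d \<notin> {a..b} \<and> d + q \<notin> {a..b} \<and> d - q \<notin> {a..b}"
  show "\<forall>g\<in>{a..b}. \<not> q dvd d - g"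
  proof (intro ballI notI)
    fix g assume g: "g \<in> {a..b}" and "q dvd d - g"
    then obtain t where t: "d - g = q * t"
      by (auto elim: dvdE)
    have "0 < q"
      using assms by linarith
    moreover have "q * t < q * 2" "q * (-2) < q * t"
      using t g assms unfolding atLeastAtMost_iff by linarith+
    ultimately have "t < 2" "-2 < t"
      using mult_less_cancel_left_pos[of q] by blast+
    then consider "t = 0" | "t = 1" | "t = -1"
      by linarith
    then show False
      using t g R by cases (auto simp: algebra_simps)
  qed
qed

lemma gain_coloring_iff:
  assumes q: "int k1 + int k2 < q" and x: "x \<in> {1..Suc j} \<rightarrow>\<^sub>E {0..<q}" "x (Suc j) = 0"
  shows "x \<in> colorings (Suc j) q {} (gain_edges (Suc j) (- int k2) (int k1 + int k2)) \<longleftrightarrow>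
    (\<forall>i\<in>{1..j}. x i \<in> {int k2 + 1..<q - int k1 - int k2}) \<and> separated k1 k2 {1..j} x"
proof -
  let ?I = "{- int k2..int k1 + int k2}"
  let ?avoids = "\<lambda>d. d \<notin> ?I \<and> d + q \<notin> ?I \<and> d - q \<notin> ?I"
  have range: "0 \<le> x i \<and> x i < q" if "i \<in> {1..Suc j}" for i
    using PiE_mem[OF x(1) that] by simp
  have "x \<in> colorings (Suc j) q {} (gain_edges (Suc j) (- int k2) (int k1 + int k2)) \<longleftrightarrow>
      (\<forall>i\<in>{1..Suc j}. \<forall>k\<in>{1..Suc j}. i < k \<longrightarrow> (\<forall>g\<in>?I. \<not> q dvd (x k - x i) - g))"
    using x(1) by (fastforce simp: colorings_def satisfies_mod_def defect_def gain_edges_def)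
  also have "\<dots> \<longleftrightarrow> (\<forall>i\<in>{1..Suc j}. \<forall>k\<in>{1..Suc j}. i < k \<longrightarrow> ?avoids (x k - x i))"
  proof (intro ball_cong imp_cong refl avoids_interval_mod_iff)
    fix i k assume "i \<in> {1..Suc j}" "k \<in> {1..Suc j}"
    then show "- q < x k - x i" "x k - x i < q"
      using range[of i] range[of k] by auto
  qed (use q in auto)
  also have "\<dots> \<longleftrightarrow> (\<forall>i\<in>{1..j}. ?avoids (- x i)) \<and> (\<forall>i\<in>{1..j}. \<forall>k\<in>{1..j}. i < k \<longrightarrow> ?avoids (x k - x i))"
    using x(2) by (auto simp: atLeastAtMostSuc_conv)
  also have "\<dots> \<longleftrightarrow> (\<forall>i\<in>{1..j}. x i \<in> {int k2 + 1..<q - int k1 - int k2}) \<and> separated k1 k2 {1..j} x"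
  proof (intro conj_cong ball_cong refl)
    fix i assume "i \<in> {1..j}"
    then show "?avoids (- x i) \<longleftrightarrow> x i \<in> {int k2 + 1..<q - int k1 - int k2}"
      using range[of i] by auto
  next
    assume R: "\<forall>i\<in>{1..j}. x i \<in> {int k2 + 1..<q - int k1 - int k2}"
    have "?avoids (x k - x i) \<longleftrightarrow> x i + gap k1 k2 i k \<le> x k \<or> x k + gap k1 k2 k i \<le> x i"
      if "i \<in> {1..j}" "k \<in> {1..j}" "i < k" for i k
    proof -
      have "x i \<in> {int k2 + 1..<q - int k1 - int k2}" "x k \<in> {int k2 + 1..<q - int k1 - int k2}"
        using R that by blast+
      then show ?thesis
        using that(3) by (auto simp: gap_def)
    qed
    then show "(\<forall>i\<in>{1..j}. \<forall>k\<in>{1..j}. i < k \<longrightarrow> ?avoids (x k - x i)) \<longleftrightarrow> separated k1 k2 {1..j} x"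
      unfolding separated_def by (metis linorder_neqE_nat less_irrefl)
  qed
  finally show ?thesis .
qed

lemma based_gain_coloring_iff:
  assumes q: "int k1 + int k2 < q"
  shows "x \<in> colorings (Suc j) q {} (gain_edges (Suc j) (- int k2) (int k1 + int k2))
      \<and> x (Suc j) = 0
    \<longleftrightarrow> x (Suc j) = 0 \<and> x(Suc j := undefined) \<in> {1..j} \<rightarrow>\<^sub>E {int k2 + 1..<q - int k1 - int k2}
      \<and> separated k1 k2 {1..j} (x(Suc j := undefined))"
proof -
  let ?n = "Suc j" and ?I = "{int k2 + 1..<q - int k1 - int k2}"
  let ?x = "x(?n := undefined)"
  have same: "?x i = x i" if "i \<in> {1..j}" for i
    using that by simp
  have "x \<in> {1..?n} \<rightarrow>\<^sub>E {0..<q} \<longleftrightarrow> x ?n \<in> {0..<q} \<and> ?x \<in> {1..j} \<rightarrow>\<^sub>E {0..<q}"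
    using PiE_insert_iff[of ?n "{1..j}" x "\<lambda>_. {0..<q}"] by (simp add: atLeastAtMostSuc_conv)
  moreover have "(\<forall>i\<in>{1..j}. x i \<in> ?I) \<longleftrightarrow> (\<forall>i\<in>{1..j}. ?x i \<in> ?I)"
    by (intro ball_cong refl) (simp only: same)
  moreover have "separated k1 k2 {1..j} x \<longleftrightarrow> separated k1 k2 {1..j} ?x"
    unfolding separated_def by (intro ball_cong refl) (simp only: same)
  moreover have "?x \<in> {1..j} \<rightarrow>\<^sub>E {0..<q} \<and> (\<forall>i\<in>{1..j}. ?x i \<in> ?I) \<longleftrightarrow> ?x \<in> {1..j} \<rightarrow>\<^sub>E ?I"
  proof -
    have "?I \<subseteq> {0..<q}"
      by auto
    then show ?thesis
      unfolding PiE_iff by blast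
  qed
  moreover have "0 \<in> {0..<q}"
    using q by simp
  ultimately show ?thesis
    using gain_coloring_iff[OF q, of x j] unfolding colorings_def by (smt (verit) mem_Collect_eq)
qed

lemma card_based_gain_colorings:
  assumes q: "int k1 + int k2 < q"
  shows "card {x \<in> colorings (Suc j) q {} (gain_edges (Suc j) (- int k2) (int k1 + int k2)).
      x (Suc j) = 0}
    = card {y \<in> {1..j} \<rightarrow>\<^sub>E {int k2 + 1..<q - int k1 - int k2}. separated k1 k2 {1..j} y}"
    (is "card ?A = card ?B")
proof -
  let ?n = "Suc j"
  have A: "x \<in> ?A \<longleftrightarrow> x ?n = 0 \<and> x(?n := undefined) \<in> ?B" for x
    using based_gain_coloring_iff[OF q] by blast
  have "bij_betw (\<lambda>y. y(?n := 0)) ?B ?A"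
  proof (rule bij_betw_byWitness[where f' = "\<lambda>x. x(?n := undefined)"])
    have "y(?n := undefined) = y" if "y \<in> ?B" for y
      using that by (intro fun_upd_idem) (auto simp: PiE_def extensional_def)
    then show "\<forall>y\<in>?B. (y(?n := 0))(?n := undefined) = y" "(\<lambda>y. y(?n := 0)) ` ?B \<subseteq> ?A"
      unfolding image_subset_iff A by simp_all
    show "\<forall>x\<in>?A. (x(?n := undefined))(?n := 0) = x"
      by (simp add: fun_upd_idem)
    show "(\<lambda>x. x(?n := undefined)) ` ?A \<subseteq> ?B"
      using A by blast
  qed
  then show ?thesis
    by (rule bij_betw_same_card[symmetric])
qed

lemma edges_within_gain_edges: "edges_within n (gain_edges n a b)"
  by (auto simp: edges_within_def gain_edges_def)

theorem coloring_invariant_gain_edges: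
  assumes "n = Suc j" "1 \<le> j" and q: "int (n * k2 + n * k1 + 1) \<le> q"
  shows "coloring_invariant n q {} (gain_edges n (- int k2) (int k1 + int k2))
    = stirling_sum k1 j (\<lambda>_. 1) (\<lambda>s. (1 - of_int q) + of_nat (n * k2 + k1) + of_nat s)"
proof -
  let ?C = "colorings n q {} (gain_edges n (- int k2) (int k1 + int k2))"
  let ?Z = "\<lambda>xs. q - 1 - int (n * k2) - int k1 - int k1 * int (ascents xs)"
  have "k1 \<le> n * k1" "k2 \<le> n * k2"
    using assms(1) by auto
  then have large: "int k1 + int k2 < q" "0 < q"
    using q by linarith+
  have "card ?C = nat q * card {x \<in> ?C. x n = 0}"
    using large assms(1) edges_within_gain_edges by (intro card_colorings_based) auto
  also have "card {x \<in> ?C. x n = 0} = (\<Sum>xs\<in>permutations_of_set {1..j}. nat (?Z xs) choose j)"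
    using card_based_gain_colorings[OF large(1), of j]
      card_separated[of "{1..j}" "int k2 + 1" _ k1 k2] assms(1,2)
    by (simp add: algebra_simps)
  finally have card: "real (card ?C)
      = of_int q * (\<Sum>xs\<in>permutations_of_set {1..j}. real (nat (?Z xs) choose j))"
    using large by simp
  have count: "real (nat (?Z xs) choose j)
      = (- 1) ^ j * multichoose ((1 - of_int q) + of_nat (n * k2 + k1)
          + of_nat k1 * of_nat (ascents xs)) j"
    if xs: "xs \<in> permutations_of_set {1..j}" for xs
  proof -
    have "ascents xs \<le> j"
      using ascents_le_length[of xs] length_finite_permutations_of_set[OF xs] by simp
    then have "k1 * (ascents xs + 1) \<le> k1 * n"
      using assms(1) by (intro mult_left_mono) auto
    then have "int (k1 * (ascents xs + 1)) \<le> int (n * k1)"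
      by (simp only: of_nat_le_iff mult.commute[of n])
    then have "0 \<le> ?Z xs"
      using q by (simp add: algebra_simps)
    then show ?thesis
      using gbinomial_eq_multichoose[of "real (nat (?Z xs))" j]
      by (simp add: binomial_gbinomial algebra_simps)
  qed
  have "real (card ?C) = of_int q * ((- 1) ^ j * (\<Sum>xs\<in>permutations_of_set {1..j}.
      multichoose ((1 - of_int q) + of_nat (n * k2 + k1) + of_nat k1 * of_nat (ascents xs)) j))"
    unfolding card sum_distrib_left[of "(- 1) ^ j"]
    by (intro arg_cong2[where f = "(*)"] sum.cong refl count)
  then show ?thesis
    using large(2) assms(1)
      sum_multichoose_ascents[of "{1..j}" "(1 - of_int q) + of_nat (n * k2 + k1) :: real" k1]
    by (simp add: coloring_invariant_def)
qed

section \<open>Cells of the arrangement\<close>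

definition slope :: "(nat \<Rightarrow> real) \<Rightarrow> gedge \<Rightarrow> real" where
  "slope v e = v (tgt e) - v (src e)"

definition cell :: "gedge set \<Rightarrow> gedge set \<Rightarrow> gedge set \<Rightarrow> (nat \<Rightarrow> real) set" where
  "cell D E S = {x. (\<forall>e\<in>D. defect x e = 0) \<and> (\<forall>e\<in>S. defect x e < 0) \<and> (\<forall>e\<in>E - S. 0 < defect x e)}"

definition recession_cone :: "gedge set \<Rightarrow> gedge set \<Rightarrow> gedge set \<Rightarrow> (nat \<Rightarrow> real) set" where
  "recession_cone D E S
      = {v. (\<forall>e\<in>D. slope v e = 0) \<and> (\<forall>e\<in>S. slope v e \<le> 0) \<and> (\<forall>e\<in>E - S. 0 \<le> slope v e)}"

text \<open>Boundedness is meant modulo translations along the diagonal.\<close>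

definition bounded_diffs :: "nat \<Rightarrow> (nat \<Rightarrow> real) set \<Rightarrow> bool" where
  "bounded_diffs n C \<longleftrightarrow> (\<exists>M. \<forall>x\<in>C. \<forall>i\<in>{1..n}. \<forall>j\<in>{1..n}. x j - x i \<le> M)"

definition bounded_cell :: "nat \<Rightarrow> (nat \<Rightarrow> real) set \<Rightarrow> bool" where
  "bounded_cell n C \<longleftrightarrow> C \<noteq> {} \<and> bounded_diffs n C"

definition bounded_signs :: "nat \<Rightarrow> gedge set \<Rightarrow> gedge set \<Rightarrow> gedge set set" where
  "bounded_signs n D E = {S. S \<subseteq> E \<and> bounded_cell n (cell D E S)}"

lemma defect_add_mult: "defect (\<lambda>i. x i + t * v i) e = defect x e + t * slope v e"
  by (simp add: defect_def slope_def algebra_simps)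

lemma slope_linear: "slope (\<lambda>i. a * v i + b * w i) e = a * slope v e + b * slope w e"
  by (simp add: slope_def algebra_simps)

lemma not_constant_onE:
  fixes v :: "'a \<Rightarrow> real"
  assumes "\<not> v constant_on A"
  obtains i j where "i \<in> A" "j \<in> A" "v i < v j"
  using assms unfolding constant_on_def by (metis linorder_neqE)

lemma slope_constant_on:
  "v constant_on {1..n} \<Longrightarrow> src e \<in> {1..n} \<Longrightarrow> tgt e \<in> {1..n} \<Longrightarrow> slope v e = 0"
  by (auto simp: constant_on_def slope_def)

lemma spanning_imp_constant_on:
  assumes "spanning n S" "\<And>f. f \<in> S \<Longrightarrow> slope v f = 0"
  shows "v constant_on {1..n}"
proof (rule ccontr)
  assume "\<not> v constant_on {1..n}"
  then obtain i j where ij: "i \<in> {1..n}" "j \<in> {1..n}" "v i < v j"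
    by (rule not_constant_onE)
  then have "linked S i j"
    using assms(1) by (simp add: spanning_def)
  then have "v i = v j"
    by (rule linked_invariant[where P = "\<lambda>u. v i = v u"]) (use assms(2) in \<open>auto simp: slope_def\<close>)
  then show False
    using ij(3) by simp
qed

subsection \<open>Recession directions and boundedness\<close>

lemma cell_add_recession:
  assumes "x \<in> cell D E S" "v \<in> recession_cone D E S" "0 \<le> t"
  shows "(\<lambda>i. x i + t * v i) \<in> cell D E S"
proof -
  have "t * slope v e \<le> 0" if "e \<in> S" for e
    using assms that by (intro mult_nonneg_nonpos) (auto simp: recession_cone_def)
  moreover have "0 \<le> t * slope v e" if "e \<in> E - S" for e
    using assms that by (intro mult_nonneg_nonneg) (auto simp: recession_cone_def)
  ultimately show ?thesis
    using assms(1,2) by (auto simp: cell_def recession_cone_def defect_add_mult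
        intro: add_neg_nonpos add_pos_nonneg)
qed

lemma unbounded_if_recession:
  assumes x: "x \<in> cell D E S" and v: "v \<in> recession_cone D E S" "\<not> v constant_on {1..n}"
  shows "\<not> bounded_diffs n (cell D E S)"
proof
  assume "bounded_diffs n (cell D E S)"
  then obtain M where M: "\<And>y i j. y \<in> cell D E S \<Longrightarrow> i \<in> {1..n} \<Longrightarrow> j \<in> {1..n} \<Longrightarrow> y j - y i \<le> M"
    unfolding bounded_diffs_def by blast
  obtain i j where ij: "i \<in> {1..n}" "j \<in> {1..n}" "v i < v j"
    using v(2) by (rule not_constant_onE)
  define t where "t = (\<bar>M\<bar> + \<bar>x j - x i\<bar> + 1) / (v j - v i)"
  have "0 \<le> t" "t * (v j - v i) = \<bar>M\<bar> + \<bar>x j - x i\<bar> + 1"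
    using ij(3) by (simp_all add: t_def)
  moreover have "(x j + t * v j) - (x i + t * v i) \<le> M"
    using M[OF cell_add_recession[OF x v(1) \<open>0 \<le> t\<close>] ij(1,2)] .
  then have "(x j - x i) + t * (v j - v i) \<le> M"
    by (simp add: algebra_simps)
  ultimately show False
    by linarith
qed

definition constraint_rel :: "gedge set \<Rightarrow> gedge set \<Rightarrow> gedge set \<Rightarrow> (nat \<times> nat) set" where
  "constraint_rel D E S =
     {(src e, tgt e) | e. e \<in> D \<union> S} \<union> {(tgt e, src e) | e. e \<in> D \<union> (E - S)}"

lemma diff_le_along_constraints:
  assumes "(i, j) \<in> (constraint_rel D E S)\<^sup>*"
  shows "\<exists>M. \<forall>x\<in>cell D E S. x j - x i \<le> M"
  using assms
proof induction
  case base
  then show ?case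
    by auto
next
  case (step j k)
  obtain e where e: "e \<in> D \<union> S \<and> j = src e \<and> k = tgt e \<or> e \<in> D \<union> (E - S) \<and> j = tgt e \<and> k = src e"
    using step.hyps(2) unfolding constraint_rel_def by blast
  have edge: "x k - x j \<le> \<bar>real_of_int (gain e)\<bar>" if "x \<in> cell D E S" for x
  proof -
    have "e \<in> D \<union> S \<Longrightarrow> defect x e \<le> 0" "e \<in> D \<union> (E - S) \<Longrightarrow> 0 \<le> defect x e"
      using that by (auto simp: cell_def less_imp_le)
    then show ?thesis
      using e by (auto simp: defect_def)
  qed
  obtain M where "\<forall>x\<in>cell D E S. x j - x i \<le> M"
    using step.IH by auto
  then have "\<forall>x\<in>cell D E S. x k - x i \<le> M + \<bar>real_of_int (gain e)\<bar>"
    using edge by force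
  then show ?case
    by blast
qed

lemma bounded_diffs_if_all_reachable:
  assumes "\<And>i j. i \<in> {1..n} \<Longrightarrow> j \<in> {1..n} \<Longrightarrow> (i, j) \<in> (constraint_rel D E S)\<^sup>*"
  shows "bounded_diffs n (cell D E S)"
proof -
  have "\<forall>i\<in>{1..n}. \<forall>j\<in>{1..n}. \<exists>M. \<forall>x\<in>cell D E S. x j - x i \<le> M"
    using assms diff_le_along_constraints by blast
  then obtain M where M: "x j - x i \<le> M i j"
    if "i \<in> {1..n}" "j \<in> {1..n}" "x \<in> cell D E S" for i j x
    by metis
  define B where "B = (\<Sum>p\<in>{1..n} \<times> {1..n}. \<bar>M (fst p) (snd p)\<bar>)"
  have "M i j \<le> B" if "i \<in> {1..n}" "j \<in> {1..n}" for i j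
    using member_le_sum[of "(i, j)" "{1..n} \<times> {1..n}" "\<lambda>p. \<bar>M (fst p) (snd p)\<bar>"] that
    by (auto simp: B_def)
  then show ?thesis
    unfolding bounded_diffs_def using M by (meson order_trans)
qed

text \<open>If the constraints do not bound \<open>x j - x i\<close>, then minus the indicator of the vertices reachable
  from \<open>i\<close> is a direction of recession.\<close>

lemma bounded_diffs_if_recession_constant:
  assumes "S \<subseteq> E" and const: "\<And>v. v \<in> recession_cone D E S \<Longrightarrow> v constant_on {1..n}"
  shows "bounded_diffs n (cell D E S)"
proof (rule bounded_diffs_if_all_reachable, rule ccontr)
  fix i j assume ij: "i \<in> {1..n}" "j \<in> {1..n}" "(i, j) \<notin> (constraint_rel D E S)\<^sup>*"
  define v where "v = (\<lambda>u. - of_bool ((i, u) \<in> (constraint_rel D E S)\<^sup>*) :: real)"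
  have decreasing: "v b \<le> v a" if "(a, b) \<in> constraint_rel D E S" for a b
    using that by (auto simp: v_def intro: rtrancl_into_rtrancl)
  have "slope v e \<le> 0" if "e \<in> D \<union> S" for e
  proof -
    have "(src e, tgt e) \<in> constraint_rel D E S"
      using that unfolding constraint_rel_def by blast
    then show ?thesis
      using decreasing by (simp add: slope_def)
  qed
  moreover have "0 \<le> slope v e" if "e \<in> D \<union> (E - S)" for e
  proof -
    have "(tgt e, src e) \<in> constraint_rel D E S"
      using that unfolding constraint_rel_def by blast
    then show ?thesis
      using decreasing by (simp add: slope_def)
  qed
  ultimately have "v \<in> recession_cone D E S"
    by (auto simp: recession_cone_def intro: order_antisym)
  then have "v constant_on {1..n}"
    by (rule const)
  then have "v i = v j"
    using ij(1,2) by (auto simp: constant_on_def)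
  then show False
    using ij(3) by (simp add: v_def)
qed

lemma bounded_cell_iff:
  assumes "S \<subseteq> E" "cell D E S \<noteq> {}"
  shows "bounded_cell n (cell D E S) \<longleftrightarrow> (\<forall>v\<in>recession_cone D E S. v constant_on {1..n})"
  using assms(2) bounded_diffs_if_recession_constant[OF assms(1)] unbounded_if_recession[of _ D E S]
  unfolding bounded_cell_def by (metis ex_in_conv)

subsection \<open>Cutting a cell by a hyperplane\<close>

definition component_indicator :: "gedge set \<Rightarrow> nat \<Rightarrow> nat \<Rightarrow> real" where
  "component_indicator S u w = of_bool (linked S u w)"

lemma slope_component_indicator: "f \<in> S \<Longrightarrow> slope (component_indicator S u) f = 0"
  using linked_edge[of f S] unfolding component_indicator_def slope_def
  by (auto intro: linked_trans linked_sym)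

lemma slope_component_indicator_cut:
  "\<not> linked S (src e) (tgt e) \<Longrightarrow> slope (component_indicator S (tgt e)) e = 1"
  unfolding component_indicator_def slope_def using linked_sym[of S "tgt e" "src e"] by auto

lemma circle_free_potential:
  assumes "finite D" "circle_free D"
  shows "\<exists>x :: nat \<Rightarrow> real. \<forall>e\<in>D. defect x e = 0"
  using assms
proof (induction D)
  case (insert e D)
  then obtain x :: "nat \<Rightarrow> real" where x: "\<forall>f\<in>D. defect x f = 0"
    by (auto simp: circle_free_insert_iff)
  have "\<not> linked D (src e) (tgt e)"
    using insert by (simp add: circle_free_insert_iff)
  then have "\<forall>f\<in>insert e D. defect (\<lambda>i. x i + (- defect x e) * component_indicator D (tgt e) i) f = 0"
    unfolding defect_add_mult
    using x slope_component_indicator slope_component_indicator_cut by auto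
  then show ?case
    by blast
qed simp

lemma cell_insert:
  assumes "e \<notin> E" "S \<subseteq> E"
  shows "cell D (insert e E) (insert e S) = {x \<in> cell D E S. defect x e < 0}"
    and "cell D (insert e E) S = {x \<in> cell D E S. 0 < defect x e}"
    and "cell (insert e D) E S = {x \<in> cell D E S. defect x e = 0}"
proof -
  have "insert e E - insert e S = E - S" "insert e E - S = insert e (E - S)"
    using assms by auto
  then show "cell D (insert e E) (insert e S) = {x \<in> cell D E S. defect x e < 0}"
    "cell D (insert e E) S = {x \<in> cell D E S. 0 < defect x e}"
    "cell (insert e D) E S = {x \<in> cell D E S. defect x e = 0}"
    by (auto simp: cell_def)
qed

lemma recession_cone_insert:
  assumes "e \<notin> E" "S \<subseteq> E"
  shows "recession_cone D (insert e E) (insert e S) = {v \<in> recession_cone D E S. slope v e \<le> 0}"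
    and "recession_cone D (insert e E) S = {v \<in> recession_cone D E S. 0 \<le> slope v e}"
    and "recession_cone (insert e D) E S = {v \<in> recession_cone D E S. slope v e = 0}"
proof -
  have "insert e E - insert e S = E - S" "insert e E - S = insert e (E - S)"
    using assms by auto
  then show "recession_cone D (insert e E) (insert e S) = {v \<in> recession_cone D E S. slope v e \<le> 0}"
    "recession_cone D (insert e E) S = {v \<in> recession_cone D E S. 0 \<le> slope v e}"
    "recession_cone (insert e D) E S = {v \<in> recession_cone D E S. slope v e = 0}"
    by (auto simp: recession_cone_def)
qed

lemma eventually_cell:
  assumes "finite E" "S \<subseteq> E" and x: "x \<in> cell D E S" and v: "\<And>e. e \<in> D \<Longrightarrow> slope v e = 0"
  shows "\<forall>\<^sub>F t in nhds 0. (\<lambda>i. x i + t * v i) \<in> cell D E S"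
proof -
  have lim: "((\<lambda>t. defect (\<lambda>i. x i + t * v i) e) \<longlongrightarrow> defect x e) (nhds 0)" for e
    unfolding defect_add_mult by (auto intro!: tendsto_eq_intros filterlim_ident)
  have "\<forall>\<^sub>F t in nhds 0. \<forall>e\<in>S. defect (\<lambda>i. x i + t * v i) e < 0"
    using assms x order_tendstoD(2)[OF lim] finite_subset
    by (intro eventually_ball_finite) (auto simp: cell_def)
  moreover have "\<forall>\<^sub>F t in nhds 0. \<forall>e\<in>E - S. 0 < defect (\<lambda>i. x i + t * v i) e"
    using assms x order_tendstoD(1)[OF lim]
    by (intro eventually_ball_finite) (auto simp: cell_def)
  ultimately show ?thesis
    by eventually_elim (use x v in \<open>auto simp: cell_def defect_add_mult\<close>)
qed

lemma cell_perturb: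
  assumes "finite E" "S \<subseteq> E" "\<not> linked D (src e) (tgt e)" and x: "x \<in> cell D E S" "defect x e = 0"
  shows "\<exists>y\<in>cell D E S. defect y e < 0" and "\<exists>y\<in>cell D E S. 0 < defect y e"
proof -
  let ?v = "component_indicator D (tgt e)"
  have "\<forall>\<^sub>F t in nhds 0. (\<lambda>i. x i + t * ?v i) \<in> cell D E S"
    by (rule eventually_cell[OF assms(1,2) x(1)]) (rule slope_component_indicator)
  then obtain \<epsilon> :: real where "0 < \<epsilon>" and \<epsilon>: "\<bar>t\<bar> < \<epsilon> \<Longrightarrow> (\<lambda>i. x i + t * ?v i) \<in> cell D E S" for t
    by (auto simp: eventually_nhds_metric dist_real_def)
  have defect: "defect (\<lambda>i. x i + t * ?v i) e = t" for t
    using x(2) slope_component_indicator_cut[OF assms(3)] by (simp only: defect_add_mult)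
  show "\<exists>y\<in>cell D E S. defect y e < 0"
    using \<epsilon>[of "- \<epsilon> / 2"] defect[of "- \<epsilon> / 2"] \<open>0 < \<epsilon>\<close> by (intro bexI) auto
  show "\<exists>y\<in>cell D E S. 0 < defect y e"
    using \<epsilon>[of "\<epsilon> / 2"] defect[of "\<epsilon> / 2"] \<open>0 < \<epsilon>\<close> by (intro bexI) auto
qed

lemma cell_between:
  assumes x: "x \<in> cell D E S" "defect x e < 0" and y: "y \<in> cell D E S" "0 < defect y e"
  shows "\<exists>z\<in>cell D E S. defect z e = 0"
proof -
  define t where "t = - defect x e / (defect y e - defect x e)"
  have t: "0 < t" "t < 1"
    using x(2) y(2) by (auto simp: t_def field_simps)
  define z where "z = (\<lambda>i. (1 - t) * x i + t * y i)"
  have z: "defect z f = (1 - t) * defect x f + t * defect y f" for f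
    by (simp add: defect_def z_def algebra_simps)
  have "(1 - t) * defect x f + t * defect y f < 0" if "f \<in> S" for f
    using x y t that by (intro add_neg_neg mult_pos_neg) (auto simp: cell_def)
  moreover have "0 < (1 - t) * defect x f + t * defect y f" if "f \<in> E - S" for f
    using x y t that by (intro add_pos_pos mult_pos_pos) (auto simp: cell_def)
  ultimately have "z \<in> cell D E S"
    using x y by (auto simp: cell_def z)
  moreover have "defect z e = defect x e + t * (defect y e - defect x e)"
    by (simp add: z algebra_simps)
  then have "defect z e = 0"
    using x(2) y(2) by (simp add: t_def)
  ultimately show ?thesis
    by blast
qed

lemma nonneg_combination_eq_0:
  fixes a b s t :: real
  assumes "0 < a" "0 \<le> b" "s \<le> 0 \<and> t \<le> 0 \<or> 0 \<le> s \<and> 0 \<le> t" "a * s + b * t = 0"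
  shows "s = 0"
proof -
  have "a * s \<le> 0 \<and> b * t \<le> 0 \<or> 0 \<le> a * s \<and> 0 \<le> b * t"
    using assms(1-3) by (auto simp: mult_nonneg_nonpos)
  then have "a * s = 0"
    using assms(4) by linarith
  then show ?thesis
    using assms(1) by simp
qed

text \<open>A positive combination of two directions leaving the hyperplane on opposite sides stays inside
  it.\<close>

lemma recession_opposite:
  assumes v: "v \<in> recession_cone D E S" "0 < slope v e"
    and w: "w \<in> recession_cone D E S" "slope w e < 0"
    and "\<not> v constant_on {1..n}" and span: "spanning n (D \<union> E)" and within: "edges_within n (D \<union> E)"
  shows "\<exists>u\<in>recession_cone D E S. slope u e = 0 \<and> \<not> u constant_on {1..n}"
proof -
  define u where "u = (\<lambda>i. (- slope w e) * v i + slope v e * w i)"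
  have u: "slope u f = (- slope w e) * slope v f + slope v e * slope w f" for f
    unfolding u_def by (rule slope_linear)
  have "slope u f \<le> 0" if "f \<in> S" for f
    unfolding u using v w that
    by (intro add_nonpos_nonpos mult_nonneg_nonpos) (auto simp: recession_cone_def)
  moreover have "0 \<le> slope u f" if "f \<in> E - S" for f
    unfolding u using v w that
    by (intro add_nonneg_nonneg mult_nonneg_nonneg) (auto simp: recession_cone_def)
  moreover have "slope u f = 0" if "f \<in> D" for f
    unfolding u using v w that by (simp add: recession_cone_def)
  ultimately have "u \<in> recession_cone D E S"
    by (simp add: recession_cone_def)
  moreover have "\<not> u constant_on {1..n}"
  proof
    assume "u constant_on {1..n}"
    have "slope v f = 0" if f: "f \<in> D \<union> E" for f
    proof (rule nonneg_combination_eq_0[of "- slope w e" "slope v e"])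
      have "slope u f = 0"
        using \<open>u constant_on {1..n}\<close> f within
        by (intro slope_constant_on) (auto simp: edges_within_def)
      then show "(- slope w e) * slope v f + slope v e * slope w f = 0"
        by (simp only: u)
      show "slope v f \<le> 0 \<and> slope w f \<le> 0 \<or> 0 \<le> slope v f \<and> 0 \<le> slope w f"
        using v w f by (cases "f \<in> S"; cases "f \<in> D") (auto simp: recession_cone_def)
    qed (use v(2) w(2) in simp_all)
    then show False
      using spanning_imp_constant_on[OF span] assms(5) by blast
  qed
  moreover have "slope u e = 0"
    by (simp add: u)
  ultimately show ?thesis
    by blast
qed

lemma bounded_cell_cut_empty:
  assumes "e \<notin> E" "S \<subseteq> E" and empty: "cell (insert e D) E S = {}"
  shows "of_bool (bounded_cell n (cell D (insert e E) (insert e S)))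
      + of_bool (bounded_cell n (cell D (insert e E) S))
    = (of_bool (bounded_cell n (cell D E S)) :: nat)"
proof -
  note cells = cell_insert[OF assms(1,2), of D]
  have "cell D (insert e E) (insert e S) = {} \<or> cell D (insert e E) S = {}"
    using cell_between empty unfolding cells by blast
  moreover have "cell D E S = cell D (insert e E) (insert e S) \<union> cell D (insert e E) S"
    using empty unfolding cells by (auto simp: not_less_iff_gr_or_eq)
  ultimately show ?thesis
    by (auto simp: bounded_cell_def)
qed

lemma bounded_cell_cut:
  assumes fin: "finite E" and "e \<notin> E" "S \<subseteq> E" and unlinked: "\<not> linked D (src e) (tgt e)"
    and span: "spanning n (D \<union> E)" and within: "edges_within n (D \<union> E)"
  shows "of_bool (bounded_cell n (cell D (insert e E) (insert e S)))
      + of_bool (bounded_cell n (cell D (insert e E) S))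
    = (of_bool (bounded_cell n (cell D E S))
        + of_bool (bounded_cell n (cell (insert e D) E S)) :: nat)"
proof (cases "cell (insert e D) E S = {}")
  case True
  then show ?thesis
    using bounded_cell_cut_empty[OF assms(2,3) True] by (simp add: bounded_cell_def)
next
  case False
  let ?neg = "cell D (insert e E) (insert e S)" and ?pos = "cell D (insert e E) S"
  note cells = cell_insert[OF assms(2,3), of D]
    and cones = recession_cone_insert[OF assms(2,3), of D]
  have nonempty: "?neg \<noteq> {}" "?pos \<noteq> {}" "cell D E S \<noteq> {}"
    using False cell_perturb[OF fin assms(3) unlinked] unfolding cells by blast+
  have neg: "bounded_cell n ?neg \<longleftrightarrow> (\<forall>v\<in>recession_cone D E S. slope v e \<le> 0 \<longrightarrow> v constant_on {1..n})"
    using bounded_cell_iff[OF _ nonempty(1)] assms(3) by (auto simp: cones)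
  have pos: "bounded_cell n ?pos \<longleftrightarrow> (\<forall>v\<in>recession_cone D E S. 0 \<le> slope v e \<longrightarrow> v constant_on {1..n})"
    using bounded_cell_iff[OF _ nonempty(2)] assms(3) by (auto simp: cones)
  have cut: "bounded_cell n (cell (insert e D) E S) \<longleftrightarrow>
      (\<forall>v\<in>recession_cone D E S. slope v e = 0 \<longrightarrow> v constant_on {1..n})"
    using bounded_cell_iff[OF assms(3) False] by (auto simp: cones)
  have "bounded_cell n (cell D E S) \<longleftrightarrow> (\<forall>v\<in>recession_cone D E S. v constant_on {1..n})"
    by (rule bounded_cell_iff[OF assms(3) nonempty(3)])
  then have whole: "bounded_cell n (cell D E S) \<longleftrightarrow> bounded_cell n ?neg \<and> bounded_cell n ?pos"
    unfolding neg pos by (meson linear)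
  have "bounded_cell n (cell (insert e D) E S) \<longleftrightarrow> bounded_cell n ?neg \<or> bounded_cell n ?pos"
  proof
    assume bounded: "bounded_cell n (cell (insert e D) E S)"
    show "bounded_cell n ?neg \<or> bounded_cell n ?pos"
    proof (rule ccontr)
      assume "\<not> (bounded_cell n ?neg \<or> bounded_cell n ?pos)"
      then obtain v w where v: "v \<in> recession_cone D E S" "0 \<le> slope v e" "\<not> v constant_on {1..n}"
        and w: "w \<in> recession_cone D E S" "slope w e \<le> 0" "\<not> w constant_on {1..n}"
        unfolding neg pos by blast
      then have "0 < slope v e" "slope w e < 0"
        using bounded unfolding cut by (metis order_less_le)+
      then show False
        using recession_opposite[OF v(1) _ w(1) _ v(3) span within] bounded unfolding cut by blast
    qed
  qed (auto simp: neg pos cut)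
  then show ?thesis
    using whole by simp
qed

subsection \<open>The number of bounded cells\<close>

lemma card_bounded_signs:
  assumes "finite E"
  shows "card (bounded_signs n D E) = (\<Sum>S\<in>Pow E. of_bool (bounded_cell n (cell D E S)))"
proof -
  have "bounded_signs n D E = {S \<in> Pow E. bounded_cell n (cell D E S)}"
    by (auto simp: bounded_signs_def)
  then show ?thesis
    using assms by (simp add: Int_def)
qed

lemma card_bounded_signs_insert:
  assumes "finite E" "e \<notin> E"
  shows "card (bounded_signs n D (insert e E)) = (\<Sum>S\<in>Pow E.
      of_bool (bounded_cell n (cell D (insert e E) (insert e S)))
      + of_bool (bounded_cell n (cell D (insert e E) S)))"
proof -
  let ?f = "\<lambda>S. of_bool (bounded_cell n (cell D (insert e E) S)) :: nat"
  have "card (bounded_signs n D (insert e E)) = sum ?f (Pow E \<union> insert e ` Pow E)"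
    using assms(1) by (simp only: card_bounded_signs finite_insert Pow_insert)
  also have "\<dots> = sum ?f (Pow E) + sum ?f (insert e ` Pow E)"
    by (rule sum.union_disjoint) (use assms in auto)
  also have "sum ?f (insert e ` Pow E) = (\<Sum>S\<in>Pow E. ?f (insert e S))"
    by (subst sum.reindex) (use assms(2) in \<open>auto simp: inj_on_def\<close>)
  finally show ?thesis
    by (simp only: sum.distrib add.commute)
qed

lemma bounded_signs_spanning_tree:
  assumes "finite D" "circle_free D" "spanning n D"
  shows "bounded_signs n D {} = {{}}"
proof -
  obtain x :: "nat \<Rightarrow> real" where "\<forall>e\<in>D. defect x e = 0"
    using circle_free_potential[OF assms(1,2)] by blast
  then have "cell D {} {} \<noteq> {}"
    by (auto simp: cell_def)
  moreover have "bounded_diffs n (cell D {} {})"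
    using spanning_imp_constant_on[OF assms(3)]
    by (intro bounded_diffs_if_recession_constant) (auto simp: recession_cone_def)
  ultimately show ?thesis
    by (auto simp: bounded_signs_def bounded_cell_def)
qed

lemma subtraction_closed_zero: "subtraction_closed (\<lambda>a :: 'a::ab_group_add. a = 0)"
  by (simp add: subtraction_closed_def)

lemma bounded_signs_balanced:
  assumes "balanced_by D e" "src e \<noteq> tgt e" "e \<notin> E"
  shows "bounded_signs n D (insert e E) = {}"
proof -
  have "defect x e = 0" if "x \<in> cell D (insert e E) S" for x S
    using balanced_by_defect[OF assms(1,2) subtraction_closed_zero] that by (auto simp: cell_def)
  moreover have "defect x e \<noteq> 0" if "x \<in> cell D (insert e E) S" for x S
  proof -
    have "e \<in> S \<Longrightarrow> defect x e < 0" "e \<in> insert e E - S \<Longrightarrow> 0 < defect x e"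
      using that unfolding cell_def by blast+
    then show ?thesis
      by (cases "e \<in> S") auto
  qed
  ultimately have "cell D (insert e E) S = {}" for S
    by blast
  then show ?thesis
    by (simp add: bounded_signs_def bounded_cell_def)
qed

lemma card_bounded_signs_unbalanced:
  assumes "linked D (src e) (tgt e)" "\<not> balanced_by D e" "src e \<noteq> tgt e"
    "finite D" "finite E" "e \<notin> D" "e \<notin> E"
  shows "card (bounded_signs n D (insert e E)) = card (bounded_signs n D E)"
proof -
  obtain g where "g \<noteq> 0" and iff: "\<And>P x. subtraction_closed P \<Longrightarrow>
      (\<And>f. f \<in> D \<Longrightarrow> P (defect (x :: nat \<Rightarrow> real) f)) \<Longrightarrow> P (defect x e) \<longleftrightarrow> P (of_int g)"
    using linked_unbalanced_defect[OF assms(1-4,6), where 'a = real] by metis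
  have "defect x e \<noteq> 0" if "\<forall>f\<in>D. defect x f = 0" for x :: "nat \<Rightarrow> real"
    using iff[OF subtraction_closed_zero, of x] that \<open>g \<noteq> 0\<close> by simp
  then have "cell (insert e D) E S = {}" for S
    by (auto simp: cell_def)
  then show ?thesis
    unfolding card_bounded_signs_insert[OF assms(5,7)] card_bounded_signs[OF assms(5)]
    by (intro sum.cong refl bounded_cell_cut_empty assms(7)) auto
qed

lemma card_bounded_signs_ordinary:
  assumes "finite E" "e \<notin> E" "\<not> linked D (src e) (tgt e)" "spanning n (D \<union> E)"
    "edges_within n (D \<union> E)"
  shows "card (bounded_signs n D (insert e E))
      = card (bounded_signs n D E) + card (bounded_signs n (insert e D) E)"
  unfolding card_bounded_signs_insert[OF assms(1,2)] card_bounded_signs[OF assms(1)]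
    sum.distrib[symmetric]
  by (intro sum.cong refl bounded_cell_cut assms) simp

lemma bounded_signs_isthmus:
  assumes "e \<notin> E" "edges_within n {e}" and isthmus: "\<not> linked (D \<union> E) (src e) (tgt e)"
  shows "bounded_signs n D (insert e E) = {}"
proof -
  let ?v = "component_indicator (D \<union> E) (tgt e)"
  have cut: "slope ?v e = 1"
    by (rule slope_component_indicator_cut[OF isthmus])
  have slope: "slope (\<lambda>i. a * ?v i) f = a * slope ?v f" for a f
    by (simp add: slope_def algebra_simps)
  have "\<not> bounded_diffs n (cell D (insert e E) S)"
    if "S \<subseteq> insert e E" "cell D (insert e E) S \<noteq> {}" for S
  proof -
    define a :: real where "a = (if e \<in> S then -1 else 1)"
    have "(\<lambda>i. a * ?v i) \<in> recession_cone D (insert e E) S"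
      using cut slope_component_indicator[of _ "D \<union> E" "tgt e"] that(1)
      by (auto simp: recession_cone_def slope a_def)
    moreover have "\<not> (\<lambda>i. a * ?v i) constant_on {1..n}"
    proof
      assume "(\<lambda>i. a * ?v i) constant_on {1..n}"
      then have "slope (\<lambda>i. a * ?v i) e = 0"
        using assms(2) by (intro slope_constant_on) (auto simp: edges_within_def)
      then show False
        using cut by (simp add: slope a_def split: if_splits)
    qed
    ultimately show ?thesis
      using that(2) unbounded_if_recession by blast
  qed
  then show ?thesis
    by (auto simp: bounded_signs_def bounded_cell_def)
qed

theorem card_bounded_signs_eq_activity_poly:
  assumes minor: "gain_minor n ord D E"
  shows "card (bounded_signs n D E) = activity_poly n ord D E 0"
proof (rule activity_poly_unique[OF minor order_refl])
  show "card (bounded_signs n D' {}) = 1" if "gain_minor n ord D' {}" for D'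
    using that bounded_signs_spanning_tree by (simp add: gain_minor_def)
  fix D' E' e assume removable: "removable n ord D' E' e"
  note rem = removableD[OF removable]
  show "card (bounded_signs n D' (insert e E')) = 0" if "balanced_by D' e"
    using bounded_signs_balanced[OF that rem(6,2)] by simp
  show "card (bounded_signs n D' (insert e E')) = card (bounded_signs n D' E')"
    if "linked D' (src e) (tgt e)" "\<not> balanced_by D' e"
    by (rule card_bounded_signs_unbalanced[OF that rem(6,3,4,1,2)])
  show "card (bounded_signs n D' (insert e E'))
      = card (bounded_signs n D' E') + card (bounded_signs n (insert e D') E')"
    if "\<not> linked D' (src e) (tgt e)" "linked (D' \<union> E') (src e) (tgt e)"
    using gain_minor_delete[OF removable that(2)] rem
    by (intro card_bounded_signs_ordinary that(1)) (auto simp: gain_minor_def)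
  show "card (bounded_signs n D' (insert e E')) = 0 * card (bounded_signs n (insert e D') E')"
    if "\<not> linked (D' \<union> E') (src e) (tgt e)"
    using bounded_signs_isthmus[OF rem(2) _ that] rem(5) by (simp add: edges_within_def)
qed

section \<open>Regions as connected components\<close>

definition coords :: "(nat \<Rightarrow> 'n::finite) \<Rightarrow> real ^ 'n \<Rightarrow> nat \<Rightarrow> real" where
  "coords idx x i = x $ idx i"

definition region :: "(nat \<Rightarrow> 'n::finite) \<Rightarrow> gedge set \<Rightarrow> gedge set \<Rightarrow> (real ^ 'n) set" where
  "region idx E S = {x \<in> sum_zero_space. coords idx x \<in> cell {} E S}"

definition arr_complement :: "(nat \<Rightarrow> 'n::finite) \<Rightarrow> gedge set \<Rightarrow> (real ^ 'n) set" where
  "arr_complement idx E = sum_zero_space - \<Union> (arr_hyperplanes idx E)"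

definition negative_edges :: "(nat \<Rightarrow> 'n::finite) \<Rightarrow> gedge set \<Rightarrow> real ^ 'n \<Rightarrow> gedge set" where
  "negative_edges idx E x = {e \<in> E. defect (coords idx x) e < 0}"

lemma mem_arr_complement:
  "x \<in> arr_complement idx E \<longleftrightarrow> x \<in> sum_zero_space \<and> (\<forall>e\<in>E. defect (coords idx x) e \<noteq> 0)"
proof -
  have "x \<in> \<Union> (arr_hyperplanes idx E) \<longleftrightarrow> (\<exists>i j g. (i, j, g) \<in> E \<and> x $ idx j - x $ idx i = of_int g)"
    unfolding arr_hyperplanes_def by blast
  also have "\<dots> \<longleftrightarrow> (\<exists>e\<in>E. defect (coords idx x) e = 0)"
    by (simp add: Bex_def split_paired_Ex defect_def coords_def)
  finally show ?thesis
    unfolding arr_complement_def by blast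
qed

lemma defect_coords_convex:
  "defect (coords idx ((1 - t) *\<^sub>R x + t *\<^sub>R y)) e
    = (1 - t) * defect (coords idx x) e + t * defect (coords idx y) e"
  by (simp add: defect_def coords_def algebra_simps)

lemma continuous_defect_coords: "continuous_on A (\<lambda>x. defect (coords idx x) e)"
  unfolding defect_def coords_def by (intro continuous_intros)

lemma convex_region: "convex (region idx E S)"
  unfolding convex_alt
proof (intro ballI allI impI)
  fix x y t assume x: "x \<in> region idx E S" and y: "y \<in> region idx E S"
    and t: "0 \<le> t \<and> t \<le> (1::real)"
  let ?z = "(1 - t) *\<^sub>R x + t *\<^sub>R y"
  have "?z \<in> sum_zero_space"
    using x y by (simp add: region_def sum_zero_space_def sum.distrib sum_distrib_left[symmetric])
  moreover have "(1 - t) * a + t * b < 0" if "a < 0" "b < 0" for a b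
    using that t by (intro convex_bound_lt) auto
  moreover have "0 < (1 - t) * a + t * b" if "0 < a" "0 < b" for a b
    using convex_bound_lt[of "- a" 0 "- b" "1 - t" t] that t by auto
  ultimately show "?z \<in> region idx E S"
    using x y by (auto simp: region_def cell_def defect_coords_convex)
qed

lemma mem_region_iff:
  assumes "S \<subseteq> E"
  shows "x \<in> region idx E S \<longleftrightarrow> x \<in> arr_complement idx E \<and> S = negative_edges idx E x"
proof
  assume x: "x \<in> region idx E S"
  have neg: "defect (coords idx x) e < 0" if "e \<in> S" for e
    using x that unfolding region_def cell_def by blast
  have pos: "0 < defect (coords idx x) e" if "e \<in> E - S" for e
    using x that unfolding region_def cell_def by blast
  have "defect (coords idx x) e \<noteq> 0 \<and> (e \<in> S \<longleftrightarrow> defect (coords idx x) e < 0)" if "e \<in> E" for e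
    using neg[of e] pos[of e] that by (cases "e \<in> S") auto
  then show "x \<in> arr_complement idx E \<and> S = negative_edges idx E x"
    using x assms by (auto simp: mem_arr_complement negative_edges_def region_def)
next
  assume x: "x \<in> arr_complement idx E \<and> S = negative_edges idx E x"
  then have "0 < defect (coords idx x) e" if "e \<in> E - S" for e
    using that by (force simp: mem_arr_complement negative_edges_def)
  then show "x \<in> region idx E S"
    using x by (auto simp: region_def cell_def mem_arr_complement negative_edges_def)
qed

lemma connected_component_same_sign:
  fixes f :: "'a::topological_space \<Rightarrow> real"
  assumes "continuous_on W f" and nonzero: "\<And>z. z \<in> W \<Longrightarrow> f z \<noteq> 0" and y: "connected_component W x y"
  shows "f y < 0 \<longleftrightarrow> f x < 0"
proof (rule ccontr)
  obtain T where T: "connected T" "T \<subseteq> W" "x \<in> T" "y \<in> T"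
    using y by (auto simp: connected_component_def)
  have "connected (f ` T)"
    using connected_continuous_image continuous_on_subset assms(1) T(1,2) by blast
  then have "{f x..f y} \<subseteq> f ` T" "{f y..f x} \<subseteq> f ` T"
    using T(3,4) by (intro connected_contains_Icc; blast)+
  moreover assume "\<not> (f y < 0 \<longleftrightarrow> f x < 0)"
  then have "0 \<in> {f x..f y} \<union> {f y..f x}"
    by auto
  ultimately show False
    using nonzero T(2) by (metis UnE imageE subsetD)
qed

lemma component_eq_region:
  assumes x: "x \<in> arr_complement idx E"
  shows "connected_component_set (arr_complement idx E) x = region idx E (negative_edges idx E x)"
proof
  have sub: "negative_edges idx E z \<subseteq> E" for z
    by (auto simp: negative_edges_def)
  show "region idx E (negative_edges idx E x) \<subseteq> connected_component_set (arr_complement idx E) x"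
    using x by (intro connected_component_maximal convex_connected convex_region)
      (auto simp: mem_region_iff[OF sub])
  show "connected_component_set (arr_complement idx E) x \<subseteq> region idx E (negative_edges idx E x)"
  proof
    fix y assume y: "y \<in> connected_component_set (arr_complement idx E) x"
    have "defect (coords idx y) e < 0 \<longleftrightarrow> defect (coords idx x) e < 0" if "e \<in> E" for e
      using that y
      by (intro connected_component_same_sign[OF continuous_defect_coords])
        (auto simp: mem_arr_complement)
    then have "negative_edges idx E x = negative_edges idx E y"
      by (auto simp: negative_edges_def)
    then show "y \<in> region idx E (negative_edges idx E x)"
      using y connected_component_subset unfolding mem_region_iff[OF sub] by blast
  qed
qed

lemma arr_regions_eq:
  "arr_regions sum_zero_space (arr_hyperplanes idx E)
      = region idx E ` {S. S \<subseteq> E \<and> region idx E S \<noteq> {}}"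
proof -
  have "arr_regions sum_zero_space (arr_hyperplanes idx E)
      = (\<lambda>x. region idx E (negative_edges idx E x)) ` arr_complement idx E"
    unfolding arr_regions_def arr_complement_def[symmetric] setcompr_eq_image Collect_mem_eq
    by (intro image_cong refl component_eq_region)
  also have "\<dots> = region idx E ` {S. S \<subseteq> E \<and> region idx E S \<noteq> {}}"
  proof (intro equalityI image_subsetI)
    fix x assume "x \<in> arr_complement idx E"
    moreover have "negative_edges idx E x \<subseteq> E"
      by (auto simp: negative_edges_def)
    moreover from this have "x \<in> region idx E (negative_edges idx E x)"
      using mem_region_iff[of "negative_edges idx E x" E x idx] calculation by simp
    ultimately show "region idx E (negative_edges idx E x)
        \<in> region idx E ` {S. S \<subseteq> E \<and> region idx E S \<noteq> {}}"
      by blast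
  next
    fix S assume S: "S \<in> {S. S \<subseteq> E \<and> region idx E S \<noteq> {}}"
    then obtain x where "x \<in> region idx E S"
      by blast
    then have "x \<in> arr_complement idx E" "S = negative_edges idx E x"
      using S mem_region_iff[of S E x idx] by simp_all
    then show "region idx E S \<in> (\<lambda>x. region idx E (negative_edges idx E x)) ` arr_complement idx E"
      by blast
  qed
  finally show ?thesis .
qed

lemma inj_on_region: "inj_on (region idx E) {S. S \<subseteq> E \<and> region idx E S \<noteq> {}}"
proof (rule inj_onI)
  fix S T
  assume S: "S \<in> {S. S \<subseteq> E \<and> region idx E S \<noteq> {}}" and T: "T \<in> {S. S \<subseteq> E \<and> region idx E S \<noteq> {}}"
    and "region idx E S = region idx E T"
  then obtain x where "x \<in> region idx E S" "x \<in> region idx E T"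
    by auto
  then show "S = T"
    using S T mem_region_iff[of S E x idx] mem_region_iff[of T E x idx] by simp
qed

subsection \<open>Bounded regions\<close>

lemma cell_lift:
  fixes idx :: "nat \<Rightarrow> 'n::finite"
  assumes bij: "bij_betw idx {1..n} UNIV" and within: "edges_within n E"
    and y: "y \<in> cell {} E S" and "S \<subseteq> E"
  obtains x where "x \<in> region idx E S"
    "\<And>i j. i \<in> {1..n} \<Longrightarrow> j \<in> {1..n} \<Longrightarrow> coords idx x j - coords idx x i = y j - y i"
proof -
  define vertex where "vertex = inv_into {1..n} idx"
  define mean where "mean = (\<Sum>k\<in>UNIV. y (vertex k)) / real CARD('n)"
  define x :: "real ^ 'n" where "x = (\<chi> k. y (vertex k) - mean)"
  have coords: "coords idx x i = y i - mean" if "i \<in> {1..n}" for i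
    using bij that by (simp add: coords_def x_def vertex_def bij_betw_def inv_into_f_f)
  then have "defect (coords idx x) e = defect y e" if "e \<in> E" for e
    using within that by (simp add: defect_def edges_within_def)
  then have "coords idx x \<in> cell {} E S"
    using y \<open>S \<subseteq> E\<close> unfolding cell_def by (auto simp: subset_iff)
  moreover have "x \<in> sum_zero_space"
    by (simp add: sum_zero_space_def x_def sum_subtractf mean_def)
  ultimately show ?thesis
    using that[of x] coords by (simp add: region_def)
qed

lemma bounded_region_imp_bounded_diffs:
  fixes idx :: "nat \<Rightarrow> 'n::finite"
  assumes "bij_betw idx {1..n} UNIV" "edges_within n E" "S \<subseteq> E" "bounded (region idx E S)"
  shows "bounded_diffs n (cell {} E S)"
proof -
  obtain B where B: "\<And>x. x \<in> region idx E S \<Longrightarrow> norm x \<le> B"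
    using assms(4) by (auto simp: bounded_iff)
  have "y j - y i \<le> 2 * B" if y: "y \<in> cell {} E S" and ij: "i \<in> {1..n}" "j \<in> {1..n}" for y i j
  proof -
    obtain x where x: "x \<in> region idx E S" "coords idx x j - coords idx x i = y j - y i"
      using cell_lift[OF assms(1,2) y assms(3)] ij by metis
    have "\<bar>x $ idx j\<bar> \<le> B" "\<bar>x $ idx i\<bar> \<le> B"
      using component_le_norm_cart[of x] B[OF x(1)] by (meson order_trans)+
    then show ?thesis
      using x(2) by (simp add: coords_def)
  qed
  then show ?thesis
    unfolding bounded_diffs_def by blast
qed

lemma sum_zero_space_component_le:
  fixes x :: "real ^ 'n::finite"
  assumes "x \<in> sum_zero_space" and diff: "\<And>k l. x $ k - x $ l \<le> M"
  shows "\<bar>x $ k\<bar> \<le> M"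
proof -
  have zero: "(\<Sum>l\<in>UNIV. x $ l) = 0"
    using assms(1) by (simp add: sum_zero_space_def)
  have "(\<Sum>l\<in>(UNIV :: 'n set). x $ k - x $ l) \<le> (\<Sum>l\<in>(UNIV :: 'n set). M)"
    "(\<Sum>l\<in>(UNIV :: 'n set). x $ l - x $ k) \<le> (\<Sum>l\<in>(UNIV :: 'n set). M)"
    by (intro sum_mono diff)+
  then have "real CARD('n) * x $ k \<le> real CARD('n) * M"
    "real CARD('n) * - x $ k \<le> real CARD('n) * M"
    by (simp_all add: sum_subtractf zero)
  then have "x $ k \<le> M" "- x $ k \<le> M"
    by (simp_all only: mult_le_cancel_left_pos of_nat_0_less_iff zero_less_card_finite)
  then show ?thesis
    by simp
qed

lemma bounded_diffs_imp_bounded_region: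
  fixes idx :: "nat \<Rightarrow> 'n::finite"
  assumes "bij_betw idx {1..n} UNIV" "bounded_diffs n (cell {} E S)"
  shows "bounded (region idx E S)"
proof -
  obtain M where M: "\<And>y i j. y \<in> cell {} E S \<Longrightarrow> i \<in> {1..n} \<Longrightarrow> j \<in> {1..n} \<Longrightarrow> y j - y i \<le> M"
    using assms(2) unfolding bounded_diffs_def by blast
  have "norm x \<le> real CARD('n) * M" if x: "x \<in> region idx E S" for x
  proof -
    have "x $ k - x $ l \<le> M" for k l
    proof -
      obtain i j where "i \<in> {1..n}" "j \<in> {1..n}" "idx i = l" "idx j = k"
        using assms(1) by (metis UNIV_I bij_betw_imp_surj_on imageE)
      then show ?thesis
        using M[of "coords idx x" i j] x by (auto simp: region_def coords_def)
    qed
    then have "\<bar>x $ k\<bar> \<le> M" for k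
      using x by (intro sum_zero_space_component_le) (simp add: region_def)
    then have "(\<Sum>k\<in>UNIV. \<bar>x $ k\<bar>) \<le> (\<Sum>k\<in>(UNIV :: 'n set). M)"
      by (intro sum_mono)
    then show ?thesis
      using norm_le_l1_cart[of x] by simp
  qed
  then show ?thesis
    unfolding bounded_iff by blast
qed

theorem num_bounded_regions_eq:
  fixes idx :: "nat \<Rightarrow> 'n::finite"
  assumes bij: "bij_betw idx {1..n} UNIV" and within: "edges_within n E"
  shows "num_bounded_regions idx E = card (bounded_signs n {} E)"
proof -
  have nonempty: "region idx E S \<noteq> {} \<longleftrightarrow> cell {} E S \<noteq> {}" if sub: "S \<subseteq> E" for S
  proof
    assume "cell {} E S \<noteq> {}"
    then obtain y where y: "y \<in> cell {} E S"
      by blast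
    obtain x where "x \<in> region idx E S"
      by (rule cell_lift[OF bij within y sub])
    then show "region idx E S \<noteq> {}"
      by blast
  qed (auto simp: region_def)
  have bounded: "bounded (region idx E S) \<longleftrightarrow> bounded_diffs n (cell {} E S)" if "S \<subseteq> E" for S
    using bounded_region_imp_bounded_diffs[OF bij within that]
      bounded_diffs_imp_bounded_region[OF bij]
    by blast
  have signs: "bounded_signs n {} E
      = {S \<in> {S. S \<subseteq> E \<and> region idx E S \<noteq> {}}. bounded (region idx E S)}"
    unfolding bounded_signs_def bounded_cell_def using nonempty bounded by blast
  have "{R \<in> arr_regions (sum_zero_space :: (real ^ 'n) set) (arr_hyperplanes idx E). bounded R}
      = region idx E ` bounded_signs n {} E"
    unfolding arr_regions_eq signs by blast
  moreover have "inj_on (region idx E) (bounded_signs n {} E)"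
    by (rule inj_on_subset[OF inj_on_region]) (auto simp: signs)
  ultimately show ?thesis
    by (simp add: num_bounded_regions_def card_image)
qed

section \<open>Comparison of the two polynomials\<close>

lemma card_eq_if_power_sums_eq:
  fixes X :: "'c::{idom,ring_char_0} set" and f :: "'a \<Rightarrow> nat" and g :: "'b \<Rightarrow> nat"
  assumes "finite A" "finite B" "infinite X"
    and eq: "\<And>y. y \<in> X \<Longrightarrow> (\<Sum>a\<in>A. y ^ f a) = (\<Sum>b\<in>B. y ^ g b)"
  shows "card {a \<in> A. f a = k} = card {b \<in> B. g b = k}"
proof -
  define P :: "'c poly" where "P = (\<Sum>a\<in>A. monom 1 (f a))"
  define R :: "'c poly" where "R = (\<Sum>b\<in>B. monom 1 (g b))"
  have "poly (P - R) y = 0" if "y \<in> X" for y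
    using eq[OF that] by (simp add: P_def R_def poly_sum poly_monom)
  then have "P - R = 0"
    using poly_roots_finite[of "P - R"] assms(3) finite_subset[of X "{y. poly (P - R) y = 0}"]
    by blast
  then have "coeff P k = coeff R k"
    by simp
  moreover have "coeff P k = of_nat (card {a \<in> A. f a = k})"
    "coeff R k = of_nat (card {b \<in> B. g b = k})"
    using assms(1,2)
    by (simp_all add: P_def R_def coeff_sum coeff_monom if_distrib sum.If_cases Int_def conj_commute)
  ultimately show ?thesis
    by simp
qed

lemma activity_poly_0:
  assumes "finite D" "finite E"
  shows "activity_poly n ord D E 0 = card {B \<in> minor_bases n ord D E. minor_activity ord E B = 0}"
proof -
  have "activity_poly n ord D E 0
      = (\<Sum>B\<in>minor_bases n ord D E. of_bool (minor_activity ord E B = 0) :: nat)"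
    unfolding activity_poly_def by (intro sum.cong) (auto simp: power_0_left)
  then show ?thesis
    using finite_minor_bases[OF assms] by (simp add: Int_def)
qed

lemma finite_gain_edges: "finite (gain_edges n a b)"
  by (rule finite_subset[of _ "{1..n} \<times> {1..n} \<times> {a..b}"]) (auto simp: gain_edges_def)

lemma loopless_gain_edges: "loopless (gain_edges n a b)"
  by (auto simp: loopless_def gain_edges_def)

lemma spanning_gain_edges:
  assumes "a \<le> 0" "0 \<le> b"
  shows "spanning n (gain_edges n a b)"
  unfolding spanning_def
proof (intro ballI)
  fix u v assume uv: "u \<in> {1..n}" "v \<in> {1..n}"
  have "linked (gain_edges n a b) s t" if "s \<in> {1..n}" "t \<in> {1..n}" "s < t" for s t
    using linked_edge[of "(s, t, 0)" "gain_edges n a b"] that assms by (auto simp: gain_edges_def)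
  then show "linked (gain_edges n a b) u v"
    using uv linked_sym by (cases u v rule: linorder_cases) auto
qed

lemma gain_minor_gain_edges:
  assumes "a \<le> 0" "0 \<le> b" "inj_on ord (gain_edges n a b)"
  shows "gain_minor n ord {} (gain_edges n a b)"
  using assms spanning_gain_edges finite_gain_edges loopless_gain_edges edges_within_gain_edges
  by (simp add: gain_minor_def)

theorem card_minor_bases_eq_card_decreasing_trees:
  fixes n k1 k2 :: nat
  defines "E \<equiv> gain_edges n (- int k2) (int k1 + int k2)"
  assumes "2 \<le> n" and minor: "gain_minor n ord {} E"
  shows "card {B \<in> minor_bases n ord {} E. minor_activity ord E B = \<alpha>}
    = card {T. decreasing_tree n (k1 + 1) k2 T \<and> n_root_color1_edges n T = \<alpha>}"
proof -
  define Q where "Q = max (int (n * k2 + n * k1 + 1)) ((\<Sum>f\<in>E. \<bar>gain f\<bar>) + 1)"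
  let ?X = "(\<lambda>q. 1 - real_of_int q) ` {Q..}"
  obtain j where j: "n = Suc j" "1 \<le> j"
    using \<open>2 \<le> n\<close> by (cases n) auto
  have "infinite ?X"
    by (auto simp: finite_image_iff inj_on_def infinite_Ici)
  moreover have "(\<Sum>B\<in>minor_bases n ord {} E. y ^ minor_activity ord E B)
      = (\<Sum>T | decreasing_tree n (k1 + 1) k2 T. y ^ n_root_color1_edges n T)" if y: "y \<in> ?X" for y
  proof -
    obtain q where q: "y = 1 - real_of_int q" "int (n * k2 + n * k1 + 1) \<le> q"
      "(\<Sum>f\<in>{} \<union> E. \<bar>gain f\<bar>) < q"
      using y by (auto simp: Q_def)
    have "activity_poly n ord {} E y = coloring_invariant n q {} E"
      unfolding q(1) using j
      by (intro coloring_invariant_eq_activity_poly[OF minor _ q(3), symmetric]) simp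
    also have "\<dots> = stirling_sum k1 j (\<lambda>_. 1) (\<lambda>s. y + of_nat (n * k2 + k1) + of_nat s)"
      unfolding q(1) E_def by (rule coloring_invariant_gain_edges[OF j q(2)])
    also have "\<dots> = (\<Sum>T | decreasing_tree n (k1 + 1) k2 T. y ^ n_root_color1_edges n T)"
      by (rule decreasing_tree_polynomial[OF j(1), symmetric])
    finally show ?thesis
      by (simp add: activity_poly_def)
  qed
  ultimately show ?thesis
    using card_eq_if_power_sums_eq[of "minor_bases n ord {} E"
        "{T. decreasing_tree n (k1 + 1) k2 T}" ?X "minor_activity ord E" "n_root_color1_edges n" \<alpha>]
      finite_minor_bases finite_decreasing_trees minor
    by (simp add: gain_minor_def)
qed

theorem theorem4p3:
  fixes n k1 k2 \<alpha> :: nat and ord :: "gedge \<Rightarrow> nat" and idx :: "nat \<Rightarrow> 'n::finite"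
  assumes "2 \<le> n" and "\<alpha> \<le> n - 1"
    and "inj_on ord (gain_edges n (- int k2) (int k1 + int k2))"
    and "bij_betw idx {1..n} (UNIV :: 'n set)"
  shows "card {B. nbc_basis n (gain_edges n (- int k2) (int k1 + int k2)) ord B \<and>
                  activity n (gain_edges n (- int k2) (int k1 + int k2)) ord B = \<alpha>}
         = card {T. decreasing_tree n (k1 + 1) k2 T \<and> n_root_color1_edges n T = \<alpha>}
       \<and> num_bounded_regions idx (gain_edges n (- int k2) (int k1 + int k2))
         = card {T. decreasing_tree n (k1 + 1) k2 T \<and> n_root_color1_edges n T = 0}"
proof
  let ?E = "gain_edges n (- int k2) (int k1 + int k2)"
  have minor: "gain_minor n ord {} ?E"
    using assms(3) by (intro gain_minor_gain_edges) auto
  note count = card_minor_bases_eq_card_decreasing_trees[OF assms(1) minor]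
  have "{B. nbc_basis n ?E ord B \<and> activity n ?E ord B = \<alpha>}
      = {B \<in> minor_bases n ord {} ?E. minor_activity ord ?E B = \<alpha>}"
    using nbc_basis_iff_minor_basis[OF loopless_gain_edges assms(3)]
      activity_eq_minor_activity[OF loopless_gain_edges edges_within_gain_edges] by auto
  then show "card {B. nbc_basis n ?E ord B \<and> activity n ?E ord B = \<alpha>}
      = card {T. decreasing_tree n (k1 + 1) k2 T \<and> n_root_color1_edges n T = \<alpha>}"
    by (simp only: count)
  have "num_bounded_regions idx ?E = card (bounded_signs n {} ?E)"
    by (rule num_bounded_regions_eq[OF assms(4) edges_within_gain_edges])
  also have "\<dots> = card {B \<in> minor_bases n ord {} ?E. minor_activity ord ?E B = 0}"
    by (simp add: card_bounded_signs_eq_activity_poly[OF minor] activity_poly_0 finite_gain_edges)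
  finally show "num_bounded_regions idx ?E
      = card {T. decreasing_tree n (k1 + 1) k2 T \<and> n_root_color1_edges n T = 0}"
    by (simp only: count)
qed

end
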